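(* Let $k\ge 3$ be an integer and let $r<\log k/k$ (natural logarithm), $r>0$. Then \[ \lim_{n\to\infty}\Pr\bigl(1_k(\lfloor rn\rfloor,n)\text{ is satisfiable}\bigr)=1 . \]
   Context: Positive 1-in-$k$-SAT: given $n$ boolean variables $x_1,\dots,x_n$, a constraint is a $k$-tuple of variables $(x_{i_1},\dots,x_{i_k})$, satisfied by an assignment $\sigma:\{x_1,\dots,x_n\}\to\{0,1\}$ iff exactly one coordinate $j$ has $\sigma(x_{i_j})=1$. An instance is satisfiable iff some assignment satisfies all its constraints. $1_k(m,n)$ denotes the random instance on $n$ variables formed by drawing $m$ constraints independently, uniformly at random and with replacement, each being a uniformly random ordered $k$-tuple of the $n$ variables. *)

theory Defs
  imports "HOL-Probability.Probability"
begin

definition constraints :: "nat \<Rightarrow> nat \<Rightarrow> nat list set" where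
  "constraints k n = {c. length c = k \<and> set c \<subseteq> {..<n}}"

definition instances :: "nat \<Rightarrow> nat \<Rightarrow> nat \<Rightarrow> nat list list set" where
  "instances k m n = {cs. length cs = m \<and> (\<forall>c\<in>set cs. c \<in> constraints k n)}"

definition sat_constraint :: "(nat \<Rightarrow> bool) \<Rightarrow> nat list \<Rightarrow> bool" where
  "sat_constraint \<sigma> c \<longleftrightarrow> card {j. j < length c \<and> \<sigma> (c ! j)} = 1"

definition satisfiable :: "nat list list \<Rightarrow> bool" where
  "satisfiable cs \<longleftrightarrow> (\<exists>\<sigma>. \<forall>c\<in>set cs. sat_constraint \<sigma> c)"

text \<open>The random instance 1_k(m,n): m constraints drawn independently, uniformly, with
replacement; equivalently the uniform distribution on all length-m lists of constraints.\<close>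
definition random_instance :: "nat \<Rightarrow> nat \<Rightarrow> nat \<Rightarrow> nat list list pmf" where
  "random_instance k m n = pmf_of_set (instances k m n)"

definition prob_sat :: "nat \<Rightarrow> nat \<Rightarrow> nat \<Rightarrow> real" where
  "prob_sat k m n = measure_pmf.prob (random_instance k m n) {cs. satisfiable cs}"

end

theory Submission
  imports Defs
begin

text \<open>
Idea. Pad the variable set so that \<open>k\<close> divides \<open>n\<close>, and count only the satisfying assignments with exactly
\<open>n / k\<close> true variables. Their number after \<open>t\<close> random constraints, divided by its expectation, is a
martingale \<open>L t\<close>. For two assignments with correlation \<open>x\<close>, a constraint is satisfied by both with
probability \<open>q^2 h x\<close>, and for densities below \<open>ln k / k\<close> the entropy of the correlation beats the gain
\<open>(h x)^t\<close>, so the second moment of \<open>L M\<close> is bounded even for some \<open>M\<close> larger than \<open>r n\<close> by a constant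
factor.

This alone gives only a positive probability, since \<open>L\<close> really fluctuates (short cycles). Probability tending to 1
comes from following the process: the conditional second moment of \<open>L M\<close> given the first \<open>t\<close> constraints is
a martingale, and by convexity it is at least \<open>(L t)^2 (1 + V)^(M - t)\<close>, where \<open>V\<close> is the conditional variance of
\<open>L (t + 1) / L t\<close>. Hence, as long as it is bounded, \<open>V\<close> is of order \<open>(1 - ln (L t)) / n\<close>, and by a Gronwall
argument \<open>- ln (L t)\<close> stays bounded in mean up to time \<open>r n\<close>. The logarithm of a step is quadratically controlled
unless the new constraint kills almost all solutions; expanding the constraint in Fourier characters, whose first-order
coefficients vanish at density \<open>1 / k\<close>, shows that only a fraction of order \<open>n powr (-5/4)\<close> of all
constraints does so, hence none of the first \<open>r n\<close> does.
\<close>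

section \<open>The rate function of the overlap\<close>

text \<open>The second moment is hard near correlation \<open>0\<close>: Stirling estimates of the
  hypergeometric weights lose a power of \<open>n\<close>, harmless where the exponent has a gap but
  fatal where \<open>rate\<close> vanishes. There a birth-death chain reversible for the weights
  yields an identity of Stein type; the gain \<open>(h x)^t\<close> acts as a linear force weaker
  than the restoring drift, so the moments of the correlation bound themselves and have the sizes
  given by fluctuations of order \<open>n powr (-1/2)\<close>. The signed first moment is even
  \<open>O(1/n)\<close>, and the third absolute moment is \<open>O(n powr (-3/2))\<close>. Nearly
  frozen variables enter through the square of a pair average, whose expectation is out of reach;
  splitting at a level \<open>\<delta>\<close> replaces it by \<open>\<delta>\<close> times the
  first moment plus \<open>1 / \<delta>\<close> times the third. The choice
  \<open>\<delta> = n powr (-1/4)\<close> balances the two at \<open>n powr (-5/4)\<close>, which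
  leaves room for \<open>r n\<close> steps. The constants are chosen in the order \<open>R\<close>
  (from the error allowed), \<open>B\<close> (from \<open>R\<close> and the error),
  \<open>n\<close>, because bad constraints cost a factor \<open>1 / (R exp (-B))^2\<close>.\<close>

text \<open>Here and below \<open>J = k - 1\<close>, and \<open>x\<close> is the correlation of two assignments with \<open>n / k\<close> true
variables each, ranging from \<open>-1/J\<close> (disjoint) to \<open>1\<close> (equal). \<open>exp (lnh J x)\<close> is the factor by which the
probability that both satisfy a random constraint exceeds that for independent events, and \<open>rate J x\<close> is
\<open>k^2 / J\<close> times the large deviation rate of the correlation.\<close>

definition lnh :: "real \<Rightarrow> real \<Rightarrow> real" where
  "lnh J x = (J - 1) * ln (1 + x / J) + ln (1 - x * (J - 1) / J + x^2)"

definition rate :: "real \<Rightarrow> real \<Rightarrow> real" where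
  "rate J x = (1 + J * x) * ln (1 + J * x) / J + 2 * ((1 - x) * ln (1 - x)) + (J + x) * ln (1 + x / J)"

lemma quadratic_factor_pos:
  fixes J x :: real
  assumes "2 \<le> J"
  shows "0 < 1 - x * (J - 1) / J + x^2"
proof -
  define a where "a = (J - 1) / J"
  have "0 \<le> a" "a \<le> 1" using assms by (auto simp: a_def field_simps)
  have "1 - x * a + x^2 = (x - a/2)^2 + (1 - a^2/4)" by (simp add: power2_eq_square algebra_simps)
  moreover have "a^2 \<le> 1" using \<open>0 \<le> a\<close> \<open>a \<le> 1\<close> by (simp add: power_le_one)
  ultimately have "0 < 1 - x * a + x^2" using zero_le_power2[of "x - a/2"] by linarith
  thus ?thesis by (simp add: a_def)
qed

lemma linear_factor_pos:
  fixes J x :: real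
  assumes "2 \<le> J" "-1/J \<le> x"
  shows "0 < 1 + x / J" "0 < J + x"
proof -
  have "-1/J > -J" using assms(1) by (simp add: field_simps) (smt (verit) mult_le_cancel_right1)
  thus "0 < J + x" using assms(2) by linarith
  thus "0 < 1 + x / J" using assms(1) by (simp add: field_simps)
qed

text \<open>After \<open>ln (1 + u) \<le> u\<close> in both logarithms the linear terms cancel, an
  effect of the density \<open>1 / k\<close>; only \<open>x^2\<close> is left.\<close>

lemma lnh_le_square:
  assumes "2 \<le> J" "-1/J \<le> x"
  shows "lnh J x \<le> x^2"
proof -
  have "(J - 1) * ln (1 + x / J) \<le> (J - 1) * (x / J)"
    using ln_le_minus_one[OF linear_factor_pos(1)[OF assms]] assms by (intro mult_left_mono) auto
  moreover have "ln (1 - x * (J - 1) / J + x^2) \<le> - x * (J - 1) / J + x^2"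
    using ln_le_minus_one[OF quadratic_factor_pos[OF assms(1), of x]] by simp
  ultimately show ?thesis unfolding lnh_def by (simp add: mult.commute)
qed

text \<open>The product is \<open>0\<close> at \<open>0\<close> whatever \<open>ln 0\<close> is.
  This makes \<open>rate\<close> continuous up to the endpoints \<open>-1/J\<close> and
  \<open>1\<close>, as the compactness argument in \<open>rate_gap\<close> requires.\<close>

lemma continuous_on_xlnx: "continuous_on {0..} (\<lambda>x::real. x * ln x)"
proof -
  have lim: "((\<lambda>x::real. x * ln x) \<longlongrightarrow> 0) (at_right 0)" by real_asymp
  have "continuous (at x within {0..}) (\<lambda>x::real. x * ln x)" if "x \<ge> 0" for x
  proof (cases "x = 0")
    case True
    have "(at (0::real) within {0..}) = at_right 0"
      by (metis at_within_Ici_at_right)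
    thus ?thesis using lim True by (simp add: continuous_within)
  next
    case False
    thus ?thesis using that by (intro continuous_intros) auto
  qed
  thus ?thesis by (auto simp: continuous_on_eq_continuous_within)
qed

lemma continuous_on_xlnx_compose:
  assumes "continuous_on A f" "\<And>x. x \<in> A \<Longrightarrow> (0::real) \<le> f x"
  shows "continuous_on A (\<lambda>x. f x * ln (f x))"
  using continuous_on_compose2[OF continuous_on_xlnx assms(1)] assms(2) by auto

lemma one_plus_Jx_nonneg: "2 \<le> (J::real) \<Longrightarrow> -1/J \<le> x \<Longrightarrow> 0 \<le> 1 + J * x"
  by (simp add: field_simps)

lemma continuous_on_rate:
  assumes "2 \<le> J"
  shows "continuous_on {-1/J..1} (rate J)"
proof -
  have 1: "continuous_on {-1/J..1} (\<lambda>x. (1 + J * x) * ln (1 + J * x))"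
    using assms one_plus_Jx_nonneg[OF assms] by (intro continuous_on_xlnx_compose continuous_intros) auto
  have 2: "continuous_on {-1/J..1} (\<lambda>x. (1 - x) * ln (1 - x))"
    by (intro continuous_on_xlnx_compose continuous_intros) auto
  have 3: "continuous_on {-1/J..1} (\<lambda>x. ln (1 + x / J))"
    using linear_factor_pos(1)[OF assms] assms
    by (intro continuous_on_ln continuous_intros ballI less_imp_neq[symmetric]) auto
  show ?thesis unfolding rate_def[abs_def]
    using assms by (intro continuous_intros 1 2 3) auto
qed

lemma continuous_on_lnh:
  assumes "2 \<le> J"
  shows "continuous_on {-1/J..1} (lnh J)"
  unfolding lnh_def[abs_def]
  using linear_factor_pos(1)[OF assms] quadratic_factor_pos[OF assms] assms
  by (intro continuous_on_add continuous_on_mult continuous_on_ln continuous_intros ballI less_imp_neq[symmetric]) auto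

lemma rate_0 [simp]: "rate J 0 = 0" and lnh_0 [simp]: "lnh J 0 = 0"
  by (simp_all add: rate_def lnh_def)

definition rate' :: "real \<Rightarrow> real \<Rightarrow> real" where
  "rate' J x = ln (1 + J * x) - 2 * ln (1 - x) + ln (1 + x / J)"

lemma has_deriv_xlnx:
  fixes f :: "real \<Rightarrow> real"
  assumes "(f has_real_derivative d) (at x)" "0 < f x"
  shows "((\<lambda>x. f x * ln (f x)) has_real_derivative (d * (ln (f x) + 1))) (at x)"
  using DERIV_mult[OF assms(1) DERIV_chain2[OF DERIV_ln_divide[OF assms(2)] assms(1)]] assms(2)
  by (simp add: field_simps)

lemma has_deriv_rate:
  assumes "2 \<le> J" "-1/J < x" "x < 1"
  shows "(rate J has_real_derivative rate' J x) (at x)"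
proof -
  have p: "0 < 1 + J * x" "0 < 1 - x" "0 < 1 + x / J" "0 < J + x" "0 < J"
    using assms linear_factor_pos[OF assms(1), of x] by (auto simp: field_simps)
  have 1: "((\<lambda>x. (1 + J * x) * ln (1 + J * x)) has_real_derivative (J * (ln (1 + J * x) + 1))) (at x)"
    using p by (intro has_deriv_xlnx) (auto intro!: derivative_eq_intros)
  have 2: "((\<lambda>x. (1 - x) * ln (1 - x)) has_real_derivative ((-1) * (ln (1 - x) + 1))) (at x)"
    using p by (intro has_deriv_xlnx) (auto intro!: derivative_eq_intros)
  have 3: "((\<lambda>x. (1 + x / J) * ln (1 + x / J)) has_real_derivative ((1 / J) * (ln (1 + x / J) + 1))) (at x)"
    using p by (intro has_deriv_xlnx) (auto intro!: derivative_eq_intros)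
  have "((\<lambda>x. (1 + J * x) * ln (1 + J * x) / J + 2 * ((1 - x) * ln (1 - x)) + J * ((1 + x / J) * ln (1 + x / J)))
      has_real_derivative (J * (ln (1 + J * x) + 1) / J + 2 * ((-1) * (ln (1 - x) + 1))
        + J * ((1 / J) * (ln (1 + x / J) + 1)))) (at x)"
    by (intro DERIV_add DERIV_cdivide DERIV_cmult 1 2 3)
  moreover have "J * (ln (1 + J * x) + 1) / J + 2 * ((-1) * (ln (1 - x) + 1))
        + J * ((1 / J) * (ln (1 + x / J) + 1)) = rate' J x"
    using p by (simp add: rate'_def)
  moreover have "(\<lambda>x. (1 + J * x) * ln (1 + J * x) / J + 2 * ((1 - x) * ln (1 - x)) + J * ((1 + x / J) * ln (1 + x / J)))
      = rate J"
    using p by (simp add: rate_def fun_eq_iff distrib_left mult.assoc[symmetric])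
  ultimately show ?thesis by simp
qed

lemma has_deriv_rate':
  assumes "2 \<le> J" "-1/J < x" "x < 1"
  shows "(rate' J has_real_derivative (J / (1 + J * x) + 2 / (1 - x) + 1 / (J + x))) (at x)"
proof -
  have p: "0 < 1 + J * x" "0 < 1 - x" "0 < 1 + x / J" "0 < J + x" "0 < J"
    using assms linear_factor_pos[OF assms(1), of x] by (auto simp: field_simps)
  have 1: "((\<lambda>x. ln (1 + J * x)) has_real_derivative (1 / (1 + J * x) * J)) (at x)"
    using p by (intro DERIV_chain2[OF DERIV_ln_divide]) (auto intro!: derivative_eq_intros)
  have 2: "((\<lambda>x. ln (1 - x)) has_real_derivative (1 / (1 - x) * (-1))) (at x)"
    using p by (intro DERIV_chain2[OF DERIV_ln_divide]) (auto intro!: derivative_eq_intros)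
  have 3: "((\<lambda>x. ln (1 + x / J)) has_real_derivative (1 / (1 + x / J) * (1 / J))) (at x)"
    using p by (intro DERIV_chain2[OF DERIV_ln_divide]) (auto intro!: derivative_eq_intros)
  have "(rate' J has_real_derivative
     (1 / (1 + J * x) * J - 2 * (1 / (1 - x) * (-1)) + 1 / (1 + x / J) * (1 / J))) (at x)"
    unfolding rate'_def[abs_def] by (intro DERIV_add DERIV_diff DERIV_cmult 1 2 3)
  moreover have "1 / (1 + x / J) * (1 / J) = 1 / (J + x)"
    using p by (simp add: distrib_right)
  ultimately show ?thesis by simp
qed

lemma rate'_0 [simp]: "rate' J 0 = 0"
  by (simp add: rate'_def)

text \<open>The logarithms combine because
  \<open>(1 + J x) (1 + x / J) = (1 - x)^2 + x (J + 1)^2 / J\<close>. In this form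
  \<open>rate'\<close> visibly has the sign of \<open>x\<close>.\<close>

lemma rate'_eq:
  assumes "2 \<le> J" "-1/J < x" "x < 1"
  shows "rate' J x = ln (1 + x * (J + 1)^2 / (J * (1 - x)^2))" "0 < 1 + x * (J + 1)^2 / (J * (1 - x)^2)"
proof -
  have p: "0 < 1 + J * x" "0 < 1 - x" "0 < 1 + x / J" "0 < J + x" "0 < J"
    using assms linear_factor_pos[OF assms(1), of x] by (auto simp: field_simps)
  have e: "1 + x * (J + 1)^2 / (J * (1 - x)^2) = (1 + J * x) * (1 + x / J) / (1 - x)^2"
  proof -
    have "(1 + J * x) * (1 + x / J) = (1 - x)^2 + x * (J + 1)^2 / J"
      using p by (simp add: field_simps power2_eq_square)
    hence "(1 + J * x) * (1 + x / J) / (1 - x)^2 = (1 - x)^2 / (1 - x)^2 + x * (J + 1)^2 / J / (1 - x)^2"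
      by (simp add: add_divide_distrib)
    thus ?thesis using p by simp
  qed
  show "0 < 1 + x * (J + 1)^2 / (J * (1 - x)^2)" unfolding e using p by simp
  show "rate' J x = ln (1 + x * (J + 1)^2 / (J * (1 - x)^2))"
    unfolding e rate'_def using p by (simp add: ln_div ln_mult ln_realpow)
qed

lemma rate_pos:
  assumes "2 \<le> J" "-1/J \<le> x" "x \<le> 1" "x \<noteq> 0"
  shows "0 < rate J x"
proof (cases "x < 0")
  case True
  have "\<exists>d. (rate J has_real_derivative d) (at z) \<and> d < 0" if "x < z" "z < 0" for z
  proof -
    have z: "-1/J < z" "z < 1" using that assms by auto
    have "z * (J + 1)^2 / (J * (1 - z)^2) < 0"
      using that assms z by (intro divide_neg_pos mult_neg_pos mult_pos_pos) auto
    hence "rate' J z < 0" using rate'_eq[OF assms(1) z] by (simp add: ln_less_zero)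
    thus ?thesis using has_deriv_rate[OF assms(1) z] by blast
  qed
  moreover have "continuous_on {x..0} (rate J)"
    using assms by (intro continuous_on_subset[OF continuous_on_rate[OF assms(1)]]) auto
  ultimately have "rate J 0 < rate J x" using True by (intro DERIV_neg_imp_decreasing_open[where f="rate J"])
  thus ?thesis by simp
next
  case False
  have "\<exists>d. (rate J has_real_derivative d) (at z) \<and> d > 0" if "0 < z" "z < x" for z
  proof -
    have "-1/J < 0" using assms(1) by simp
    hence z: "-1/J < z" "z < 1" using that assms less_trans[of "-1/J" 0 z] by auto
    have "z * (J + 1)^2 / (J * (1 - z)^2) > 0"
      using that assms z by (intro divide_pos_pos mult_pos_pos) auto
    hence "rate' J z > 0" using rate'_eq[OF assms(1) z] by (simp add: ln_gt_zero)
    thus ?thesis using has_deriv_rate[OF assms(1) z] by blast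
  qed
  moreover have "0 \<ge> -1/J" using assms(1) by simp
  hence "continuous_on {0..x} (rate J)"
    using assms by (intro continuous_on_subset[OF continuous_on_rate[OF assms(1)]]) auto
  moreover have "0 < x" using False assms by simp
  ultimately have "rate J 0 < rate J x" by (intro DERIV_pos_imp_increasing_open[where f="rate J"])
  thus ?thesis by simp
qed

text \<open>The lower bound \<open>2 c\<close> on the second derivative is integrated twice from
  \<open>0\<close>, where \<open>rate\<close> and \<open>rate'\<close> both vanish.\<close>

lemma rate_ge_quadratic_neg:
  assumes J: "2 \<le> J" and x: "-1/J \<le> x" "x \<le> 0"
    and c: "\<And>z. -1/J < z \<Longrightarrow> z \<le> 0 \<Longrightarrow> 2 * c \<le> J / (1 + J * z) + 2 / (1 - z) + 1 / (J + z)"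
  shows "c * x^2 \<le> rate J x"
proof (cases "x = 0")
  case False
  have J0: "-1/J < 0" using J by simp
  have 1: "rate' J z - 2 * c * z \<le> 0" if z: "-1/J < z" "z \<le> 0" for z
  proof -
    have "rate' J z - 2 * c * z \<le> rate' J 0 - 2 * c * 0"
    proof (rule DERIV_nonneg_imp_nondecreasing[where f="\<lambda>z. rate' J z - 2 * c * z", OF z(2)])
      fix y assume y: "z \<le> y" "y \<le> 0"
      have "((\<lambda>z. rate' J z - 2 * c * z) has_real_derivative
          (J / (1 + J * y) + 2 / (1 - y) + 1 / (J + y) - 2 * c * 1)) (at y)"
        using y z J by (intro derivative_intros has_deriv_rate') auto
      thus "\<exists>d. ((\<lambda>z. rate' J z - 2 * c * z) has_real_derivative d) (at y) \<and> 0 \<le> d"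
        using c[of y] y z J0 by (intro exI[where x="J / (1 + J * y) + 2 / (1 - y) + 1 / (J + y) - 2 * c * 1"] conjI) auto
    qed
    thus ?thesis by simp
  qed
  have "rate J 0 - c * 0^2 \<le> rate J x - c * x^2"
  proof (rule DERIV_nonpos_imp_decreasing_open[where f="\<lambda>z. rate J z - c * z^2"])
    show "x \<le> 0" by fact
    fix z assume z: "x < z" "z < 0"
    have "((\<lambda>z. rate J z - c * z^2) has_real_derivative (rate' J z - 2 * c * z)) (at z)"
      using has_deriv_rate[OF J, of z] z x by (auto intro!: derivative_eq_intros)
    thus "\<exists>d. ((\<lambda>z. rate J z - c * z^2) has_real_derivative d) (at z) \<and> d \<le> 0"
      using 1[of z] z x by (intro exI conjI) auto
  next
    show "continuous_on {x..0} (\<lambda>z. rate J z - c * z^2)"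
      using x by (intro continuous_intros continuous_on_subset[OF continuous_on_rate[OF J]]) auto
  qed
  thus ?thesis by simp
qed simp

lemma rate_ge_quadratic_pos:
  assumes J: "2 \<le> J" and x: "0 \<le> x" "x \<le> 1"
    and c: "\<And>z. 0 \<le> z \<Longrightarrow> z < 1 \<Longrightarrow> 2 * c \<le> J / (1 + J * z) + 2 / (1 - z) + 1 / (J + z)"
  shows "c * x^2 \<le> rate J x"
proof -
  have J0: "-1/J < 0" using J by simp
  have 1: "rate' J z - 2 * c * z \<ge> 0" if z: "0 \<le> z" "z < 1" for z
  proof -
    have "rate' J z - 2 * c * z \<ge> rate' J 0 - 2 * c * 0"
    proof (rule DERIV_nonneg_imp_nondecreasing[where f="\<lambda>z. rate' J z - 2 * c * z", OF z(1)])
      fix y assume y: "0 \<le> y" "y \<le> z"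
      have "((\<lambda>z. rate' J z - 2 * c * z) has_real_derivative
          (J / (1 + J * y) + 2 / (1 - y) + 1 / (J + y) - 2 * c * 1)) (at y)"
        using y z J J0 by (intro derivative_intros has_deriv_rate' less_le_trans[OF J0]) auto
      thus "\<exists>d. ((\<lambda>z. rate' J z - 2 * c * z) has_real_derivative d) (at y) \<and> 0 \<le> d"
        using c[of y] y z J0 by (intro exI[where x="J / (1 + J * y) + 2 / (1 - y) + 1 / (J + y) - 2 * c * 1"] conjI) auto
    qed
    thus ?thesis by simp
  qed
  have "rate J 0 - c * 0^2 \<le> rate J x - c * x^2"
  proof (rule DERIV_nonneg_imp_increasing_open[where f="\<lambda>z. rate J z - c * z^2"])
    show "0 \<le> x" by fact
    fix z assume z: "0 < z" "z < x"
    have "((\<lambda>z. rate J z - c * z^2) has_real_derivative (rate' J z - 2 * c * z)) (at z)"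
      using has_deriv_rate[OF J, of z] z x J0 by (auto intro!: derivative_eq_intros)
    thus "\<exists>d. ((\<lambda>z. rate J z - c * z^2) has_real_derivative d) (at z) \<and> 0 \<le> d"
      using 1[of z] z x by (intro exI conjI) auto
  next
    show "continuous_on {0..x} (\<lambda>z. rate J z - c * z^2)"
      using x J0 by (intro continuous_intros continuous_on_subset[OF continuous_on_rate[OF J]]) auto
  qed
  thus ?thesis by simp
qed


section \<open>Comparison of \<open>rate\<close> with \<open>lnh\<close>, with explicit numerical
  estimates\<close>

lemma ln_11_ge: "2.386 \<le> ln (11::real)"
proof -
  have "ln (2::real) \<ge> 0.692"
    using ln_approx_bounds[of 2 3] by (simp add: eval_nat_numeral)
  \<comment> \<open>\<open>11^2 = 121\<close> lies close to \<open>2^7 = 128\<close>, so a bound for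
    \<open>ln 2\<close> suffices.\<close>
  moreover have "1 - 128 / 121 \<le> ln (121 / 128 :: real)"
    using ln_le_minus_one[of "128/121 :: real"] by (simp add: ln_div)
  moreover have "ln (121 :: real) = 2 * ln 11"
    using ln_realpow[of "11::real" 2] by simp
  moreover have "ln (128 :: real) = 7 * ln 2"
    using ln_realpow[of "2::real" 7] by simp
  ultimately show ?thesis by (simp add: ln_div)
qed

text \<open>This is the curvature condition \<open>2 c \<le> 5.8 J / k + 1 / k\<close> for
  \<open>c = k ln k / J\<close>, cleared of denominators. The right side stays below
  \<open>2.9\<close>, so only a bounded range of \<open>k\<close> can be treated this way.\<close>

lemma ln_small_nat_le:
  assumes "3 \<le> k" "k \<le> (10::nat)"
  shows "ln (real k) \<le> (5.8 * (real k - 1)^2 + (real k - 1)) / (2 * (real k)^2)"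
proof -
  have l2: "ln (2::real) \<le> 25/36" by (rule ln2_le_25_over_36)
  have l8: "ln (8 :: real) = 3 * ln 2" and l4: "ln (4 :: real) = 2 * ln 2"
    using ln_realpow[of "2::real" 3] ln_realpow[of "2::real" 2] by simp_all
  \<comment> \<open>Tangent to \<open>ln\<close> at \<open>8\<close>, good enough from
    \<open>4\<close> to \<open>10\<close>; at \<open>3\<close> it is too weak, so \<open>B\<close>
    uses the tangent at \<open>4\<close>.\<close>
  have A: "ln x \<le> 25/12 + x / 8 - 1" if "x > 0" for x :: real
    using ln_le_minus_one[of "x/8"] that l2 l8 by (simp add: ln_div)
  have B: "ln 3 \<le> 25/18 + 3 / 4 - (1::real)"
    using ln_le_minus_one[of "3/4::real"] l2 l4 by (simp add: ln_div)
  have "k \<in> {3,4,5,6,7,8,9,10}" using assms by auto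
  thus ?thesis
    using B A[of 4] A[of 5] A[of 6] A[of 7] A[of 8] A[of 9] A[of 10]
    by (elim insertE) (simp_all add: power2_eq_square)
qed

text \<open>Serves the tangent of slope \<open>0.18\<close> to \<open>x ln x\<close>, since
  \<open>0.18 - 1 = -0.82\<close>.\<close>

lemma exp_minus_082_le: "exp (-0.82) \<le> (0.4427 :: real)"
proof -
  have "1 + 0.205 + 0.205^2/2 \<le> exp (0.205 :: real)"
    by (rule exp_lower_Taylor_quadratic) simp
  hence "(1 + 0.205 + 0.205^2/2)^4 \<le> exp (0.205 :: real)^4"
    by (intro power_mono) auto
  also have "exp (0.205 :: real)^4 = exp 0.82" by (simp add: exp_of_nat_mult[symmetric])
  finally have "1 / 0.4427 \<le> exp (0.82 :: real)" by (simp add: eval_nat_numeral)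
  thus ?thesis by (simp add: exp_minus field_simps)
qed

text \<open>The left side is the tangent of slope \<open>c\<close> to the convex function
  \<open>x ln x\<close>, touching at \<open>exp (c - 1)\<close>.\<close>

lemma xlnx_ge_linear:
  fixes x c :: real
  assumes "0 \<le> x"
  shows "c * x - exp (c - 1) \<le> x * ln x"
proof (cases "x = 0")
  case False
  hence x: "0 < x" using assms by simp
  have "ln (exp (c - 1) / x) \<le> exp (c - 1) / x - 1" using x by (intro ln_le_minus_one) auto
  hence "c - ln x \<le> exp (c - 1) / x" using x by (simp add: ln_div)
  hence "x * (c - ln x) \<le> x * (exp (c - 1) / x)" using x by (intro mult_left_mono) auto
  thus ?thesis using x by (simp add: algebra_simps)
qed simp

lemma one_minus_xlnx_ge:
  fixes e :: real
  assumes "0 \<le> e" "e < 1"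
  shows "- e + e^2 / 2 \<le> (1 - e) * ln (1 - e)"
proof -
  have "(1 - 0) * ln (1 - 0) + 0 - 0^2/2 \<le> (1 - e) * ln (1 - e) + e - e^2/2"
  proof (rule DERIV_nonneg_imp_nondecreasing[where f="\<lambda>e. (1 - e) * ln (1 - e) + e - e^2/2", OF assms(1)])
    fix y assume y: "0 \<le> y" "y \<le> e"
    have "((\<lambda>e. (1 - e) * ln (1 - e) + e - e^2/2) has_real_derivative (- ln (1 - y) - y)) (at y)"
    proof -
      have "((\<lambda>e. (1 - e) * ln (1 - e)) has_real_derivative ((-1) * (ln (1 - y) + 1))) (at y)"
        using y assms by (intro has_deriv_xlnx) (auto intro!: derivative_eq_intros)
      from DERIV_diff[OF DERIV_add[OF this DERIV_ident] DERIV_cdivide[OF DERIV_power[OF DERIV_ident, of 2], of 2]]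
      show ?thesis by simp
    qed
    moreover have "0 \<le> - ln (1 - y) - y" using ln_le_minus_one[of "1 - y"] y assms by simp
    ultimately show "\<exists>d. ((\<lambda>e. (1 - e) * ln (1 - e) + e - e^2/2) has_real_derivative d) (at y) \<and> 0 \<le> d"
      by blast
  qed
  thus ?thesis by simp
qed

text \<open>In terms of \<open>e\<close>, the fraction of one set of true variables not shared by
  the other, the range is \<open>e \<le> 1/2\<close>, and each of the three terms of
  \<open>rate\<close> gets its own elementary bound. The leading \<open>(1 - e) ln K\<close> then
  faces at most \<open>(1 - e)^2 ln K\<close>.\<close>

lemma rate_ge_quadratic_large:
  fixes k :: nat
  defines "K \<equiv> real k" defines "J \<equiv> K - 1" defines "c \<equiv> ln K * K / J"
  assumes k: "11 \<le> k" and x: "(J - 1) / (2 * J) \<le> x" "x \<le> 1"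
  shows "c * x^2 \<le> rate J x"
proof -
  have K: "11 \<le> K" using k by (simp add: K_def)
  have J: "10 \<le> J" and KJ: "K = J + 1" using K by (auto simp: J_def)
  have x0: "0 \<le> x"
  proof -
    have "0 \<le> (J - 1) / (2 * J)" using J by simp
    thus ?thesis using x by linarith
  qed
  define e where "e = J * (1 - x) / K"
  have e0: "0 \<le> e" using x J K by (simp add: e_def)
  have e1: "e \<le> 1/2"
  proof -
    have "J * (1 - x) \<le> J * (1 - (J - 1) / (2 * J))" using x J by (intro mult_left_mono) auto
    also have "\<dots> = K / 2" using J by (simp add: KJ field_simps)
    finally show ?thesis using K by (simp add: e_def field_simps)
  qed
  have th: "1 + J * x = K * (1 - e)" using K by (simp add: e_def KJ field_simps)
  have xe: "x \<le> 1 - e"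
  proof -
    have "(1 - x) * J \<le> (1 - x) * K" using x KJ by (intro mult_left_mono) auto
    thus ?thesis using K by (simp add: e_def field_simps)
  qed
  have L: "2.386 \<le> ln K"
    using ln_11_ge K ln_mono[of 11 K] by linarith
  have t1: "(J / K) * ((1 + J * x) * ln (1 + J * x) / J) = (1 - e) * ln K + (1 - e) * ln (1 - e)"
  proof -
    have "(J / K) * ((1 + J * x) * ln (1 + J * x) / J) = (1 - e) * ln (K * (1 - e))"
      unfolding th using K J by simp
    also have "ln (K * (1 - e)) = ln K + ln (1 - e)" using K e1 by (intro ln_mult_pos) auto
    finally show ?thesis by (simp add: distrib_left)
  qed
  \<comment> \<open>\<open>e ln e\<close> is replaced by its tangent of slope \<open>0.18\<close>;
    with this slope the final quadratic in \<open>e\<close> is positive at both ends of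
    \<open>[0, 1/2]\<close>.\<close>
  have t2: "2 * (0.18 * e - 0.4427) + 2 * e / K \<le> (J / K) * (2 * ((1 - x) * ln (1 - x)))"
  proof (cases "x = 1")
    case False
    hence x1: "x < 1" using x by simp
    have ee: "1 - x = e * (K / J)" using J K by (simp add: e_def)
    have e00: "0 < e" using x1 J K by (simp add: e_def)
    have "ln (1 - x) = ln e + ln (K / J)"
      unfolding ee using J K e00 by (intro ln_mult_pos) auto
    moreover have "(J / K) * (2 * ((1 - x) * l)) = 2 * e * l" for l
      unfolding ee using J K by simp
    ultimately have "(J / K) * (2 * ((1 - x) * ln (1 - x))) = 2 * (e * ln e) + 2 * e * ln (K / J)"
      by (simp only: distrib_left mult.assoc)
    moreover have "ln (K / J) \<ge> 1 / K"
      using ln_le_minus_one[of "J / K"] J K by (simp add: ln_div KJ field_simps)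
    hence "2 * e * (1 / K) \<le> 2 * e * ln (K / J)"
      using e0 by (intro mult_left_mono) auto
    hence "2 * e / K \<le> 2 * e * ln (K / J)" by simp
    moreover have "0.18 * e - 0.4427 \<le> e * ln e"
      using xlnx_ge_linear[OF e0, of "0.18"] exp_minus_082_le by simp
    moreover define T p l where "T = (J / K) * (2 * ((1 - x) * ln (1 - x)))" "p = e * ln e" "l = 2 * e * ln (K / J)"
    ultimately have "T = 2 * p + l" "2 * e / K \<le> l" "0.18 * e - 0.4427 \<le> p" by simp_all
    thus ?thesis unfolding T_p_l_def(1)[symmetric] by simp
  qed (simp add: e_def)
  have t3: "1 - e - 1 / K \<le> (J / K) * ((J + x) * ln (1 + x / J))"
  proof -
    have "x / (J + x) \<le> ln (1 + x / J)"
      using ln_le_minus_one[of "1 / (1 + x / J)"] J x0 by (simp add: ln_div field_simps)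
    hence "(J + x) * (x / (J + x)) \<le> (J + x) * ln (1 + x / J)"
      using J x0 by (intro mult_left_mono) auto
    hence "x \<le> (J + x) * ln (1 + x / J)" using J x0 by simp
    hence "(J / K) * x \<le> (J / K) * ((J + x) * ln (1 + x / J))"
      using J K by (intro mult_left_mono) auto
    moreover have "(J / K) * x = 1 - e - 1 / K"
    proof -
      have "1 - e - 1 / K = (K - J * (1 - x) - 1) / K" using K by (simp add: e_def diff_divide_distrib)
      also have "K - J * (1 - x) - 1 = J * x" by (simp add: KJ algebra_simps)
      finally show ?thesis by simp
    qed
    ultimately show ?thesis by simp
  qed
  have "(J / K) * rate J x = (J / K) * ((1 + J * x) * ln (1 + J * x) / J)
      + (J / K) * (2 * ((1 - x) * ln (1 - x))) + (J / K) * ((J + x) * ln (1 + x / J))"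
    by (simp add: rate_def algebra_simps)
  moreover have "- e + e^2 / 2 \<le> (1 - e) * ln (1 - e)" using one_minus_xlnx_ge[of e] e0 e1 by simp
  ultimately have r: "(1 - e) * ln K - e + e^2/2 + 2 * (0.18 * e - 0.4427) + 2 * e / K + 1 - e - 1 / K
      \<le> (J / K) * rate J x"
    using t1 t2 t3 by linarith
  have "ln K * x^2 \<le> ln K * (1 - e)^2"
    using x0 xe L by (intro mult_left_mono power_mono) auto
  hence "(J / K) * rate J x - ln K * x^2
     \<ge> ln K * (e * (1 - e)) + (0.1146 - 1.64 * e + e^2 / 2 + (2 * e - 1) * (1 / K))"
    using r by (simp add: power2_eq_square algebra_simps)
  moreover have "ln K * (e * (1 - e)) \<ge> 2.386 * (e * (1 - e))"
    using L e0 e1 by (intro mult_right_mono mult_nonneg_nonneg) auto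
  moreover have "(2 * e - 1) * (1 / K) \<ge> (2 * e - 1) * (1 / 11)"
    using e1 K by (intro mult_left_mono_neg) (auto simp: field_simps)
  \<comment> \<open>The expression is concave in \<open>e\<close>; \<open>e^2 \<le> e / 2\<close>
    replaces it by its chord over \<open>[0, 1/2]\<close>, which is positive.\<close>
  moreover have "0 \<le> 2.386 * (e * (1 - e)) + (0.1146 - 1.64 * e + e^2 / 2 + (2 * e - 1) * (1 / 11))"
  proof -
    define s where "s = e * e"
    have "0 \<le> e * (1/2 - e)" using e0 e1 by (intro mult_nonneg_nonneg) auto
    hence "0 \<le> e / 2 - s" by (simp add: s_def algebra_simps)
    moreover have "2.386 * (e * (1 - e)) + (0.1146 - 1.64 * e + e^2 / 2 + (2 * e - 1) * (1 / 11))
      = 2.386 * e - 2.386 * s + 0.1146 - 1.64 * e + s / 2 + 2 * e / 11 - 1 / 11"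
      by (simp add: s_def power2_eq_square field_simps)
    ultimately show ?thesis using e0 e1 by simp
  qed
  ultimately have "0 \<le> (J / K) * rate J x - ln K * x^2" by linarith
  thus ?thesis unfolding c_def using J K by (simp add: field_simps)
qed

text \<open>The common denominator exposes the factor \<open>x\<close> of the derivative; the
  comparison with \<open>rate'\<close> and the expansion at \<open>0\<close> both rest on this
  form.\<close>

lemma has_deriv_lnh:
  assumes "2 \<le> J" "-1/J \<le> x"
  shows "(lnh J has_real_derivative ((J + 1) * x * (1 + x) / ((J + x) * (1 - x * (J - 1) / J + x^2)))) (at x)"
proof -
  define Q where "Q = 1 - x * (J - 1) / J + x^2"
  have p: "0 < 1 + x / J" "0 < J + x" "0 < J" "0 < Q"
    using assms linear_factor_pos[OF assms] quadratic_factor_pos[OF assms(1), of x] by (auto simp: Q_def)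
  have e: "(J - 1) * (1 / J / (1 + x / J)) + (2 * x - (J - 1) / J) / Q = (J + 1) * x * (1 + x) / ((J + x) * Q)"
  proof -
    have "J * (1 + x / J) = J + x" using p by (simp add: distrib_left)
    hence "(J - 1) * (1 / J / (1 + x / J)) = (J - 1) / (J + x)" by simp
    moreover have "(J - 1) * Q + (2 * x - (J - 1) / J) * (J + x) = (J + 1) * x * (1 + x)"
      using p(3) unfolding Q_def by (simp add: field_simps power2_eq_square)
    ultimately show ?thesis using p by (subst \<open>(J - 1) * (1 / J / (1 + x / J)) = (J - 1) / (J + x)\<close>, subst add_frac_eq) auto
  qed
  have "(lnh J has_real_derivative ((J - 1) * (1 / J / (1 + x / J)) + (2 * x - (J - 1) / J) / Q)) (at x)"
  proof -
    have 1: "((\<lambda>x. ln (1 + x / J)) has_real_derivative (1 / (1 + x / J) * (1 / J))) (at x)"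
      using p by (intro DERIV_chain2[OF DERIV_ln_divide]) (auto intro!: derivative_eq_intros)
    have 2: "((\<lambda>x. ln (1 - x * (J - 1) / J + x^2)) has_real_derivative (1 / Q * (2 * x - (J - 1) / J))) (at x)"
      unfolding Q_def using p(3,4)
      by (intro DERIV_chain2[OF DERIV_ln_divide]) (auto intro!: derivative_eq_intros simp: Q_def)
    show ?thesis
      using DERIV_add[OF DERIV_cmult[OF 1, of "J - 1"] 2] unfolding lnh_def[abs_def] by (simp add: mult_ac)
  qed
  thus ?thesis unfolding e by (simp add: Q_def)
qed

text \<open>With \<open>y = x k^2 / (J (1 - x)^2)\<close> the derivative of the difference is
\<open>ln (1 + y) - ln k (1 + x) k y / ((k + y) (J + x))\<close>; for \<open>y \<le> J\<close> concavity gives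
\<open>ln (1 + y) \<ge> ln k y / J\<close>, for \<open>y \<ge> J\<close> monotonicity gives \<open>ln (1 + y) \<ge> ln k\<close>.\<close>

lemma rate_ge_lnh_mid:
  fixes J L :: real
  assumes J: "2 \<le> J" and x: "0 \<le> x" "x \<le> (J - 1) / (2 * J)"
  shows "ln (J + 1) * (J + 1) / J * lnh J x \<le> rate J x"
proof -
  define K where "K = J + 1"
  define L where "L = ln K"
  define c where "c = L * K / J"
  define x1 where "x1 = (J - 1) / (2 * J)"
  have K: "3 \<le> K" using J by (simp add: K_def)
  have L: "0 < L" using K by (simp add: L_def)
  have x1: "0 \<le> x1" "x1 \<le> 1/2" using J by (auto simp: x1_def field_simps)
  have J0: "-1/J < 0" using J by simp
  have "rate J 0 - c * lnh J 0 \<le> rate J x - c * lnh J x"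
  proof (rule DERIV_nonneg_imp_nondecreasing[where f="\<lambda>z. rate J z - c * lnh J z", OF x(1)])
    fix z assume z: "0 \<le> z" "z \<le> x"
    have z1: "z \<le> x1" using z x by (simp add: x1_def)
    hence z1: "z \<le> x1" "z < 1" "-1/J < z" using x1 less_le_trans[OF J0 z(1)] by auto
    define Q where "Q = 1 - z * (J - 1) / J + z^2"
    define y where "y = z * K^2 / (J * (1 - z)^2)"
    have y0: "0 \<le> y" using z J z1 by (simp add: y_def)
    have Qp: "0 < Q" using quadratic_factor_pos[OF J] by (simp add: Q_def)
    have Q: "Q = (1 - z)^2 + z * K / J" using J by (simp add: Q_def K_def field_simps power2_eq_square)
    have w: "0 < (1 - z)^2" "(1 - z)^2 \<le> 1" using z z1 by (auto simp: power_le_one)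
    have key: "c * (K * z * (1 + z) / ((J + z) * Q)) \<le> ln (1 + y)"
    proof (cases "y \<le> J")
      case True
      have "L * (y / J) \<le> ln (1 + y)"
      proof -
        have "(1 - y / J) * ln 1 + (y / J) * ln K \<le> ln ((1 - y / J) * 1 + (y / J) * K)"
          using ln_concave concave_onD[of "{0<..}" ln "y / J" 1 K] True y0 J K by simp
        also have "(1 - y / J) * 1 + (y / J) * K = 1 + y" using J by (simp add: K_def field_simps)
        finally show ?thesis by (simp add: L_def mult.commute)
      qed
      moreover have "c * (K * z * (1 + z) / ((J + z) * Q)) \<le> L * (y / J)"
      proof -
        have "J * (1 + z) * (1 - z)^2 \<le> (J + z) * Q"
        proof -
          have "z * (J * (1 - z)^2) \<le> z * (K + z * K / J)"
          proof (rule mult_left_mono[OF _ z(1)])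
            have "J * (1 - z)^2 \<le> J * 1" using w J by (intro mult_left_mono) auto
            also have "\<dots> \<le> K + z * K / J" using z K J by (simp add: K_def)
            finally show "J * (1 - z)^2 \<le> K + z * K / J" .
          qed
          moreover have "0 \<le> J * (z * (1 - z)^2)" using z J by simp
          ultimately show ?thesis unfolding Q using J by (simp add: field_simps)
        qed
        moreover have "0 < (J + z) * Q" "0 < J * (1 - z)^2" using J z Qp w(1) by auto
        ultimately have "(1 + z) / ((J + z) * Q) \<le> 1 / (J * (1 - z)^2)"
          by (simp add: pos_divide_le_eq pos_le_divide_eq mult_ac)
        hence "(L * K^2 / J * z) * ((1 + z) / ((J + z) * Q)) \<le> (L * K^2 / J * z) * (1 / (J * (1 - z)^2))"
          using L K J z by (intro mult_left_mono) auto
        thus ?thesis by (simp add: c_def y_def power2_eq_square mult_ac)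
      qed
      ultimately show ?thesis by linarith
    next
      case False
      have "L \<le> ln (1 + y)" unfolding L_def using False K by (intro ln_mono) (auto simp: K_def)
      moreover have "c * (K * z * (1 + z) / ((J + z) * Q)) \<le> L"
      proof -
        \<comment> \<open>The left side increases in \<open>z\<close> and
          \<open>(J + z) (1 - z)^2\<close> decreases, so it is enough to compare them at the right
          end \<open>x1\<close>.\<close>
        have "K * z * (1 + J * z) \<le> K * x1 * (1 + J * x1)"
          using z z1 J K by (intro mult_mono) auto
        also have "\<dots> = K^2 * (J - 1) / (4 * J)"
          using J by (simp add: x1_def K_def field_simps power2_eq_square)
        also have "\<dots> \<le> J * ((J + x1) * (1 - x1)^2)"
        proof -
          have e: "J * ((J + x1) * (1 - x1)^2) = (2 * J - 1) * K^3 / (8 * J^2)"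
            using J by (simp add: x1_def K_def field_simps power2_eq_square power3_eq_cube)
          have "K^2 * (2 * J * (J - 1)) \<le> K^2 * ((2 * J - 1) * K)"
            using J K by (intro mult_left_mono) (auto simp: K_def algebra_simps)
          hence "K^2 * (2 * J * (J - 1)) / (8 * J^2) \<le> K^2 * ((2 * J - 1) * K) / (8 * J^2)"
            by (intro divide_right_mono) auto
          moreover have "K^2 * (2 * J * (J - 1)) / (8 * J^2) = K^2 * (J - 1) / (4 * J)"
            using J by (simp add: field_simps power2_eq_square)
          ultimately have "K^2 * (J - 1) / (4 * J) \<le> (2 * J - 1) * K^3 / (8 * J^2)"
            by (simp add: power2_eq_square power3_eq_cube mult_ac)
          thus ?thesis unfolding e .
        qed
        also have "\<dots> \<le> J * ((J + z) * (1 - z)^2)"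
        proof -
          have "0 \<le> (x1 - z) * (J * (2 - z - x1) - (1 - 2 * (z + x1) + z^2 + z * x1 + x1^2))"
          proof (intro mult_nonneg_nonneg)
            have "2 * 1 \<le> J * (2 - z - x1)" using J z1 x1 by (intro mult_mono) auto
            moreover have "1 - 2 * (z + x1) + z^2 + z * x1 + x1^2 = (1 - (z + x1))^2 - z * x1"
              by (simp add: power2_eq_square algebra_simps)
            moreover have "(1 - (z + x1))^2 \<le> 1" using z z1 x1 by (intro power_le_one) auto
            moreover have "0 \<le> z * x1" using z x1 by simp
            ultimately show "0 \<le> J * (2 - z - x1) - (1 - 2 * (z + x1) + z^2 + z * x1 + x1^2)" by linarith
          qed (use z1 in simp)
          also have "\<dots> = (J + z) * (1 - z)^2 - (J + x1) * (1 - x1)^2"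
            by (simp add: power2_eq_square algebra_simps)
          finally show ?thesis using J by (intro mult_left_mono) auto
        qed
        finally have "K * z * (1 + J * z) \<le> J * ((J + z) * (1 - z)^2)" .
        hence "K * (K * z * (1 + z)) \<le> J * ((J + z) * Q)"
        proof -
          have "J * ((J + z) * Q) = J * ((J + z) * (1 - z)^2) + (J + z) * z * K"
            unfolding Q using J by (simp add: distrib_left)
          moreover have "K * (K * z * (1 + z)) = K * z * (1 + J * z) + (J + z) * z * K"
            by (simp add: K_def algebra_simps)
          ultimately show ?thesis using \<open>K * z * (1 + J * z) \<le> J * ((J + z) * (1 - z)^2)\<close> by linarith
        qed
        moreover have "0 < J * ((J + z) * Q)" using J z Qp by simp
        ultimately have "K * (K * z * (1 + z)) / (J * ((J + z) * Q)) \<le> 1"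
          by (simp only: divide_le_eq_1_pos)
        hence "(K / J) * (K * z * (1 + z) / ((J + z) * Q)) \<le> 1"
          by (simp only: times_divide_times_eq)
        hence "L * ((K / J) * (K * z * (1 + z) / ((J + z) * Q))) \<le> L * 1"
          using L by (intro mult_left_mono) auto
        thus ?thesis by (simp add: c_def)
      qed
      ultimately show ?thesis by linarith
    qed
    have "((\<lambda>z. rate J z - c * lnh J z) has_real_derivative
        (rate' J z - c * (K * z * (1 + z) / ((J + z) * Q)))) (at z)"
      using z1 J has_deriv_lnh[OF J, of z] has_deriv_rate[OF J, of z]
      by (auto intro!: derivative_eq_intros simp: K_def Q_def)
    moreover have "rate' J z = ln (1 + y)"
      using rate'_eq(1)[OF J z1(3,2)] by (simp add: y_def K_def)
    ultimately show "\<exists>d. ((\<lambda>z. rate J z - c * lnh J z) has_real_derivative d) (at z) \<and> 0 \<le> d"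
      using key by (intro exI conjI) auto
  qed
  thus ?thesis by (simp add: c_def K_def L_def)
qed


text \<open>The constant is the value of \<open>t d\<close> at \<open>t = n ln k / k\<close>, so
  this inequality is what produces the threshold. For \<open>x \<le> 0\<close>, for small
  \<open>k\<close>, and for \<open>x\<close> beyond \<open>(J - 1) / (2 J)\<close> both sides are
  compared with a multiple of \<open>x^2\<close>; in the remaining range \<open>lnh\<close> itself
  is needed.\<close>

lemma rate_ge_lnh:
  fixes k :: nat
  defines "K \<equiv> real k" defines "J \<equiv> K - 1"
  assumes k: "3 \<le> k" and x: "-1/J \<le> x" "x \<le> 1"
  shows "ln K * K / J * lnh J x \<le> rate J x"
proof -
  define c where "c = ln K * K / J"
  have K: "3 \<le> K" using k by (simp add: K_def)
  have J: "2 \<le> J" and KJ: "K = J + 1" using K by (auto simp: J_def)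
  have c0: "0 \<le> c" using K J by (simp add: c_def)
  have "c * lnh J x \<le> c * x^2"
    using lnh_le_square[OF J x(1)] c0 by (intro mult_left_mono) auto
  consider "x \<le> 0" | "0 < x" "k \<le> 10" | "0 < x" "11 \<le> k" "x \<le> (J - 1) / (2 * J)"
    | "11 \<le> k" "(J - 1) / (2 * J) \<le> x" by linarith
  hence "c * lnh J x \<le> rate J x"
  proof cases
    case 1
    have "c * x^2 \<le> rate J x"
    proof (rule rate_ge_quadratic_neg[OF J x(1) 1])
      fix z assume z: "-1/J < z" "z \<le> 0"
      have p: "0 < 1 + J * z" "0 < J + z" using z J linear_factor_pos[OF J, of z] by (auto simp: field_simps)
      \<comment> \<open>Tangent to \<open>ln\<close> at \<open>4\<close>, with
        \<open>7/18 = 2 (25/36) - 1\<close> from the bound on \<open>ln 2\<close>.\<close>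
      have L: "ln K \<le> K / 4 + 7 / 18"
        using ln_le_minus_one[of "K/4"] ln_realpow[of "2::real" 2] ln2_le_25_over_36 K by (simp add: ln_div)
      have "J * (1 + J * z) \<le> J * 1" using z J by (intro mult_left_mono) (auto simp: mult_nonneg_nonpos)
      hence t1: "J \<le> J / (1 + J * z)" using p by (simp add: pos_le_divide_eq)
      have "1 - z \<le> K / J" using z J by (simp add: KJ field_simps)
      hence t2: "2 / (K / J) \<le> 2 / (1 - z)" using z J K by (intro divide_left_mono) auto
      have t3: "1 / J \<le> 1 / (J + z)" using p z J by (intro divide_left_mono) auto
      have "2 * c \<le> J + 2 / (K / J) + 1 / J"
      proof -
        have "2 * ln K * K \<le> 2 * (K / 4 + 7 / 18) * K" using L K by (intro mult_right_mono) auto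
        also have "\<dots> \<le> K^2 - 2"
        proof -
          have "3 * (K/2 - 7/9) \<le> K * (K/2 - 7/9)" using K by (intro mult_right_mono) auto
          moreover have "2 \<le> 3 * (K/2 - 7/9)" using K by simp
          ultimately show ?thesis by (simp add: power2_eq_square algebra_simps)
        qed
        also have "\<dots> \<le> K^2 - 2 + 2 / K" using K by simp
        also have "\<dots> = J * (J + 2 / (K / J) + 1 / J)"
        proof -
          have "2 * J^2 / K = 2 * K - 4 + 2 / K" using K by (simp add: J_def field_simps power2_eq_square)
          thus ?thesis using J by (simp add: KJ power2_eq_square algebra_simps)
        qed
        finally have "2 * ln K * K / J \<le> J + 2 / (K / J) + 1 / J"
          using J by (simp only: pos_divide_le_eq mult.commute[of _ J])
        thus ?thesis by (simp add: c_def)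
      qed
      thus "2 * c \<le> J / (1 + J * z) + 2 / (1 - z) + 1 / (J + z)" using t1 t2 t3 by linarith
    qed
    thus ?thesis using \<open>c * lnh J x \<le> c * x^2\<close> by linarith
  next
    case 2
    have "c * x^2 \<le> rate J x"
    proof (rule rate_ge_quadratic_pos[OF J _ x(2)])
      fix z :: real assume z: "0 \<le> z" "z < 1"
      define a where "a = z + 1 / J"
      define b where "b = 1 - z"
      have "0 < a" unfolding a_def using z J by (intro add_nonneg_pos) auto
      hence ab: "0 < a" "0 < b" "a + b = K / J" using z J by (auto simp: a_def b_def KJ field_simps)
      \<comment> \<open>The optimal inequality is
        \<open>1/a + 2/b \<ge> (1 + sqrt 2)^2 / (a + b)\<close>; \<open>5.8\<close> is a rational
        value just below \<open>(1 + sqrt 2)^2 = 5.828...\<close>.\<close>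
      have "0 \<le> 2 * (a - 0.7 * b)^2 + 0.02 * b^2" by simp
      hence "5.8 * (a * b) \<le> (b + 2 * a) * (a + b)" by (simp add: power2_eq_square algebra_simps)
      hence "5.8 / (a + b) \<le> (b + 2 * a) / (a * b)" using ab(1,2) by (simp add: divide_simps) (simp add: algebra_simps)
      also have "\<dots> = 1 / a + 2 / b" using ab by (simp add: field_simps)
      finally have t1: "5.8 * J / K \<le> 1 / a + 2 / b" using ab(3) by simp
      have t2: "1 / a = J / (1 + J * z)" using J by (simp add: a_def field_simps)
      have t3: "1 / K \<le> 1 / (J + z)" using z J KJ by (intro divide_left_mono) auto
      have "2 * ln K * K^2 \<le> 5.8 * J^2 + J"
        using ln_small_nat_le[OF k 2(2)] K by (simp add: K_def J_def field_simps)
      hence "2 * c \<le> 5.8 * J / K + 1 / K"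
        using J K by (simp add: c_def field_simps power2_eq_square)
      thus "2 * c \<le> J / (1 + J * z) + 2 / (1 - z) + 1 / (J + z)"
        using t1 t2 t3 by (simp add: b_def)
    qed (use 2 in simp)
    thus ?thesis using \<open>c * lnh J x \<le> c * x^2\<close> by linarith
  next
    case 3
    show ?thesis using rate_ge_lnh_mid[OF J _ 3(3)] 3(1) by (simp add: c_def KJ)
  next
    case 4
    thus ?thesis using rate_ge_quadratic_large[OF 4(1)] x(2) \<open>c * lnh J x \<le> c * x^2\<close>
      by (fastforce simp: c_def K_def J_def)
  qed
  thus ?thesis by (simp add: c_def)
qed

text \<open>Compactness: away from \<open>0\<close> the continuous function
  \<open>rate - y lnh\<close> is positive, and being linear in \<open>y\<close> it is smallest at
  \<open>y = 0\<close> or \<open>y = X\<close>.\<close>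

lemma rate_gap:
  fixes k :: nat
  defines "K \<equiv> real k" defines "J \<equiv> K - 1"
  assumes k: "3 \<le> k" and X: "0 \<le> X" "X < ln K * K / J" and \<delta>: "0 < \<delta>"
  obtains g where "0 < g"
    "\<And>x y. -1/J \<le> x \<Longrightarrow> x \<le> 1 \<Longrightarrow> \<delta> \<le> \<bar>x\<bar> \<Longrightarrow> 0 \<le> y \<Longrightarrow> y \<le> X \<Longrightarrow> g \<le> rate J x - y * lnh J x"
proof -
  have K: "3 \<le> K" using k by (simp add: K_def)
  have J: "2 \<le> J" using K by (auto simp: J_def)
  define f where "f x = min (rate J x) (rate J x - X * lnh J x)" for x
  define A where "A = {-1/J..1} \<inter> {x. \<delta> \<le> \<bar>x\<bar>}"
  have "closed {x :: real. \<delta> \<le> \<bar>x\<bar>}" by (intro closed_Collect_le continuous_intros)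
  hence "compact A" unfolding A_def by (intro compact_Int_closed) auto
  have fpos: "0 < f x" if "x \<in> A" for x
  proof -
    have x: "-1/J \<le> x" "x \<le> 1" "x \<noteq> 0" using that \<delta> by (auto simp: A_def)
    have r: "0 < rate J x" by (rule rate_pos[OF J x])
    have "X * lnh J x < rate J x"
    proof (cases "lnh J x \<le> 0")
      case True
      hence "X * lnh J x \<le> 0" using X by (simp add: mult_nonneg_nonpos)
      thus ?thesis using r by linarith
    next
      case False
      hence "X * lnh J x < ln K * K / J * lnh J x" using X by (intro mult_strict_right_mono) auto
      thus ?thesis using rate_ge_lnh[OF k, of x] x by (simp add: K_def J_def)
    qed
    thus ?thesis using r by (simp add: f_def)
  qed
  have le: "f x \<le> rate J x - y * lnh J x" if "0 \<le> y" "y \<le> X" for x y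
  proof (cases "lnh J x \<le> 0")
    case True
    thus ?thesis using that mult_nonneg_nonpos[of y "lnh J x"] by (simp add: f_def min_le_iff_disj)
  next
    case False
    hence "y * lnh J x \<le> X * lnh J x" using that by (intro mult_right_mono) auto
    thus ?thesis by (simp add: f_def min_le_iff_disj)
  qed
  show thesis
  proof (cases "A = {}")
    case True
    show thesis by (rule that[of 1]) (use True in \<open>auto simp: A_def\<close>)
  next
    case False
    have "continuous_on A f" unfolding f_def[abs_def] A_def
      by (intro continuous_intros continuous_on_subset[OF continuous_on_rate[OF J]]
          continuous_on_subset[OF continuous_on_lnh[OF J]]) auto
    then obtain x0 where x0: "x0 \<in> A" "\<And>x. x \<in> A \<Longrightarrow> f x0 \<le> f x"
      using continuous_attains_inf[OF \<open>compact A\<close> False] by blast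
    show thesis
    proof (rule that[of "f x0"])
      show "0 < f x0" by (rule fpos[OF x0(1)])
      fix x y assume "-1/J \<le> x" "x \<le> 1" "\<delta> \<le> \<bar>x\<bar>" "0 \<le> y" "y \<le> X"
      thus "f x0 \<le> rate J x - y * lnh J x"
        using x0(2)[of x] le[of y x] by (fastforce simp: A_def)
    qed
  qed
qed

section \<open>Overlap weights\<close>

text \<open>One side of Stirling's formula. Together with \<open>ln_fact_le\<close> the error is
  \<open>1 + ln n\<close>, hence a power of \<open>n\<close> after exponentiation.\<close>

lemma xlnx_minus_le_ln_fact: "real n * ln (real n) - real n \<le> ln (fact n)"
proof (induction n)
  case (Suc n)
  show ?case
  proof (cases "n = 0")
    case False
    hence n: "0 < real n" by simp
    have "ln (real (Suc n) / real n) \<le> real (Suc n) / real n - 1"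
      using n by (intro ln_le_minus_one) auto
    also have "\<dots> = 1 / real n" using n by (simp add: field_simps)
    finally have "real n * (ln (real (Suc n)) - ln (real n)) \<le> 1"
      using n by (simp add: ln_div field_simps)
    moreover have "ln (fact (Suc n) :: real) = ln (real (Suc n)) + ln (fact n)"
      unfolding fact_Suc of_nat_mult of_nat_fact by (rule ln_mult_pos) auto
    ultimately show ?thesis using Suc by (simp add: algebra_simps)
  qed simp
qed simp

lemma ln_fact_le: "0 < n \<Longrightarrow> ln (fact n) \<le> 1 + ln (real n) + (real n * ln (real n) - real n)"
proof (induction n)
  case (Suc n)
  show ?case
  proof (cases "n = 0")
    case False
    hence n: "0 < real n" by simp
    have "ln (real n / real (Suc n)) \<le> real n / real (Suc n) - 1"
      using n by (intro ln_le_minus_one) auto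
    also have "\<dots> = - 1 / real (Suc n)" using n by (simp add: field_simps)
    finally have "1 \<le> real (Suc n) * (ln (real (Suc n)) - ln (real n))"
      using n by (simp add: ln_div field_simps)
    moreover have "ln (fact (Suc n) :: real) = ln (real (Suc n)) + ln (fact n)"
      unfolding fact_Suc of_nat_mult of_nat_fact by (rule ln_mult_pos) auto
    ultimately show ?thesis using Suc False by (simp add: algebra_simps)
  qed simp
qed simp

lemma xlnx_scale: "0 < c \<Longrightarrow> 0 \<le> x \<Longrightarrow> (c * x) * ln (c * x) = c * (x * ln c + x * ln (x::real))"
  by (cases "x = 0") (simp_all add: ln_mult_pos algebra_simps)

text \<open>\<open>rho a\<close> is the correlation of two sets of size \<open>s\<close> that share \<open>a\<close> of the \<open>n\<close> variables, \<open>hyp\<close> its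
hypergeometric distribution, and \<open>om\<close> the normalised up-rate of the reversible birth-death chain for
\<open>hyp\<close>, whose drift is linear in \<open>rho\<close>.\<close>

locale overlap =
  fixes k s :: nat
  assumes k3: "3 \<le> k" and s_pos: "0 < s"
begin

definition n :: nat where "n = k * s"
definition J :: real where "J = real k - 1"
definition hyp :: "nat \<Rightarrow> real" where
  "hyp a = real ((s choose a) * ((n - s) choose (s - a))) / real (n choose s)"
definition rho :: "nat \<Rightarrow> real" where "rho a = (real k * real a / real s - 1) / J"
definition h :: "real \<Rightarrow> real" where
  "h x = (1 + x / J) ^ (k - 2) * (1 - x * (J - 1) / J + x^2)"
definition om :: "real \<Rightarrow> real" where "om x = J / (real k)^2 * (1 - x)^2"
text \<open>The increment of \<open>rho\<close>, and also the scale in which \<open>t\<close>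
  constraints enter: the exponent of the weights is proportional to
  \<open>rate - t d lnh\<close>.\<close>

definition d :: real where "d = (real k)^2 / (J * real n)"
text \<open>By \<open>pairwt_Nil_eq_mom\<close> this is the expected sum of \<open>f\<close> of the
  correlation over pairs of balanced solutions after \<open>t\<close> random constraints, in units
  of the squared expected number of solutions.\<close>

definition mom :: "nat \<Rightarrow> (real \<Rightarrow> real) \<Rightarrow> real" where
  "mom t f = (\<Sum>a\<le>s. hyp a * h (rho a) ^ t * f (rho a))"

lemma J2: "2 \<le> J" using k3 by (simp add: J_def)
lemma k_eq: "real k = J + 1" by (simp add: J_def)
lemma n_pos: "0 < real n" using k3 s_pos by (simp add: n_def)
lemma s_eq: "real s = real n / real k" using k3 by (simp add: n_def)
lemma n_ge: "3 * s \<le> n" using k3 by (simp add: n_def)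
lemma d_pos: "0 < d" using J2 n_pos k3 by (simp add: d_def)

lemma rho_Suc: "rho (Suc a) = rho a + d"
  using J2 k3 s_pos by (simp add: rho_def d_def n_def add_divide_distrib diff_divide_distrib power2_eq_square algebra_simps)

lemma rho_ge: "-1 / J \<le> rho a"
  using J2 divide_right_mono[of "-1" "real k * real a / real s - 1" J] by (simp add: rho_def)

lemma rho_le: "a \<le> s \<Longrightarrow> rho a \<le> 1"
proof -
  assume "a \<le> s"
  hence "real k * real a \<le> real k * real s" by (intro mult_left_mono) auto
  hence "real k * real a / real s \<le> real k" using s_pos by (simp add: pos_divide_le_eq)
  thus ?thesis using J2 by (simp add: rho_def k_eq)
qed

lemma a_eq: "real a = (real n / (real k)^2) * (1 + J * rho a)"
  using J2 k3 s_pos by (simp add: rho_def n_def power2_eq_square)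

lemma sa_eq: "real s - real a = (real n * J / (real k)^2) * (1 - rho a)"
proof -
  have "real s - real a = real n / real k - (real n / (real k)^2) * (1 + J * rho a)"
    by (simp only: a_eq[symmetric] s_eq[symmetric])
  also have "\<dots> = (real n / (real k)^2) * (real k - (1 + J * rho a))"
    using k3 by (simp add: power2_eq_square right_diff_distrib)
  also have "real k - (1 + J * rho a) = J * (1 - rho a)" by (simp add: k_eq algebra_simps)
  finally show ?thesis by simp
qed

lemma nsa_eq: "real n - 2 * real s + real a = (real n * J^2 / (real k)^2) * (1 + rho a / J)"
proof -
  have "real n - 2 * real s + real a = (real n - real s) - (real s - real a)" by simp
  also have "\<dots> = (real n / (real k)^2) * (real k * J - J * (1 - rho a))"
  proof -
    have "real n - real n / real k = real n / (real k)^2 * (real k * J)"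
      using k3 by (simp add: J_def field_simps power2_eq_square)
    thus ?thesis unfolding sa_eq unfolding s_eq by (simp add: right_diff_distrib)
  qed
  also have "real k * J - J * (1 - rho a) = J^2 * (1 + rho a / J)"
    using J2 by (simp add: k_eq power2_eq_square algebra_simps)
  finally show ?thesis by simp
qed

lemma h_eq_exp: "-1/J \<le> x \<Longrightarrow> h x = exp (lnh J x)"
proof -
  assume x: "-1/J \<le> x"
  have "exp ((J - 1) * ln (1 + x / J)) = (1 + x / J) ^ (k - 2)"
  proof -
    have "J - 1 = real (k - 2)" using k3 by (simp add: J_def)
    thus ?thesis using linear_factor_pos(1)[OF J2 x] by (simp add: exp_of_nat_mult)
  qed
  thus ?thesis using quadratic_factor_pos[OF J2, of x] by (simp add: lnh_def h_def exp_add)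
qed

lemma h_pos: "-1/J \<le> x \<Longrightarrow> 0 < h x"
  by (simp add: h_eq_exp)

lemma h_rho_pos: "0 < h (rho a)"
  by (rule h_pos[OF rho_ge])

lemma abs_rho_le: "a \<le> s \<Longrightarrow> \<bar>rho a\<bar> \<le> 1"
proof -
  have "-1 \<le> -1/J" using J2 by simp
  thus "a \<le> s \<Longrightarrow> \<bar>rho a\<bar> \<le> 1" using rho_ge[of a] rho_le[of a] by linarith
qed

lemma h_le: "a \<le> s \<Longrightarrow> h (rho a) \<le> 1 + 2 * rho a ^ 2"
proof -
  assume a: "a \<le> s"
  have r: "rho a ^ 2 \<le> 1" using abs_rho_le[OF a] by (simp add: abs_square_le_1)
  have "h (rho a) \<le> exp (rho a ^ 2)"
    using lnh_le_square[OF J2 rho_ge, of a] by (simp add: h_eq_exp[OF rho_ge])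
  also have "\<dots> \<le> 1 + rho a ^ 2 + (rho a ^ 2)^2" using r by (intro exp_bound) auto
  also have "(rho a ^ 2)^2 \<le> rho a ^ 2" using r by (simp add: power2_eq_square mult_left_le)
  finally show ?thesis by simp
qed

lemma hyp_nonneg: "0 \<le> hyp a" by (simp add: hyp_def)

lemma sum_hyp: "(\<Sum>a\<le>s. hyp a) = 1"
proof -
  have "(\<Sum>a\<le>s. (s choose a) * ((n - s) choose (s - a))) = (s + (n - s)) choose s"
    by (rule vandermonde)
  also have "s + (n - s) = n" using n_ge by simp
  finally have "(\<Sum>a\<le>s. real ((s choose a) * ((n - s) choose (s - a)))) = real (n choose s)"
    by (metis (no_types, lifting) of_nat_sum sum.cong)
  moreover have "0 < n choose s" using n_ge by (simp add: zero_less_binomial_iff)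
  ultimately show ?thesis by (simp add: hyp_def sum_divide_distrib[symmetric])
qed

text \<open>Stirling on every factorial: the linear terms cancel and the \<open>x ln x\<close> terms
  assemble to \<open>rate\<close>. The four factorials in the numerator cost \<open>exp 4\<close>
  and \<open>n^4\<close>, which is affordable only where \<open>rate\<close> is bounded away from
  \<open>0\<close>.\<close>

lemma hyp_le:
  assumes a: "a \<le> s"
  shows "hyp a \<le> exp 4 * real n ^ 4 * exp (- (real n * J / (real k)^2) * rate J (rho a))"
proof -
  define X where "X m = real m * ln (real m)" for m :: nat
  let ?x = "rho a"
  have sn: "s \<le> n" "s - a \<le> n - s" using n_ge by auto
  have fpos: "0 < (fact m :: real)" for m by simp
  have e1: "real (s choose a) = fact s / (fact a * fact (s - a))"
    using a by (rule binomial_fact)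
  have e2: "real ((n - s) choose (s - a)) = fact (n - s) / (fact (s - a) * fact (n - 2 * s + a))"
  proof -
    have "n - s - (s - a) = n - 2 * s + a" using a n_ge by simp
    thus ?thesis using binomial_fact[OF sn(2), where ?'a=real] by (simp only:)
  qed
  have e3: "real (n choose s) = fact n / (fact s * fact (n - s))"
    using sn(1) by (rule binomial_fact)
  have "hyp a = (fact s * fact (n - s) * (fact s * fact (n - s)))
      / (fact a * fact (s - a) * (fact (s - a) * fact (n - 2 * s + a)) * fact n)"
    unfolding hyp_def of_nat_mult e1 e2 e3 by simp
  also have "ln \<dots> = 2 * ln (fact s) + 2 * ln (fact (n - s)) - ln (fact a) - 2 * ln (fact (s - a))
      - ln (fact (n - 2 * s + a)) - ln (fact n)"
    by (simp add: ln_div ln_mult_pos)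
  finally have ln: "ln (hyp a) = 2 * ln (fact s) + 2 * ln (fact (n - s)) - ln (fact a) - 2 * ln (fact (s - a))
      - ln (fact (n - 2 * s + a)) - ln (fact n)" .
  have hpos: "0 < hyp a"
    unfolding hyp_def using a sn by (auto simp: zero_less_binomial_iff)
  have "n - s > 0" using n_ge s_pos by simp
  have combine: "2 * a1 + 2 * a2 - a3 - 2 * a4 - a5 - a6 \<le> 2 * b1 + 2 * b2 - b3 - 2 * b4 - b5 - b6"
    if "a1 \<le> b1" "a2 \<le> b2" "b3 \<le> a3" "b4 \<le> a4" "b5 \<le> a5" "b6 \<le> a6"
    for a1 a2 a3 a4 a5 a6 b1 b2 b3 b4 b5 b6 :: real
    using that by linarith
  have "ln (hyp a) \<le> 2 * (1 + ln (real s) + (X s - real s)) + 2 * (1 + ln (real (n - s)) + (X (n - s) - real (n - s)))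
      - (X a - real a) - 2 * (X (s - a) - real (s - a)) - (X (n - 2 * s + a) - real (n - 2 * s + a)) - (X n - real n)"
    unfolding ln X_def
    by (rule combine[OF ln_fact_le[OF s_pos] ln_fact_le[OF \<open>n - s > 0\<close>] xlnx_minus_le_ln_fact
          xlnx_minus_le_ln_fact xlnx_minus_le_ln_fact xlnx_minus_le_ln_fact])
  also have "\<dots> = 4 + 2 * ln (real s) + 2 * ln (real (n - s))
      + (2 * X s + 2 * X (n - s) - X a - 2 * X (s - a) - X (n - 2 * s + a) - X n)"
    using a n_ge by (simp add: of_nat_diff algebra_simps)
  also have "2 * X s + 2 * X (n - s) - X a - 2 * X (s - a) - X (n - 2 * s + a) - X n
      = - (real n * J / (real k)^2) * rate J ?x"
  proof -
    let ?K = "real k" and ?N = "real n"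
    have K: "0 < ?K" "0 < J" using k3 J2 by auto
    have A: "0 \<le> 1 + J * ?x" using one_plus_Jx_nonneg[OF J2 rho_ge] .
    have B: "0 \<le> 1 - ?x" using rho_le[OF a] by simp
    have D: "0 \<le> 1 + ?x / J" using linear_factor_pos(1)[OF J2 rho_ge] by (simp add: less_imp_le)
    have N: "0 < ?N" by (rule n_pos)
    have l: "ln (?N / ?K^2) = ln ?N - 2 * ln ?K" "ln (?N * J / ?K^2) = ln ?N + ln J - 2 * ln ?K"
      "ln (?N * J^2 / ?K^2) = ln ?N + 2 * ln J - 2 * ln ?K"
      "ln (?N / ?K) = ln ?N - ln ?K" "ln (?N * J / ?K) = ln ?N + ln J - ln ?K"
      using K N by (simp_all add: ln_div ln_mult_pos ln_realpow)
    have xa: "X a = ?N / ?K^2 * ((1 + J * ?x) * (ln ?N - 2 * ln ?K) + (1 + J * ?x) * ln (1 + J * ?x))"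
      unfolding X_def a_eq[of a] using xlnx_scale[OF _ A, of "?N / ?K^2"] K N l by simp
    have xsa: "X (s - a) = ?N * J / ?K^2 * ((1 - ?x) * (ln ?N + ln J - 2 * ln ?K) + (1 - ?x) * ln (1 - ?x))"
      unfolding X_def of_nat_diff[OF a] sa_eq[of a] using xlnx_scale[OF _ B, of "?N * J / ?K^2"] K N l by simp
    have "real (n - 2 * s + a) = ?N - 2 * real s + real a" using n_ge by (simp add: of_nat_diff)
    hence xns: "X (n - 2 * s + a) = ?N * J^2 / ?K^2 * ((1 + ?x / J) * (ln ?N + 2 * ln J - 2 * ln ?K) + (1 + ?x / J) * ln (1 + ?x / J))"
      unfolding X_def nsa_eq[of a] using xlnx_scale[OF _ D, of "?N * J^2 / ?K^2"] K N l by simp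
    have xs: "X s = ?N / ?K * (ln ?N - ln ?K)" unfolding X_def s_eq l ..
    have "real (n - s) = ?N * J / ?K"
      using n_ge K by (simp add: of_nat_diff s_eq k_eq field_simps)
    hence xn: "X (n - s) = ?N * J / ?K * (ln ?N + ln J - ln ?K)" unfolding X_def by (simp only: l)
    define P where "P = (1 + J * ?x) * ln (1 + J * ?x)"
    define Q where "Q = (1 - ?x) * ln (1 - ?x)"
    define R where "R = ln (1 + ?x / J)"
    define W where "W = ?N / ?K^2"
    have W: "?N / ?K = W * (J + 1)" "?N * J / ?K^2 = W * J" "?N * J^2 / ?K^2 = W * J^2" "?N * J / ?K = W * (J + 1) * J"
       "?N = W * (J + 1)^2"
      using K unfolding k_eq[symmetric] by (simp_all add: W_def power2_eq_square)
    have r: "J * rate J ?x = P + 2 * J * Q + J * (J + ?x) * R"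
    proof -
      have "rate J ?x = P / J + 2 * Q + (J + ?x) * R" by (simp add: rate_def P_def Q_def R_def)
      thus ?thesis using K by (simp add: distrib_left)
    qed
    have jd: "J * (1 + ?x / J) = J + ?x" using K by (simp add: distrib_left)
    have xns': "X (n - 2 * s + a) = W * J * ((J + ?x) * (ln ?N + 2 * ln J - 2 * ln ?K) + (J + ?x) * R)"
      unfolding xns W(3) jd[symmetric] R_def by (simp add: power2_eq_square algebra_simps)
    have XN: "X n = W * (J + 1)^2 * ln ?N" unfolding X_def using W(5) by simp
    have "2 * X s + 2 * X (n - s) - X a - 2 * X (s - a) - X (n - 2 * s + a) - X n
        = - W * (P + 2 * J * Q + J * (J + ?x) * R)"
      unfolding xs xn xa xsa xns' XN W(1,2,4) P_def[symmetric] Q_def[symmetric] W_def[symmetric]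
      by (simp add: power2_eq_square algebra_simps)
    thus ?thesis unfolding r[symmetric] W_def by simp
  qed
  finally have fin: "ln (hyp a) \<le> 4 + 2 * ln (real s) + 2 * ln (real (n - s)) - (real n * J / (real k)^2) * rate J ?x"
    by simp
  have "ln (real s) \<le> ln (real n)" "ln (real (n - s)) \<le> ln (real n)"
    using s_pos n_ge \<open>n - s > 0\<close> by (auto intro!: ln_mono)
  hence "ln (hyp a) \<le> 4 + 4 * ln (real n) + (- (real n * J / (real k)^2) * rate J ?x)"
    using fin by simp
  hence "exp (ln (hyp a)) \<le> exp (4 + 4 * ln (real n) + (- (real n * J / (real k)^2) * rate J ?x))" by simp
  also have "\<dots> = exp 4 * real n ^ 4 * exp (- (real n * J / (real k)^2) * rate J ?x)"
  proof -
    have "exp (4 * ln (real n)) = real n ^ 4" using n_pos exp_of_nat_mult[of 4 "ln (real n)"] by simp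
    thus ?thesis by (simp only: exp_add)
  qed
  finally show ?thesis using hpos by simp
qed

lemma hyp_Suc:
  assumes "a < s"
  shows "hyp (Suc a) * (real (Suc a) * (real n - 2 * real s + real (Suc a))) = hyp a * (real s - real a)^2"
proof -
  have 1: "Suc a * (s choose Suc a) = (s - a) * (s choose a)"
    using assms by (metis Suc_diff_Suc binomial_absorb_comp binomial_absorption)
  define b where "b = s - Suc a"
  have b: "s - a = Suc b" using assms by (simp add: b_def)
  have 2: "Suc b * ((n - s) choose Suc b) = (n - s - b) * ((n - s) choose b)"
    by (metis binomial_absorb_comp binomial_absorption)
  have r1: "real (Suc a) * real (s choose Suc a) = (real s - real a) * real (s choose a)"
    using arg_cong[OF 1, of real] assms by (simp only: of_nat_mult of_nat_diff less_imp_le)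
  have "real (n - s - b) = real n - 2 * real s + real (Suc a)"
    using assms n_ge by (simp add: b_def of_nat_diff)
  hence r2: "(real s - real a) * real ((n - s) choose (s - a)) = (real n - 2 * real s + real (Suc a)) * real ((n - s) choose (s - Suc a))"
    using arg_cong[OF 2, of real] assms unfolding b b_def[symmetric] of_nat_mult
    by (metis b of_nat_diff less_imp_le)
  have "hyp (Suc a) * (real (Suc a) * (real n - 2 * real s + real (Suc a)))
    = (real (Suc a) * real (s choose Suc a)) * ((real n - 2 * real s + real (Suc a)) * real ((n - s) choose (s - Suc a))) / real (n choose s)"
    by (simp add: hyp_def)
  also have "\<dots> = hyp a * (real s - real a)^2"
    unfolding r1 r2[symmetric] by (simp add: hyp_def power2_eq_square)
  finally show ?thesis .
qed

text \<open>Down-rate minus up-rate is \<open>n a - s^2\<close>, linear in \<open>a\<close> and a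
  multiple of \<open>rho a\<close>.\<close>

lemma down_eq: "real a * (real n - 2 * real s + real a) = (real n)^2 * J / (real k)^2 * (rho a + om (rho a))"
proof -
  have "real a * (real n - 2 * real s + real a) = (real s - real a)^2 + (real n * real a - (real s)^2)"
    by (simp add: power2_eq_square algebra_simps)
  also have "real n * real a - (real s)^2 = (real n)^2 * J / (real k)^2 * rho a"
    unfolding a_eq[of a] unfolding s_eq using k3 by (simp add: power2_eq_square field_simps)
  also have "(real s - real a)^2 = (real n)^2 * J / (real k)^2 * om (rho a)"
    unfolding sa_eq om_def by (simp add: power2_eq_square)
  finally show ?thesis by (simp add: distrib_left)
qed

lemma up_eq: "(real s - real a)^2 = (real n)^2 * J / (real k)^2 * om (rho a)"
  unfolding sa_eq om_def by (simp add: power2_eq_square)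

lemma hyp_Suc': "a < s \<Longrightarrow> hyp (Suc a) * (rho (Suc a) + om (rho (Suc a))) = hyp a * om (rho a)"
proof -
  assume a: "a < s"
  have c: "0 < (real n)^2 * J / (real k)^2" using n_pos J2 k3 by simp
  have "((real n)^2 * J / (real k)^2) * (hyp (Suc a) * (rho (Suc a) + om (rho (Suc a))))
      = ((real n)^2 * J / (real k)^2) * (hyp a * om (rho a))"
    using hyp_Suc[OF a] unfolding down_eq up_eq by (simp add: mult_ac)
  thus ?thesis using c by (metis mult_left_cancel less_irrefl)
qed

text \<open>Detailed balance of the birth-death chain, summed against \<open>h^t g\<close>.\<close>

lemma stein_identity:
  "mom t (\<lambda>x. g x * x) = (\<Sum>a\<le>s. hyp a * (om (rho a) * (h (rho a + d) ^ t * g (rho a + d) - h (rho a) ^ t * g (rho a))))"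
proof -
  define F where "F a = h (rho a) ^ t * g (rho a)" for a
  have "(\<Sum>a\<le>s. hyp a * F a * (rho a + om (rho a))) = (\<Sum>a<Suc s. hyp a * F a * (rho a + om (rho a)))"
    by (simp add: lessThan_Suc_atMost)
  also have "\<dots> = hyp 0 * F 0 * (rho 0 + om (rho 0)) + (\<Sum>a<s. hyp (Suc a) * F (Suc a) * (rho (Suc a) + om (rho (Suc a))))"
    by (rule sum.lessThan_Suc_shift)
  also have "rho 0 + om (rho 0) = 0"
    using down_eq[of 0] n_pos J2 k3 by simp
  also have "(\<Sum>a<s. hyp (Suc a) * F (Suc a) * (rho (Suc a) + om (rho (Suc a)))) = (\<Sum>a<s. hyp a * om (rho a) * F (Suc a))"
    using hyp_Suc' by (intro sum.cong refl) (simp add: mult_ac)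
  also have "\<dots> = (\<Sum>a<Suc s. hyp a * om (rho a) * F (Suc a))"
    using up_eq[of s] n_pos J2 k3 by simp
  also have "\<dots> = (\<Sum>a\<le>s. hyp a * om (rho a) * F (Suc a))" by (simp add: lessThan_Suc_atMost)
  finally have "(\<Sum>a\<le>s. hyp a * F a * (rho a + om (rho a))) = (\<Sum>a\<le>s. hyp a * om (rho a) * F (Suc a))" by simp
  hence "(\<Sum>a\<le>s. hyp a * F a * rho a) = (\<Sum>a\<le>s. hyp a * om (rho a) * F (Suc a)) - (\<Sum>a\<le>s. hyp a * om (rho a) * F a)"
    by (simp add: distrib_left sum.distrib mult_ac)
  also have "\<dots> = (\<Sum>a\<le>s. hyp a * (om (rho a) * (F (Suc a) - F a)))"
    by (simp add: sum_subtractf[symmetric] algebra_simps)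
  finally show ?thesis by (simp add: mom_def F_def rho_Suc mult_ac)
qed

end

section \<open>The Stein identity near and away from correlation zero\<close>

lemma abs_exp_minus_linear_le: "\<bar>exp y - 1 - y\<bar> \<le> y^2 * exp \<bar>y\<bar>" for y :: real
proof -
  have 1: "\<bar>exp y - 1\<bar> \<le> \<bar>y\<bar> * exp \<bar>y\<bar>"
  proof (cases "0 \<le> y")
    case True
    have "1 - y \<le> exp (- y)" using exp_ge_add_one_self[of "-y"] by simp
    hence "(1 - y) * exp y \<le> exp (- y) * exp y" by (intro mult_right_mono) auto
    hence "exp y - 1 \<le> y * exp y" by (simp add: exp_minus algebra_simps)
    thus ?thesis using True by simp
  next
    case False
    have "1 + y \<le> exp y" by (rule exp_ge_add_one_self)
    moreover have "\<bar>y\<bar> * 1 \<le> \<bar>y\<bar> * exp \<bar>y\<bar>" by (intro mult_left_mono) auto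
    moreover have "\<bar>exp y - 1\<bar> = 1 - exp y" using False by simp
    ultimately show ?thesis using False by linarith
  qed
  have "1 - y \<le> exp (- y)" using exp_ge_add_one_self[of "-y"] by simp
  hence "(1 - y) * exp y \<le> exp (- y) * exp y" by (intro mult_right_mono) auto
  hence "exp y - 1 - y \<le> y * (exp y - 1)" by (simp add: exp_minus algebra_simps)
  also have "\<dots> \<le> \<bar>y\<bar> * \<bar>exp y - 1\<bar>" by (simp add: abs_mult[symmetric])
  also have "\<dots> \<le> \<bar>y\<bar> * (\<bar>y\<bar> * exp \<bar>y\<bar>)" using 1 by (intro mult_left_mono) auto
  finally have "exp y - 1 - y \<le> y^2 * exp \<bar>y\<bar>" by (simp add: power2_eq_square)
  moreover have "0 \<le> exp y - 1 - y" using exp_ge_add_one_self[of y] by linarith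
  ultimately show ?thesis by linarith
qed

text \<open>The derivative of \<open>lnh\<close> is \<open>z (K/J + z w z)\<close> with
  \<open>w\<close> bounded, and the prefactor at \<open>0\<close> is \<open>J / K^2\<close>; to
  first order the exponential term is therefore
  \<open>(J / K^2) t d (K / J) x = (t d / K) x\<close>. The constant must be uniform, since
  \<open>x\<close>, \<open>d\<close> and \<open>t\<close> all vary with \<open>n\<close>.\<close>

lemma near_expansion:
  fixes J D :: real
  defines "K \<equiv> J + 1"
  assumes J: "2 \<le> J" and D: "0 \<le> D"
  obtains C where "0 \<le> C"
    "\<And>x d t. -1/J \<le> x \<Longrightarrow> \<bar>x\<bar> \<le> 1/4 \<Longrightarrow> 0 < d \<Longrightarrow> d \<le> 1/4 \<Longrightarrow> 0 \<le> t \<Longrightarrow> t * d \<le> D \<Longrightarrow>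
      \<bar>J / K^2 * (1 - x)^2 * (exp (t * (lnh J (x + d) - lnh J x)) - 1) - t * d / K * x\<bar> \<le> C * (x^2 + d)"
proof -
  define Q where "Q z = 1 - z * (J - 1) / J + z^2" for z
  define P where "P z = (J - 1) + (J + z) * ((J - 1) / J) - (J + z) * z" for z
  define w where "w z = K * P z / (J * ((J + z) * Q z))" for z
  define om0 where "om0 = J / K^2"
  have K: "3 \<le> K" using J by (simp add: K_def)
  have Qp: "0 < Q z" for z using quadratic_factor_pos[OF J] by (simp add: Q_def)
  have Jz: "0 < J + z" if "-1/J \<le> z" for z using linear_factor_pos(2)[OF J that] .
  have "continuous_on {-1/J..1} w"
    unfolding w_def[abs_def] P_def Q_def[abs_def]
    using J Jz Qp[unfolded Q_def] by (intro continuous_intros) (auto simp: less_imp_neq[symmetric])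
  hence "bounded (w ` {-1/J..1})" by (intro compact_imp_bounded compact_continuous_image) auto
  then obtain C1 where "\<forall>y\<in>w ` {-1/J..1}. norm y \<le> C1" unfolding bounded_iff by blast
  hence C1: "\<bar>w z\<bar> \<le> C1" if "-1/J \<le> z" "z \<le> 1" for z using that by simp
  have "-1/J \<le> 0" using J by simp
  hence C10: "0 \<le> C1" using C1[of 0] by simp
  have deriv_eq: "K * z * (1 + z) / ((J + z) * Q z) = z * (K / J + z * w z)" if "-1/J \<le> z" for z
  proof -
    have "J * (1 + z) - (J + z) * Q z = z * P z"
      using J by (simp add: Q_def P_def field_simps power2_eq_square)
    hence e: "J * (1 + z) = (J + z) * Q z + z * P z" by simp
    have nz: "J + z \<noteq> 0" "Q z \<noteq> 0" "J \<noteq> 0" using Jz[OF that] Qp[of z] J by auto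
    have "K * z * (1 + z) / ((J + z) * Q z) = z * K * (J * (1 + z)) / (J * ((J + z) * Q z))"
      using nz by simp
    also have "\<dots> = z * K * ((J + z) * Q z) / (J * ((J + z) * Q z)) + z * (z * w z)"
      unfolding e by (simp add: w_def distrib_left add_divide_distrib mult_ac)
    also have "z * K * ((J + z) * Q z) / (J * ((J + z) * Q z)) = z * (K / J)" using nz by simp
    finally show ?thesis by (simp add: distrib_left)
  qed
  define C3 where "C3 = K / J + C1"
  define Y0 where "Y0 = D * C3"
  define C2 where "C2 = 2 * C1 + K / J"
  define C where "C = 2 * om0 * (2 * Y0^2 * exp Y0) + 3 * om0 * Y0 + om0 * (D * C2)"
  have pos: "0 \<le> om0" "0 \<le> C3" "0 \<le> Y0" "0 \<le> C2" "0 \<le> K / J"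
    using J K C10 D by (auto simp: om0_def C3_def Y0_def C2_def)
  have C0: "0 \<le> C" using pos D by (simp add: C_def)
  show thesis
  proof (rule that[OF C0])
    fix x d t :: real
    assume x: "-1/J \<le> x" "\<bar>x\<bar> \<le> 1/4" and d: "0 < d" "d \<le> 1/4" and t: "0 \<le> t" "t * d \<le> D"
    define u where "u = x^2 + d"
    have u0: "0 \<le> u" using d by (simp add: u_def)
    define \<theta> where "\<theta> = t * d"
    have \<theta>: "0 \<le> \<theta>" "\<theta> \<le> D" using t d by (auto simp: \<theta>_def)
    have "\<exists>z>x. z < x + d \<and> lnh J (x + d) - lnh J x = (x + d - x) * (K * z * (1 + z) / ((J + z) * Q z))"
    proof (rule MVT2)
      fix z assume "x \<le> z" "z \<le> x + d"
      thus "(lnh J has_real_derivative K * z * (1 + z) / ((J + z) * Q z)) (at z)"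
        using has_deriv_lnh[OF J, of z] x by (simp add: K_def Q_def)
    qed (use d in simp)
    then obtain z where z: "x < z" "z < x + d"
      and eq: "lnh J (x + d) - lnh J x = d * (K * z * (1 + z) / ((J + z) * Q z))" by auto
    have z': "-1/J \<le> z" "z \<le> 1" "\<bar>z\<bar> \<le> \<bar>x\<bar> + d" "\<bar>z\<bar> \<le> 1" "\<bar>z - x\<bar> \<le> d" using z x d by auto
    have wz: "\<bar>w z\<bar> \<le> C1" by (rule C1[OF z'(1,2)])
    have zsq: "z^2 \<le> 2 * u"
    proof -
      have "\<bar>z\<bar>^2 \<le> (\<bar>x\<bar> + d)^2" using z'(3) by (intro power_mono) auto
      hence "z^2 \<le> (\<bar>x\<bar> + d)^2" by simp
      also have "\<dots> \<le> 2 * x^2 + 2 * d^2"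
        using zero_le_power2[of "\<bar>x\<bar> - d"] by (simp add: power2_eq_square algebra_simps)
      also have "d^2 \<le> d" using d by (simp add: power2_eq_square mult_left_le)
      finally show ?thesis by (simp add: u_def)
    qed
    define Y where "Y = t * (lnh J (x + d) - lnh J x)"
    have Y: "Y = \<theta> * (z * (K / J + z * w z))"
      unfolding Y_def eq deriv_eq[OF z'(1)] by (simp add: \<theta>_def)
    have Yabs: "\<bar>Y\<bar> \<le> Y0 * \<bar>z\<bar>"
    proof -
      have "\<bar>z * w z\<bar> \<le> 1 * C1" unfolding abs_mult using z' wz by (intro mult_mono) auto
      hence "\<bar>K / J + z * w z\<bar> \<le> C3" using pos(5) unfolding C3_def by linarith
      hence "\<theta> * (\<bar>z\<bar> * \<bar>K / J + z * w z\<bar>) \<le> D * (\<bar>z\<bar> * C3)"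
        using \<theta> by (intro mult_mono) auto
      thus ?thesis using \<theta> by (simp add: Y abs_mult Y0_def mult_ac)
    qed
    have "Y0 * \<bar>z\<bar> \<le> Y0 * 1" using z'(4) pos(3) by (intro mult_left_mono) auto
    hence Yle: "\<bar>Y\<bar> \<le> Y0" using Yabs by linarith
    have Ysq: "Y^2 \<le> 2 * Y0^2 * u"
    proof -
      have "\<bar>Y\<bar>^2 \<le> (Y0 * \<bar>z\<bar>)^2" using Yabs by (intro power_mono) auto
      hence "Y^2 \<le> (Y0 * \<bar>z\<bar>)^2" by simp
      also have "\<dots> = Y0^2 * z^2" by (simp add: power_mult_distrib)
      also have "\<dots> \<le> Y0^2 * (2 * u)" using zsq by (intro mult_left_mono) auto
      finally show ?thesis by (simp add: mult_ac)
    qed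
    have Ylin: "\<bar>Y - \<theta> * (K / J * x)\<bar> \<le> D * C2 * u"
    proof -
      have "Y - \<theta> * (K / J * x) = \<theta> * (z^2 * w z + K / J * (z - x))"
      proof -
        have "\<theta> * (z * (q + z * w z)) - \<theta> * (q * x) = \<theta> * (z^2 * w z + q * (z - x))" for q
          by (simp add: power2_eq_square algebra_simps)
        thus ?thesis unfolding Y .
      qed
      moreover have "\<bar>z^2 * w z + K / J * (z - x)\<bar> \<le> C2 * u"
      proof -
        have "\<bar>z^2 * w z\<bar> \<le> (2 * u) * C1" unfolding abs_mult using zsq wz u0 by (intro mult_mono) auto
        moreover have "\<bar>K / J * (z - x)\<bar> \<le> K / J * u"
        proof -
          have "\<bar>K / J * (z - x)\<bar> = K / J * \<bar>z - x\<bar>" using pos(5) by (simp only: abs_mult abs_of_nonneg)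
          moreover have "\<bar>z - x\<bar> \<le> u" using z'(5) zero_le_power2[of x] unfolding u_def by linarith
          hence "K / J * \<bar>z - x\<bar> \<le> K / J * u" using pos(5) by (intro mult_left_mono) auto
          ultimately show ?thesis by linarith
        qed
        moreover have "C2 * u = (2 * u) * C1 + K / J * u" unfolding C2_def by (simp add: distrib_right)
        ultimately show ?thesis using abs_triangle_ineq[of "z^2 * w z" "K / J * (z - x)"] by linarith
      qed
      ultimately have "\<bar>Y - \<theta> * (K / J * x)\<bar> \<le> D * (C2 * u)"
        using \<theta> by (auto simp: abs_mult intro!: mult_mono)
      thus ?thesis by simp
    qed
    define om_x where "om_x = J / K^2 * (1 - x)^2"
    have o1: "\<bar>om_x\<bar> \<le> 2 * om0"
    proof -
      have "(1 - x)^2 \<le> (5/4)^2" using x by (intro power_mono) auto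
      hence "(1 - x)^2 \<le> 2" by (simp add: power2_eq_square)
      hence "om0 * (1 - x)^2 \<le> om0 * 2" using pos(1) by (intro mult_left_mono) auto
      moreover have "\<bar>om_x\<bar> = om0 * (1 - x)^2" using J by (simp add: om_x_def om0_def abs_mult)
      ultimately show ?thesis by linarith
    qed
    have o2: "\<bar>om_x - om0\<bar> \<le> 3 * om0 * \<bar>x\<bar>"
    proof -
      have "om_x = om0 * (1 - x)^2" by (simp add: om_x_def om0_def)
      hence "om_x - om0 = om0 * (x * (x - 2))" by (simp add: power2_eq_square algebra_simps)
      moreover have "\<bar>x * (x - 2)\<bar> \<le> \<bar>x\<bar> * 3" unfolding abs_mult using x by (intro mult_left_mono) auto
      hence "om0 * \<bar>x * (x - 2)\<bar> \<le> om0 * (\<bar>x\<bar> * 3)" using pos(1) by (intro mult_left_mono)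
      ultimately show ?thesis using pos(1) by (simp add: abs_mult)
    qed
    \<comment> \<open>Three errors: the exponential beyond its linear part, the prefactor frozen at
      \<open>0\<close>, and the linearisation of the increment of \<open>lnh\<close>.\<close>
    have split: "om_x * (exp Y - 1) - \<theta> / K * x = om_x * (exp Y - 1 - Y) + (om_x - om0) * Y + om0 * (Y - \<theta> * (K / J * x))"
    proof -
      have "om0 * (\<theta> * (K / J * x)) = \<theta> / K * x" using J K by (simp add: om0_def power2_eq_square)
      thus ?thesis by (simp add: algebra_simps)
    qed
    have b1: "\<bar>om_x * (exp Y - 1 - Y)\<bar> \<le> 2 * om0 * (2 * Y0^2 * exp Y0) * u"
    proof -
      have "\<bar>exp Y - 1 - Y\<bar> \<le> Y^2 * exp \<bar>Y\<bar>" by (rule abs_exp_minus_linear_le)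
      also have "\<dots> \<le> (2 * Y0^2 * u) * exp Y0" using Ysq Yle u0 by (intro mult_mono) auto
      finally have "\<bar>om_x\<bar> * \<bar>exp Y - 1 - Y\<bar> \<le> (2 * om0) * ((2 * Y0^2 * u) * exp Y0)"
        using o1 pos(1) by (intro mult_mono) auto
      thus ?thesis by (simp add: abs_mult mult_ac)
    qed
    have b2: "\<bar>(om_x - om0) * Y\<bar> \<le> 3 * om0 * Y0 * u"
    proof -
      have "\<bar>x\<bar> * \<bar>z\<bar> \<le> u"
      proof -
        have "\<bar>x\<bar> * \<bar>z\<bar> \<le> \<bar>x\<bar> * (\<bar>x\<bar> + d)" using z'(3) by (intro mult_left_mono) auto
        also have "\<dots> = x^2 + \<bar>x\<bar> * d" by (simp add: power2_eq_square algebra_simps abs_mult[symmetric])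
        also have "\<bar>x\<bar> * d \<le> 1 * d" using x d by (intro mult_right_mono) auto
        finally show ?thesis by (simp add: u_def)
      qed
      have "\<bar>om_x - om0\<bar> * \<bar>Y\<bar> \<le> (3 * om0 * \<bar>x\<bar>) * (Y0 * \<bar>z\<bar>)"
        using o2 Yabs pos by (intro mult_mono) auto
      also have "\<dots> = (3 * om0 * Y0) * (\<bar>x\<bar> * \<bar>z\<bar>)" by simp
      also have "\<dots> \<le> (3 * om0 * Y0) * u" using \<open>\<bar>x\<bar> * \<bar>z\<bar> \<le> u\<close> pos by (intro mult_left_mono) auto
      finally show ?thesis by (simp add: abs_mult)
    qed
    have b3: "\<bar>om0 * (Y - \<theta> * (K / J * x))\<bar> \<le> om0 * (D * C2) * u"
      using Ylin pos(1) by (simp add: abs_mult mult_left_mono mult.assoc)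
    have "\<bar>om_x * (exp Y - 1) - \<theta> / K * x\<bar> \<le> C * u"
      unfolding split C_def using b1 b2 b3 by (simp add: distrib_right)
    thus "\<bar>J / K^2 * (1 - x)^2 * (exp (t * (lnh J (x + d) - lnh J x)) - 1) - t * d / K * x\<bar> \<le> C * (x^2 + d)"
      by (simp add: om_x_def Y_def \<theta>_def u_def)
  qed
qed

context overlap
begin

lemma om_bounds: "-1/J \<le> x \<Longrightarrow> x \<le> 1 \<Longrightarrow> 0 \<le> om x \<and> om x \<le> 1"
proof -
  assume x: "-1/J \<le> x" "x \<le> 1"
  have "1 - x \<le> 1 + 1 / J" using x by simp
  also have "\<dots> = real k / J" using J2 by (simp add: k_eq field_simps)
  finally have "(1 - x)^2 \<le> (real k / J)^2" using x by (intro power_mono) auto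
  hence "J / (real k)^2 * (1 - x)^2 \<le> J / (real k)^2 * (real k / J)^2" using J2 by (intro mult_left_mono) auto
  also have "\<dots> = 1 / J" using J2 k3 by (simp add: power2_eq_square)
  finally have "om x \<le> 1 / J" unfolding om_def .
  moreover have "1 / J \<le> 1" using J2 by simp
  moreover have "0 \<le> om x" using J2 by (simp add: om_def)
  ultimately show "0 \<le> om x \<and> om x \<le> 1" by linarith
qed

text \<open>The gap \<open>g\<close> makes the weight exponentially small.
  \<open>(1 + y / 10)^10 \<le> exp y\<close> turns this into a tenth inverse power of
  \<open>n\<close>, which pays for the \<open>n^4\<close> of \<open>hyp_le\<close> and leaves
  \<open>n^6\<close>.\<close>

lemma far_bound:
  assumes g: "\<And>x y. -1/J \<le> x \<Longrightarrow> x \<le> 1 \<Longrightarrow> \<delta> \<le> \<bar>x\<bar> \<Longrightarrow> 0 \<le> y \<Longrightarrow> y \<le> X \<Longrightarrow> g \<le> rate J x - y * lnh J x"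
    and "0 < g" and t: "real t * d \<le> X" and a: "a \<le> s" "\<delta> \<le> \<bar>rho a\<bar>"
  shows "hyp a * h (rho a) ^ t \<le> exp 4 * (10 * (real k)^2 / (J * g)) ^ 10 / real n ^ 6"
proof -
  define c where "c = J / (real k)^2 * g"
  have c: "0 < c" using J2 k3 \<open>0 < g\<close> by (simp add: c_def)
  have N: "0 < real n" by (rule n_pos)
  have kk: "(real n * J / (real k)^2) * (real t * d) = real t"
    using N J2 k3 by (simp add: d_def)
  have "h (rho a) ^ t = exp (real t * lnh J (rho a))"
    using rho_ge by (simp add: h_eq_exp exp_of_nat_mult)
  hence "hyp a * h (rho a) ^ t \<le> (exp 4 * real n ^ 4 * exp (- (real n * J / (real k)^2) * rate J (rho a))) * exp (real t * lnh J (rho a))"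
    using mult_right_mono[OF hyp_le[OF a(1)], of "exp (real t * lnh J (rho a))"] by simp
  also have "\<dots> = exp 4 * real n ^ 4 * exp (- (real n * J / (real k)^2) * (rate J (rho a) - (real t * d) * lnh J (rho a)))"
  proof -
    have "- (real n * J / (real k)^2) * (rate J (rho a) - (real t * d) * lnh J (rho a))
      = - (real n * J / (real k)^2) * rate J (rho a) + ((real n * J / (real k)^2) * (real t * d)) * lnh J (rho a)"
      by (simp add: algebra_simps)
    thus ?thesis unfolding kk by (simp only: exp_add mult.assoc)
  qed
  also have "\<dots> \<le> exp 4 * real n ^ 4 * exp (- (real n * J / (real k)^2) * g)"
  proof -
    have "0 \<le> real t * d" using d_pos by simp
    from g[OF rho_ge rho_le[OF a(1)] a(2) this t]
    have "(real n * J / (real k)^2) * g \<le> (real n * J / (real k)^2) * (rate J (rho a) - (real t * d) * lnh J (rho a))"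
      using J2 by (intro mult_left_mono) auto
    hence "exp (- (real n * J / (real k)^2) * (rate J (rho a) - (real t * d) * lnh J (rho a)))
       \<le> exp (- (real n * J / (real k)^2) * g)" by simp
    thus ?thesis by (intro mult_left_mono) auto
  qed
  also have "exp (- (real n * J / (real k)^2) * g) = 1 / exp (c * real n)"
    by (simp add: c_def exp_minus inverse_eq_divide mult_ac)
  also have "exp 4 * real n ^ 4 * (1 / exp (c * real n)) \<le> exp 4 * real n ^ 4 * (1 / (c * real n / 10) ^ 10)"
  proof -
    have "(c * real n / 10) ^ 10 \<le> (1 + c * real n / 10) ^ 10" using c N by (intro power_mono) auto
    also have "\<dots> \<le> exp (c * real n)"
    proof -
      have "0 < c * real n" using c N by simp
      thus ?thesis using exp_ge_one_plus_x_over_n_power_n[of 10 "c * real n"] by simp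
    qed
    finally show ?thesis using c N by (intro mult_left_mono divide_left_mono) auto
  qed
  also have "\<dots> = exp 4 * (10 / c) ^ 10 / real n ^ 6"
  proof -
    have "1 / (c * real n / 10) ^ 10 = (10 / c) ^ 10 / real n ^ 10"
      using c N by (simp add: power_divide power_mult_distrib)
    have "real n ^ 10 = real n ^ 4 * real n ^ 6" by (simp flip: power_add)
    have "e * p * (X / (p * r)) = e * X / r" if "p \<noteq> 0" for e p X r :: real
      using that by simp
    from this[of "real n ^ 4" "exp 4" "(10 / c) ^ 10" "real n ^ 6"]
    show ?thesis using N unfolding \<open>1 / (c * real n / 10) ^ 10 = (10 / c) ^ 10 / real n ^ 10\<close>
      \<open>real n ^ 10 = real n ^ 4 * real n ^ 6\<close> by (metis less_irrefl power_not_zero)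
  qed
  also have "10 / c = 10 * (real k)^2 / (J * g)" by (simp add: c_def)
  finally show ?thesis .
qed

lemma mom_nonneg: "(\<And>a. a \<le> s \<Longrightarrow> 0 \<le> f (rho a)) \<Longrightarrow> 0 \<le> mom t f"
  unfolding mom_def using hyp_nonneg h_rho_pos by (intro sum_nonneg mult_nonneg_nonneg zero_le_power) (auto intro: less_imp_le)

context
  fixes C D \<delta> Fb :: real and t :: nat
  assumes near: "\<And>x. -1/J \<le> x \<Longrightarrow> \<bar>x\<bar> \<le> 1/4 \<Longrightarrow>
      \<bar>om x * (exp (real t * (lnh J (x + d) - lnh J x)) - 1) - real t * d / real k * x\<bar> \<le> C * (x^2 + d)"
    and \<delta>: "0 < \<delta>" "\<delta> \<le> 1/4" and d\<delta>: "d \<le> \<delta> / 2" and tD: "real t * d \<le> D" and C0: "0 \<le> C"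
    and far: "\<And>a. a \<le> s \<Longrightarrow> \<delta> / 2 \<le> \<bar>rho a\<bar> \<Longrightarrow> hyp a * h (rho a) ^ t \<le> Fb"
begin

lemma D0: "0 \<le> D"
proof -
  have "0 \<le> real t * d" using d_pos by simp
  thus ?thesis using tD by linarith
qed

lemma h_shift: "h (rho a + d) ^ t = h (rho a) ^ t * exp (real t * (lnh J (rho a + d) - lnh J (rho a)))"
proof -
  have "-1/J \<le> rho a + d" using rho_ge[of a] d_pos by simp
  thus ?thesis using rho_ge[of a]
    by (simp add: h_eq_exp exp_of_nat_mult[symmetric] exp_add[symmetric] algebra_simps)
qed

text \<open>In the Stein identity the change of \<open>h^t\<close> contributes
  \<open>t d / k\<close> times the moment itself; moved to the left, it leaves the contraction
  factor \<open>1 - t d / k\<close>. What remains are expansion errors and increments of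
  \<open>g\<close> near \<open>0\<close>, and negligible weights elsewhere. The range
  \<open>5/4\<close> covers \<open>rho a + d\<close>, and the bound \<open>2\<close> admits
  \<open>g x = x^3\<close>, as \<open>(5/4)^3 < 2\<close>.\<close>

lemma stein_step:
  assumes g: "\<And>x. \<bar>x\<bar> \<le> 5/4 \<Longrightarrow> \<bar>g x\<bar> \<le> 2"
  shows "\<bar>(1 - real t * d / real k) * mom t (\<lambda>x. g x * x)\<bar>
    \<le> (\<Sum>a\<in>{a. a \<le> s \<and> \<bar>rho a\<bar> < \<delta>}. hyp a * h (rho a) ^ t * (C * (rho a ^ 2 + d) * \<bar>g (rho a)\<bar>
          + (1 + D + 2 * C) * \<bar>g (rho a + d) - g (rho a)\<bar>))
      + real (Suc s) * ((6 + 2 * D) * Fb)"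
proof -
  define \<theta> where "\<theta> = real t * d / real k"
  have \<theta>: "0 \<le> \<theta>" "\<theta> \<le> D"
  proof -
    show "0 \<le> \<theta>" using d_pos by (simp add: \<theta>_def)
    have "\<theta> \<le> real t * d / 1" unfolding \<theta>_def using d_pos k3 by (intro divide_left_mono) auto
    thus "\<theta> \<le> D" using tD by simp
  qed
  define W where "W a = hyp a * h (rho a) ^ t" for a
  have W0: "0 \<le> W a" for a using hyp_nonneg h_rho_pos[of a] by (simp add: W_def)
  define T where "T a = hyp a * (om (rho a) * (h (rho a + d) ^ t * g (rho a + d) - h (rho a) ^ t * g (rho a)))
     - \<theta> * (W a * (g (rho a) * rho a))" for a
  have "mom t (\<lambda>x. g x * x) - \<theta> * mom t (\<lambda>x. g x * x) = (\<Sum>a\<le>s. T a)"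
    unfolding T_def sum_subtractf sum_distrib_left[symmetric]
    by (subst (1) stein_identity) (simp add: mom_def W_def)
  hence eq: "(1 - \<theta>) * mom t (\<lambda>x. g x * x) = (\<Sum>a\<le>s. T a)" by (simp add: left_diff_distrib)
  define b where "b a = W a * (C * (rho a ^ 2 + d) * \<bar>g (rho a)\<bar> + (1 + D + 2 * C) * \<bar>g (rho a + d) - g (rho a)\<bar>)" for a
  have d1: "d \<le> 1/4" using d\<delta> \<delta> by simp
  have nearT: "\<bar>T a\<bar> \<le> b a" if a: "a \<le> s" "\<bar>rho a\<bar> < \<delta>" for a
  proof -
    define \<kappa> where "\<kappa> = exp (real t * (lnh J (rho a + d) - lnh J (rho a)))"
    define e where "e = om (rho a) * (\<kappa> - 1) - \<theta> * rho a"
    have r4: "\<bar>rho a\<bar> \<le> 1/4" using a \<delta> by simp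
    have e: "\<bar>e\<bar> \<le> C * (rho a ^ 2 + d)" using near[OF rho_ge r4] by (simp add: e_def \<kappa>_def \<theta>_def)
    have ok: "\<bar>om (rho a) * \<kappa>\<bar> \<le> 1 + D + 2 * C"
    proof -
      have "om (rho a) * \<kappa> = om (rho a) + \<theta> * rho a + e" by (simp add: e_def algebra_simps)
      moreover have "\<bar>\<theta> * rho a\<bar> \<le> D * 1" unfolding abs_mult using \<theta> r4 by (intro mult_mono) auto
      moreover have "rho a ^ 2 \<le> 1" using r4 by (simp add: abs_square_le_1)
      hence "C * (rho a ^ 2 + d) \<le> C * 2" using d1 C0 by (intro mult_left_mono) auto
      moreover have "0 \<le> om (rho a) \<and> om (rho a) \<le> 1" by (rule om_bounds[OF rho_ge rho_le[OF a(1)]])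
      ultimately show ?thesis using e by (simp add: abs_le_iff)
    qed
    have "T a = W a * (g (rho a) * e + om (rho a) * \<kappa> * (g (rho a + d) - g (rho a)))"
      unfolding T_def h_shift \<kappa>_def[symmetric] e_def W_def by (simp add: algebra_simps)
    also have "\<bar>\<dots>\<bar> \<le> W a * (\<bar>g (rho a)\<bar> * (C * (rho a ^ 2 + d)) + (1 + D + 2 * C) * \<bar>g (rho a + d) - g (rho a)\<bar>)"
      unfolding abs_mult abs_of_nonneg[OF W0]
      using e ok by (intro mult_left_mono W0 order_trans[OF abs_triangle_ineq] add_mono)
        (auto simp: abs_mult intro!: mult_left_mono mult_right_mono)
    finally show ?thesis by (simp add: b_def mult_ac)
  qed
  have tri: "\<bar>x - y - z\<bar> \<le> \<bar>x\<bar> + \<bar>y\<bar> + \<bar>z\<bar>" for x y z :: real by linarith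
  have farT: "\<bar>T a\<bar> \<le> (6 + 2 * D) * Fb" if a: "a \<le> s" "\<not> \<bar>rho a\<bar> < \<delta>" for a
  proof -
    have Wa: "W a \<le> Fb" using far[OF a(1)] a(2) \<delta> by (simp add: W_def)
    hence Fb0: "0 \<le> Fb" using W0[of a] by linarith
    have om: "0 \<le> om (rho a)" "om (rho a) \<le> 1" using om_bounds[OF rho_ge rho_le[OF a(1)]] by auto
    \<comment> \<open>\<open>far\<close> at \<open>a\<close> does not control the weight after an
      up-step; detailed balance rewrites it as a weight at \<open>Suc a\<close>. Hence
      \<open>far\<close> is assumed from \<open>\<delta> / 2\<close> on, with
      \<open>d \<le> \<delta> / 2\<close>.\<close>
    have t1: "hyp a * om (rho a) * h (rho a + d) ^ t \<le> 2 * Fb"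
    proof (cases "a = s")
      case True
      have "om (rho a) = 0" using True J2 k3 s_pos by (simp add: om_def rho_def k_eq)
      thus ?thesis using Fb0 by simp
    next
      case False
      hence as: "a < s" using a by simp
      have "\<delta> / 2 \<le> \<bar>rho (Suc a)\<bar>" unfolding rho_Suc using a(2) d\<delta> d_pos by (simp add: abs_if split: if_splits)
      hence W1: "W (Suc a) \<le> Fb" using far[of "Suc a"] as by (simp add: W_def)
      have r: "rho (Suc a) + om (rho (Suc a)) \<le> 2"
        using om_bounds[OF rho_ge rho_le[of "Suc a"]] rho_le[of "Suc a"] as by fastforce
      have "hyp a * om (rho a) * h (rho a + d) ^ t = W (Suc a) * (rho (Suc a) + om (rho (Suc a)))"
        using hyp_Suc'[OF as] by (simp add: W_def rho_Suc mult_ac)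
      also have "\<dots> \<le> W (Suc a) * 2" using r W0 by (intro mult_left_mono)
      finally show ?thesis using W1 by simp
    qed
    have h0: "0 \<le> h (rho a + d) ^ t" using h_pos[of "rho a + d"] rho_ge[of a] d_pos by simp
    have g1: "\<bar>g (rho a)\<bar> \<le> 2" "\<bar>g (rho a + d)\<bar> \<le> 2"
    proof -
      show "\<bar>g (rho a)\<bar> \<le> 2" using abs_rho_le[OF a(1)] by (intro g) auto
      have "\<bar>rho a + d\<bar> \<le> 5/4" using abs_rho_le[OF a(1)] d1 d_pos by linarith
      thus "\<bar>g (rho a + d)\<bar> \<le> 2" by (rule g)
    qed
    define x1 where "x1 = hyp a * om (rho a) * h (rho a + d) ^ t * g (rho a + d)"
    define x2 where "x2 = W a * om (rho a) * g (rho a)"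
    define x3 where "x3 = \<theta> * (W a * (g (rho a) * rho a))"
    have Teq: "T a = x1 - x2 - x3"
      by (simp add: T_def W_def x1_def x2_def x3_def right_diff_distrib mult_ac)
    have "\<bar>hyp a * om (rho a) * h (rho a + d) ^ t\<bar> \<le> 2 * Fb"
      using t1 hyp_nonneg[of a] om h0 by simp
    from mult_mono[OF this g1(2)] have x1: "\<bar>x1\<bar> \<le> (2 * Fb) * 2"
      using Fb0 by (simp add: x1_def abs_mult)
    have "\<bar>W a * om (rho a)\<bar> \<le> Fb * 1"
      unfolding abs_mult using W0[of a] Wa om Fb0 by (intro mult_mono) auto
    from mult_mono[OF this g1(1)] have x2: "\<bar>x2\<bar> \<le> Fb * 2"
      using Fb0 by (simp add: x2_def abs_mult)
    have "\<bar>g (rho a) * rho a\<bar> \<le> 2 * 1"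
      unfolding abs_mult using g1 abs_rho_le[OF a(1)] by (intro mult_mono) auto
    from mult_mono[OF Wa this] have "\<bar>W a * (g (rho a) * rho a)\<bar> \<le> Fb * 2"
      using Fb0 W0[of a] by (simp add: abs_mult)
    from mult_mono[OF \<theta>(2) this] have x3: "\<bar>x3\<bar> \<le> D * (Fb * 2)"
      using Fb0 D0 \<theta> by (simp add: x3_def abs_mult)
    have "\<bar>T a\<bar> \<le> \<bar>x1\<bar> + \<bar>x2\<bar> + \<bar>x3\<bar>" unfolding Teq by (rule tri)
    also have "\<dots> \<le> (2 * Fb) * 2 + Fb * 2 + D * (Fb * 2)" using x1 x2 x3 by (intro add_mono)
    finally show ?thesis by (simp add: algebra_simps)
  qed
  have Fb0: "0 \<le> (6 + 2 * D) * Fb"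
  proof -
    have "rho s = 1" using J2 k3 s_pos by (simp add: rho_def k_eq)
    hence "W s \<le> Fb" using far[of s] \<delta> by (simp add: W_def)
    thus ?thesis using W0[of s] D0 by simp
  qed
  have "\<bar>\<Sum>a\<le>s. T a\<bar> \<le> (\<Sum>a\<le>s. \<bar>T a\<bar>)" by (rule sum_abs)
  also have "\<dots> \<le> (\<Sum>a\<le>s. (if \<bar>rho a\<bar> < \<delta> then b a else 0) + (6 + 2 * D) * Fb)"
  proof (rule sum_mono)
    fix a assume "a \<in> {..s}"
    thus "\<bar>T a\<bar> \<le> (if \<bar>rho a\<bar> < \<delta> then b a else 0) + (6 + 2 * D) * Fb"
      using nearT[of a] farT[of a] Fb0 by auto
  qed
  also have "\<dots> = (\<Sum>a\<in>{a. a \<le> s \<and> \<bar>rho a\<bar> < \<delta>}. b a) + real (Suc s) * ((6 + 2 * D) * Fb)"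
    by (simp add: sum.distrib sum.inter_filter[symmetric])
  finally show ?thesis unfolding eq[symmetric] b_def W_def \<theta>_def by simp
qed

end

end

section \<open>Moments of the correlation over pairs of solutions\<close>

context overlap
begin

lemma mom_add: "mom t (\<lambda>x. f x + g x) = mom t f + mom t g"
  by (simp add: mom_def distrib_left sum.distrib)

lemma mom_cmult: "mom t (\<lambda>x. c * f x) = c * mom t f"
  by (simp add: mom_def sum_distrib_left mult_ac)

lemma mom_mono: "(\<And>a. a \<le> s \<Longrightarrow> f (rho a) \<le> g (rho a)) \<Longrightarrow> mom t f \<le> mom t g"
  unfolding mom_def using hyp_nonneg h_rho_pos
  by (intro sum_mono mult_left_mono mult_nonneg_nonneg zero_le_power) (auto intro: less_imp_le)

lemma near_sum_le:
  assumes "\<And>a. a \<le> s \<Longrightarrow> \<bar>rho a\<bar> < \<delta> \<Longrightarrow> f a \<le> b (rho a)" "\<And>a. a \<le> s \<Longrightarrow> 0 \<le> b (rho a)"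
  shows "(\<Sum>a\<in>{a. a \<le> s \<and> \<bar>rho a\<bar> < \<delta>}. hyp a * h (rho a) ^ t * f a) \<le> mom t b"
proof -
  have W: "0 \<le> hyp a * h (rho a) ^ t" for a using hyp_nonneg[of a] h_rho_pos[of a] by simp
  have "(\<Sum>a\<in>{a. a \<le> s \<and> \<bar>rho a\<bar> < \<delta>}. hyp a * h (rho a) ^ t * f a)
      \<le> (\<Sum>a\<in>{a. a \<le> s \<and> \<bar>rho a\<bar> < \<delta>}. hyp a * h (rho a) ^ t * b (rho a))"
    using assms(1) W by (intro sum_mono mult_left_mono) auto
  also have "\<dots> \<le> mom t b"
    unfolding mom_def using assms(2) by (intro sum_mono2 mult_nonneg_nonneg[OF W]) auto
  finally show ?thesis .
qed

lemma mom_0: "mom 0 (\<lambda>_. 1) = 1"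
  by (simp add: mom_def sum_hyp)

text \<open>By \<open>h x \<le> 1 + 2 x^2\<close>, the growth of the total mass per constraint is
  governed by the second moment of the correlation.\<close>

lemma mom_Suc_le: "mom (Suc t) (\<lambda>_. 1) \<le> mom t (\<lambda>_. 1) + 2 * mom t (\<lambda>x. x * x)"
proof -
  have "mom (Suc t) (\<lambda>_. 1) = mom t h" by (simp add: mom_def mult_ac)
  also have "\<dots> \<le> mom t (\<lambda>x. 1 + 2 * (x * x))"
    using h_le by (intro mom_mono) (simp add: power2_eq_square)
  also have "\<dots> = mom t (\<lambda>_. 1) + 2 * mom t (\<lambda>x. x * x)" by (simp only: mom_add mom_cmult)
  finally show ?thesis .
qed

end

text \<open>Arithmetic-geometric mean; with \<open>q = sqrt n\<close> it interpolates the third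
  moment between the second, of order \<open>1/n\<close>, and the fourth, of order
  \<open>1/n^2\<close>.\<close>

lemma abs_cube_le: "0 < q \<Longrightarrow> \<bar>x\<bar> ^ 3 \<le> (1 / (2 * q)) * (x * x) + (q / 2) * (x ^ 3 * x)" for x q :: real
proof -
  assume q: "0 < q"
  have "0 \<le> (x * (1 - q * \<bar>x\<bar>))^2 / (2 * q)" using q by simp
  also have "(x * (1 - q * \<bar>x\<bar>))^2 = x * x - 2 * q * \<bar>x\<bar>^3 + q * q * (x ^ 3 * x)"
    by (cases "0 \<le> x") (simp_all add: power2_eq_square power3_eq_cube algebra_simps)
  also have "(x * x - 2 * q * \<bar>x\<bar>^3 + q * q * (x ^ 3 * x)) / (2 * q)
      = (1 / (2 * q)) * (x * x) - \<bar>x\<bar>^3 + (q / 2) * (x ^ 3 * x)"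
    using q by (simp add: add_divide_distrib diff_divide_distrib)
  finally show ?thesis by simp
qed

text \<open>A bootstrap on \<open>stein_step\<close>: \<open>g x = x\<close> bounds the second
  moment by \<open>O(1/n)\<close> times the mass plus one, and \<open>mom_Suc_le\<close> then keeps
  the mass bounded for \<open>r n\<close> steps. After that \<open>g x = x^3\<close> gives the
  fourth moment, \<open>g = 1\<close> the signed first moment, and interpolation the third.\<close>

lemma overlap_moments:
  fixes k :: nat and r :: real
  assumes k: "3 \<le> k" and r: "0 < r" "r < ln (real k) / real k"
  obtains A N where "0 \<le> A"
    "\<And>s t. N \<le> s \<Longrightarrow> 0 < s \<Longrightarrow> real t \<le> r * real (k * s) \<Longrightarrow>
       overlap.mom k s t (\<lambda>_. 1) \<le> A \<and> \<bar>overlap.mom k s t (\<lambda>x. x)\<bar> \<le> A / real (k * s)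
       \<and> overlap.mom k s t (\<lambda>x. \<bar>x\<bar> ^ 3) \<le> A / (real (k * s) * sqrt (real (k * s)))"
proof -
  define K where "K = real k"
  define J where "J = K - 1"
  define D where "D = r * K^2 / J"
  \<comment> \<open>The contraction factor is at least \<open>2 \<eta>\<close>; in the second and
    fourth moments one \<open>\<eta>\<close> absorbs the expansion error with
    \<open>C \<bar>x\<bar> \<le> \<eta>\<close>, which fixes \<open>\<delta>\<close>. It is positive
    because \<open>r K < ln K \<le> J\<close>.\<close>
  define \<eta> where "\<eta> = (1 - r * K / J) / 2"
  define c where "c = K^2 / J"
  have K: "3 \<le> K" using k by (simp add: K_def)
  have J: "2 \<le> J" and KJ: "K = J + 1" using K by (auto simp: J_def)
  have rK: "r * K < ln K" using r K by (simp add: K_def field_simps)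
  have "ln K \<le> J" using ln_le_minus_one[of K] K by (simp add: J_def)
  hence \<eta>: "0 < \<eta>" using rK J by (simp add: \<eta>_def field_simps)
  have D0: "0 \<le> D" using r J by (simp add: D_def)
  have DX: "D < ln K * K / J"
  proof -
    have "r * K * K < ln K * K" using rK K by (intro mult_strict_right_mono) auto
    thus ?thesis using J by (simp add: D_def power2_eq_square divide_strict_right_mono mult_ac)
  qed
  have c0: "0 \<le> c" using J by (simp add: c_def)
  obtain C where C0: "0 \<le> C" and C: "\<And>x d t. -1/J \<le> x \<Longrightarrow> \<bar>x\<bar> \<le> 1/4 \<Longrightarrow> 0 < d \<Longrightarrow> d \<le> 1/4 \<Longrightarrow> 0 \<le> t \<Longrightarrow> t * d \<le> D \<Longrightarrow>
      \<bar>J / K^2 * (1 - x)^2 * (exp (t * (lnh J (x + d) - lnh J x)) - 1) - t * d / K * x\<bar> \<le> C * (x^2 + d)"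
    using near_expansion[OF J D0] unfolding KJ[symmetric] by blast
  define \<delta> where "\<delta> = min (1/4) (\<eta> / (C + 1))"
  have \<delta>: "0 < \<delta>" "\<delta> \<le> 1/4"
    using \<eta> C0 min.cobounded1[of "1/4" "\<eta> / (C + 1)"] unfolding \<delta>_def by simp_all
  have C\<delta>: "C * \<delta> \<le> \<eta>"
  proof -
    have "C * \<delta> \<le> C * (\<eta> / (C + 1))" using C0 by (intro mult_left_mono) (auto simp: \<delta>_def)
    also have "\<dots> \<le> \<eta>" using C0 \<eta> by (simp add: field_simps)
    finally show ?thesis .
  qed
  obtain g where g0: "0 < g" and g: "\<And>x y. -1/J \<le> x \<Longrightarrow> x \<le> 1 \<Longrightarrow> \<delta>/2 \<le> \<bar>x\<bar> \<Longrightarrow> 0 \<le> y \<Longrightarrow> y \<le> D \<Longrightarrow> g \<le> rate J x - y * lnh J x"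
    using rate_gap[OF k D0 DX[unfolded J_def K_def], of "\<delta>/2"] \<delta> unfolding J_def K_def by (metis half_gt_zero)
  define F0 where "F0 = exp 4 * (10 * K^2 / (J * g)) ^ 10"
  have F0: "0 \<le> F0" using J g0 by (simp add: F0_def)
  define E where "E = (6 + 2 * D) * F0"
  have E0: "0 \<le> E" using D0 F0 by (simp add: E_def)
  define C' where "C' = 1 + D + 2 * C"
  have C'0: "0 \<le> C'" using D0 C0 by (simp add: C'_def)
  define N where "N = nat \<lceil>2 * K / (J * \<delta>)\<rceil>"
  define A1 where "A1 = ((C + C') * c + E) / \<eta>"
  define A0 where "A0 = 2 * exp (2 * A1 * r)"
  define A4 where "A4 = ((C + 5 * C') * c * (A1 * A0) + 5 * C' * c^3 * A0 + E) / \<eta>"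
  define A3 where "A3 = (C * (A1 * A0) + C * c * A0 + E) / (2 * \<eta>)"
  have A1: "0 \<le> A1" using C0 C'0 c0 E0 \<eta> by (simp add: A1_def)
  have A0: "0 \<le> A0" by (simp add: A0_def)
  have A3: "0 \<le> A3" using C0 C'0 c0 E0 \<eta> A1 A0 by (simp add: A3_def)
  have A4: "0 \<le> A4" using C0 C'0 c0 E0 \<eta> A1 A0 by (simp add: A4_def)
  show thesis
  proof (rule that[of "A0 + A3 + A1 * A0 + A4" N])
    show "0 \<le> A0 + A3 + A1 * A0 + A4" using A0 A1 A3 A4 by simp
    fix s t0 assume sN: "N \<le> s" and s0: "0 < s" and t0: "real t0 \<le> r * real (k * s)"
    interpret o: overlap k s using k s0 by unfold_locales
    have oJ: "o.J = J" by (simp add: o.J_def J_def K_def)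
    define n where "n = real o.n"
    have n_eq: "n = real (k * s)" by (simp add: n_def o.n_def)
    have n0: "0 < n" using o.n_pos by (simp add: n_def)
    have n1: "1 \<le> n"
    proof -
      have "1 \<le> k * s" using k s0 by (simp add: Suc_le_eq)
      thus ?thesis unfolding n_eq by (metis of_nat_1 of_nat_mono)
    qed
    define d where "d = o.d"
    have d_eq: "d = c / n" by (simp add: d_def o.d_def c_def oJ n_def K_def)
    have d0: "0 < d" using o.d_pos by (simp add: d_def)
    have d\<delta>: "d \<le> \<delta> / 2"
    proof -
      have "2 * K / (J * \<delta>) \<le> real N" unfolding N_def by linarith
      also have "\<dots> \<le> real s" using sN by simp
      finally have "2 * K \<le> real s * (J * \<delta>)" using J \<delta> by (simp add: pos_divide_le_eq)
      hence "K * (2 * K) \<le> K * (real s * (J * \<delta>))" using K by (intro mult_left_mono) auto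
      hence "2 * K^2 \<le> \<delta> * (J * n)" by (simp add: n_eq K_def power2_eq_square mult_ac)
      hence "K^2 / (J * n) \<le> \<delta> / 2" using J n0 by (simp add: field_simps)
      thus ?thesis by (simp add: d_eq c_def)
    qed
    have ninv: "1 / n ^ 4 \<le> 1 / n" "1 / n ^ 4 \<le> 1 / n^2" "1 / n^3 \<le> 1 / n^2"
      using n1 by (auto intro!: divide_left_mono power_increasing self_le_power)
    define M0 where "M0 t = o.mom t (\<lambda>_. 1)" for t
    define M1 where "M1 t = o.mom t (\<lambda>x. 1 * x)" for t
    define M2 where "M2 t = o.mom t (\<lambda>x. x * x)" for t
    define M4 where "M4 t = o.mom t (\<lambda>x. x^3 * x)" for t
    have x4: "0 \<le> x ^ 3 * x" for x :: real
    proof -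
      have "x ^ 3 * x = (x * x) * (x * x)" by (simp add: power3_eq_cube)
      thus ?thesis by (simp only: zero_le_square)
    qed
    have M00: "0 \<le> M0 t" for t unfolding M0_def by (intro o.mom_nonneg) auto
    have M20: "0 \<le> M2 t" for t unfolding M2_def by (intro o.mom_nonneg) auto
    have M40: "0 \<le> M4 t" for t unfolding M4_def by (intro o.mom_nonneg x4)
    have step: "2 * \<eta> * \<bar>o.mom t (\<lambda>x. f x * x)\<bar> \<le> o.mom t b + E / n^4"
      if t: "real t \<le> r * n" and f: "\<And>x. \<bar>x\<bar> \<le> 5/4 \<Longrightarrow> \<bar>f x\<bar> \<le> 2"
        and b: "\<And>x. \<bar>x\<bar> < \<delta> \<Longrightarrow> C * (x^2 + d) * \<bar>f x\<bar> + C' * \<bar>f (x + d) - f x\<bar> \<le> b x"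
        and b0: "\<And>x. 0 \<le> b x" for t f b
    proof -
      have tD: "real t * d \<le> D"
      proof -
        have "real t * d \<le> r * n * d" using t d0 by (intro mult_right_mono) auto
        also have "\<dots> = D" using n0 by (simp add: d_eq c_def D_def)
        finally show ?thesis .
      qed
      have \<theta>: "2 * \<eta> \<le> 1 - real t * d / K"
      proof -
        have "real t * d / K \<le> D / K" using tD K by (intro divide_right_mono) auto
        also have "\<dots> = r * K / J" using K by (simp add: D_def power2_eq_square)
        also have "\<dots> = 1 - 2 * \<eta>" unfolding \<eta>_def using J by (simp add: field_simps)
        finally show ?thesis by linarith
      qed
      have tD': "real t * o.d \<le> D" using tD by (simp add: d_def)
      have far: "o.hyp a * o.h (o.rho a) ^ t \<le> F0 / n ^ 6" if "a \<le> s" "\<delta> / 2 \<le> \<bar>o.rho a\<bar>" for a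
        using o.far_bound[where X=D and g=g and \<delta>="\<delta>/2", OF _ g0 tD' that] g
        by (simp add: F0_def oJ K_def n_def)
      have nr: "\<bar>o.om x * (exp (real t * (lnh o.J (x + o.d) - lnh o.J x)) - 1) - real t * o.d / real k * x\<bar> \<le> C * (x\<^sup>2 + o.d)"
        if "-1 / o.J \<le> x" "\<bar>x\<bar> \<le> 1/4" for x
        using C[of x d "real t"] that d0 d\<delta> \<delta> tD by (simp add: o.om_def oJ K_def d_def)
      have "\<bar>(1 - real t * o.d / real k) * o.mom t (\<lambda>x. f x * x)\<bar>
        \<le> (\<Sum>a\<in>{a. a \<le> s \<and> \<bar>o.rho a\<bar> < \<delta>}. o.hyp a * o.h (o.rho a) ^ t * (C * (o.rho a ^ 2 + o.d) * \<bar>f (o.rho a)\<bar>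
          + (1 + D + 2 * C) * \<bar>f (o.rho a + o.d) - f (o.rho a)\<bar>)) + real (Suc s) * ((6 + 2 * D) * (F0 / n^6))"
        by (rule o.stein_step[OF nr \<delta> d\<delta>[unfolded d_def] tD' C0 far f])
      also have "\<dots> \<le> o.mom t b + E / n^4"
      proof (rule add_mono)
        show "(\<Sum>a\<in>{a. a \<le> s \<and> \<bar>o.rho a\<bar> < \<delta>}. o.hyp a * o.h (o.rho a) ^ t * (C * (o.rho a ^ 2 + o.d) * \<bar>f (o.rho a)\<bar>
          + (1 + D + 2 * C) * \<bar>f (o.rho a + o.d) - f (o.rho a)\<bar>)) \<le> o.mom t b"
          using b b0 by (intro o.near_sum_le) (auto simp: d_def C'_def)
        have "Suc s \<le> k * s"
        proof -
          have "3 * s \<le> k * s" using k by (intro mult_right_mono) auto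
          thus ?thesis using s0 by linarith
        qed
        hence "real (Suc s) \<le> n" unfolding n_eq by (rule of_nat_mono)
        also have "n \<le> n^2" using n1 by (simp add: self_le_power)
        finally have "real (Suc s) * (E / n^6) \<le> n^2 * (E / n^6)" using E0 n0 by (intro mult_right_mono) auto
        also have "\<dots> = E / n^4" using n0 by (simp add: power_eq_if)
        finally show "real (Suc s) * ((6 + 2 * D) * (F0 / n^6)) \<le> E / n^4" by (simp add: E_def)
      qed
      finally have "\<bar>1 - real t * d / K\<bar> * \<bar>o.mom t (\<lambda>x. f x * x)\<bar> \<le> o.mom t b + E / n^4"
        by (simp add: abs_mult d_def K_def)
      moreover have "2 * \<eta> * \<bar>o.mom t (\<lambda>x. f x * x)\<bar> \<le> \<bar>1 - real t * d / K\<bar> * \<bar>o.mom t (\<lambda>x. f x * x)\<bar>"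
        using \<theta> by (intro mult_right_mono) auto
      ultimately show ?thesis by linarith
    qed
    have d1: "d \<le> 1/4" using d\<delta> \<delta> by simp
    have M2: "M2 t \<le> A1 * (M0 t + 1) / n" if t: "real t \<le> r * n" for t
    proof -
      have "2 * \<eta> * \<bar>M2 t\<bar> \<le> o.mom t (\<lambda>x. \<eta> * (x * x) + (C + C') * d * 1) + E / n^4"
        unfolding M2_def
      proof (rule step[OF t])
        fix x :: real assume x: "\<bar>x\<bar> < \<delta>"
        have "C * \<bar>x\<bar> \<le> \<eta>" using x C\<delta> C0 mult_left_mono[of "\<bar>x\<bar>" \<delta> C] by linarith
        hence "(C * \<bar>x\<bar>) * (x * x) \<le> \<eta> * (x * x)" by (intro mult_right_mono) auto
        moreover have "C * d * \<bar>x\<bar> \<le> C * d * 1" using x \<delta> C0 d0 by (intro mult_left_mono) auto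
        ultimately show "C * (x^2 + d) * \<bar>x\<bar> + C' * \<bar>x + d - x\<bar> \<le> \<eta> * (x * x) + (C + C') * d * 1"
          using d0 by (simp add: power2_eq_square algebra_simps)
      next
        fix x show "0 \<le> \<eta> * (x * x) + (C + C') * d * 1" using \<eta> C0 C'0 d0 by simp
      qed auto
      also have "o.mom t (\<lambda>x. \<eta> * (x * x) + (C + C') * d * 1) = \<eta> * M2 t + (C + C') * d * M0 t"
        by (simp only: o.mom_add o.mom_cmult M2_def M0_def)
      finally have "\<eta> * M2 t \<le> (C + C') * c * M0 t * (1 / n) + E * (1 / n^4)" using M20[of t] by (simp add: d_eq)
      also have "\<dots> \<le> (C + C') * c * (M0 t + 1) * (1 / n) + (E * (M0 t + 1)) * (1 / n)"
        using ninv(1) E0 C0 C'0 c0 M00[of t] n0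
        by (intro add_mono mult_mono mult_nonneg_nonneg) (auto simp: mult_le_cancel_left1)
      also have "\<dots> = (\<eta> * A1) * (M0 t + 1) / n"
      proof -
        have "\<eta> * A1 = (C + C') * c + E" using \<eta> by (simp add: A1_def)
        thus ?thesis by (simp add: distrib_right add_divide_distrib)
      qed
      also have "\<dots> = \<eta> * (A1 * (M0 t + 1) / n)" by simp
      finally show ?thesis by (rule mult_left_le_imp_le) (use \<eta> in simp)
    qed
    \<comment> \<open>Discrete Gronwall. The \<open>+ 1\<close> carries the additive error left by
      the far range.\<close>
    have M0: "M0 t + 1 \<le> A0" if t: "real t \<le> r * n" for t
    proof -
      have "M0 t + 1 \<le> 2 * (1 + 2 * A1 / n) ^ t"
        using t
      proof (induction t)
        case 0
        show ?case by (simp add: M0_def o.mom_0)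
      next
        case (Suc t)
        hence t: "real t \<le> r * n" by simp
        have "M0 (Suc t) + 1 \<le> M0 t + 2 * M2 t + 1" unfolding M0_def M2_def using o.mom_Suc_le by simp
        also have "\<dots> \<le> M0 t + 1 + 2 * (A1 * (M0 t + 1) / n)" using M2[OF t] by simp
        also have "\<dots> = (1 + 2 * A1 / n) * (M0 t + 1)" by (simp add: algebra_simps add_divide_distrib)
        also have "\<dots> \<le> (1 + 2 * A1 / n) * (2 * (1 + 2 * A1 / n) ^ t)"
          using Suc.IH[OF t] A1 n0 by (intro mult_left_mono) auto
        finally show ?case by simp
      qed
      also have "(1 + 2 * A1 / n) ^ t \<le> exp (2 * A1 / n) ^ t"
        using A1 n0 exp_ge_add_one_self[of "2 * A1 / n"] by (intro power_mono) auto
      also have "\<dots> = exp (real t * (2 * A1 / n))" by (rule exp_of_nat_mult[symmetric])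
      also have "\<dots> \<le> exp (2 * A1 * r)"
      proof -
        have "real t * (2 * A1 / n) \<le> r * n * (2 * A1 / n)" using t A1 n0 by (intro mult_right_mono) auto
        thus ?thesis using n0 by (simp add: mult_ac)
      qed
      finally show ?thesis by (simp add: A0_def)
    qed
    define t where "t = t0"
    have t: "real t \<le> r * n" using t0 by (simp add: t_def n_eq)
    have M2': "M2 t \<le> A1 * A0 / n"
      using order_trans[OF M2[OF t] divide_right_mono[OF mult_left_mono[OF M0[OF t] A1], of n]] n0 by simp
    have M0': "M0 t \<le> A0" using M0[OF t] by simp
    have M4': "M4 t \<le> A4 / n^2"
    proof -
      have "2 * \<eta> * \<bar>M4 t\<bar> \<le> o.mom t (\<lambda>x. \<eta> * (x^3 * x) + ((C + 5 * C') * d * (x * x) + 5 * C' * d^3 * 1)) + E / n^4"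
        unfolding M4_def
      proof (rule step[OF t])
        fix x :: real assume x: "\<bar>x\<bar> \<le> 5/4"
        have "\<bar>x\<bar>^3 \<le> (5/4)^3" using x by (intro power_mono) auto
        also have "\<dots> \<le> 2" by (simp add: power3_eq_cube)
        finally show "\<bar>x^3\<bar> \<le> 2" by (simp only: power_abs)
      next
        fix x :: real assume x: "\<bar>x\<bar> < \<delta>"
        have "C * \<bar>x\<bar> \<le> \<eta>" using x C\<delta> C0 mult_left_mono[of "\<bar>x\<bar>" \<delta> C] by linarith
        hence 1: "(C * \<bar>x\<bar>) * ((x * x) * (x * x)) \<le> \<eta> * ((x * x) * (x * x))" by (intro mult_right_mono) auto
        have x3: "\<bar>x^3\<bar> = \<bar>x\<bar> * (x * x)" by (simp add: power3_eq_cube abs_mult)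
        have "\<bar>x\<bar> * (x * x) \<le> 1 * (x * x)" using x \<delta> by (intro mult_right_mono) auto
        hence 2: "C * d * (\<bar>x\<bar> * (x * x)) \<le> C * d * (x * x)" using C0 d0 by (intro mult_left_mono) auto
        have "\<bar>(x + d)^3 - x^3\<bar> \<le> 5 * (d * (x * x) + d^3)"
        proof -
          have "(x + d)^3 - x^3 = 3 * (d * (x * x)) + 3 * (d * (x * d)) + d^3"
            by (simp add: power3_eq_cube algebra_simps)
          moreover have "\<bar>x * d\<bar> \<le> (x * x + d * d) / 2"
            using zero_le_power2[of "\<bar>x\<bar> - \<bar>d\<bar>"] by (simp add: power2_eq_square algebra_simps abs_mult)
          hence "d * \<bar>x * d\<bar> \<le> d * ((x * x + d * d) / 2)" using d0 by (intro mult_left_mono) auto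
          hence "\<bar>d * (x * d)\<bar> \<le> (d * (x * x) + d^3) / 2"
            using d0 by (simp add: abs_mult power3_eq_cube algebra_simps)
          moreover have "0 \<le> d * (x * x)" "0 \<le> d^3" using d0 by auto
          moreover have "\<bar>X\<bar> \<le> 5 * (a + e)" if "X = 3 * a + 3 * b + e" "\<bar>b\<bar> \<le> (a + e) / 2" "0 \<le> a" "0 \<le> e"
            for X a b e :: real using that unfolding abs_le_iff by (simp add: field_simps)
          ultimately show ?thesis by blast
        qed
        hence 3: "C' * \<bar>(x + d)^3 - x^3\<bar> \<le> C' * (5 * (d * (x * x) + d^3))" using C'0 by (intro mult_left_mono)
        have "C * (x^2 + d) * \<bar>x^3\<bar> = (C * \<bar>x\<bar>) * ((x * x) * (x * x)) + C * d * (\<bar>x\<bar> * (x * x))"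
          unfolding x3 by (simp add: power2_eq_square algebra_simps)
        moreover have "\<eta> * (x^3 * x) = \<eta> * ((x * x) * (x * x))" by (simp add: power3_eq_cube)
        moreover have "(C + 5 * C') * d * (x * x) + 5 * C' * d^3 * 1 = C * d * (x * x) + C' * (5 * (d * (x * x) + d^3))"
          by (simp add: algebra_simps)
        ultimately show "C * (x^2 + d) * \<bar>x^3\<bar> + C' * \<bar>(x + d)^3 - x^3\<bar>
            \<le> \<eta> * (x^3 * x) + ((C + 5 * C') * d * (x * x) + 5 * C' * d^3 * 1)"
          using 1 2 3 by linarith
      next
        fix x :: real
        show "0 \<le> \<eta> * (x^3 * x) + ((C + 5 * C') * d * (x * x) + 5 * C' * d^3 * 1)"
        proof -
          have "0 \<le> \<eta> * (x^3 * x)" by (rule mult_nonneg_nonneg[OF less_imp_le[OF \<eta>] x4])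
          moreover have "0 \<le> (C + 5 * C') * d * (x * x)"
            by (rule mult_nonneg_nonneg) (use C0 C'0 d0 in auto)
          moreover have "0 \<le> 5 * C' * d^3 * 1" using C'0 d0 by simp
          ultimately show ?thesis by linarith
        qed
      qed
      also have "o.mom t (\<lambda>x. \<eta> * (x^3 * x) + ((C + 5 * C') * d * (x * x) + 5 * C' * d^3 * 1))
          = \<eta> * M4 t + ((C + 5 * C') * d * M2 t + 5 * C' * d^3 * M0 t)"
        by (simp only: o.mom_add o.mom_cmult M2_def M0_def M4_def)
      finally have "\<eta> * M4 t \<le> (C + 5 * C') * d * M2 t + 5 * C' * d^3 * M0 t + E * (1 / n^4)"
        using M40[of t] by simp
      also have "\<dots> \<le> (C + 5 * C') * d * (A1 * A0 / n) + 5 * C' * d^3 * A0 + E * (1 / n^2)"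
        using M2' M0' ninv(2) C0 C'0 d0 E0 by (intro add_mono mult_left_mono) auto
      also have "\<dots> \<le> (C + 5 * C') * d * (A1 * A0 / n) + 5 * C' * c^3 * A0 * (1 / n^2) + E * (1 / n^2)"
      proof -
        have "5 * C' * d^3 * A0 = 5 * C' * c^3 * A0 * (1 / n^3)" by (simp add: d_eq power_divide)
        also have "\<dots> \<le> 5 * C' * c^3 * A0 * (1 / n^2)"
          using ninv(3) C'0 c0 A0 by (intro mult_left_mono) auto
        finally show ?thesis by simp
      qed
      also have "(C + 5 * C') * d * (A1 * A0 / n) + 5 * C' * c^3 * A0 * (1 / n^2) + E * (1 / n^2) = \<eta> * (A4 / n^2)"
      proof -
        have "\<eta> * A4 = (C + 5 * C') * c * (A1 * A0) + 5 * C' * c^3 * A0 + E" using \<eta> by (simp add: A4_def)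
        moreover have "(C + 5 * C') * d * (A1 * A0 / n) = (C + 5 * C') * c * (A1 * A0) * (1 / n^2)"
          by (simp add: d_eq power2_eq_square)
        ultimately show ?thesis by (simp add: add_divide_distrib distrib_right)
      qed
      finally show ?thesis by (rule mult_left_le_imp_le) (use \<eta> in simp)
    qed
    have M1': "\<bar>M1 t\<bar> \<le> A3 / n"
    proof -
      have "2 * \<eta> * \<bar>M1 t\<bar> \<le> o.mom t (\<lambda>x. C * (x * x) + C * d * 1) + E / n^4"
        unfolding M1_def
      proof (rule step[OF t])
        fix x :: real
        show "C * (x^2 + d) * \<bar>1\<bar> + C' * \<bar>1 - 1\<bar> \<le> C * (x * x) + C * d * 1"
          by (simp add: power2_eq_square algebra_simps)
        show "0 \<le> C * (x * x) + C * d * 1" using C0 d0 by simp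
      qed auto
      also have "o.mom t (\<lambda>x. C * (x * x) + C * d * 1) = C * M2 t + C * d * M0 t"
        by (simp only: o.mom_add o.mom_cmult M2_def M0_def)
      also have "C * M2 t + C * d * M0 t + E / n^4 \<le> C * (A1 * A0 / n) + C * d * A0 + E * (1 / n)"
        using M2' M0' ninv(1) C0 d0 mult_left_mono[OF ninv(1) E0] by (intro add_mono mult_left_mono) auto
      also have "\<dots> = 2 * \<eta> * (A3 / n)"
      proof -
        have "2 * \<eta> * A3 = C * (A1 * A0) + C * c * A0 + E" using \<eta> by (simp add: A3_def)
        hence "2 * \<eta> * (A3 / n) = (C * (A1 * A0) + C * c * A0 + E) / n" by (metis times_divide_eq_right)
        thus ?thesis by (simp add: d_eq add_divide_distrib)
      qed
      finally show ?thesis by (rule mult_left_le_imp_le) (use \<eta> in simp)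
    qed
    have M3': "o.mom t (\<lambda>x. \<bar>x\<bar>^3) \<le> (A1 * A0 + A4) / (n * sqrt n)"
    proof -
      define q where "q = sqrt n"
      have q: "0 < q" "q * q = n" using n0 by (auto simp: q_def)
      have "o.mom t (\<lambda>x. \<bar>x\<bar>^3) \<le> o.mom t (\<lambda>x. (1 / (2 * q)) * (x * x) + (q / 2) * (x ^ 3 * x))"
        using abs_cube_le[OF q(1)] by (intro o.mom_mono)
      also have "\<dots> = (1 / (2 * q)) * M2 t + (q / 2) * M4 t"
        by (simp only: o.mom_add o.mom_cmult M2_def M4_def)
      also have "\<dots> \<le> (1 / (2 * q)) * (A1 * A0 / n) + (q / 2) * (A4 / n^2)"
        using M2' M4' q by (intro add_mono mult_left_mono) auto
      also have "(q / 2) * (A4 / n^2) = A4 / (2 * (n * q))"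
        using q n0 by (simp add: q(2)[symmetric] power2_eq_square)
      also have "(1 / (2 * q)) * (A1 * A0 / n) + A4 / (2 * (n * q)) = (A1 * A0 + A4) / (n * q) / 2"
        by (simp add: add_divide_distrib mult_ac)
      also have "\<dots> \<le> (A1 * A0 + A4) / (n * q)"
      proof -
        have "X / 2 \<le> X" if "0 \<le> X" for X :: real using that by simp
        moreover have "0 \<le> (A1 * A0 + A4) / (n * q)" using A1 A0 A4 n0 q by simp
        ultimately show ?thesis by blast
      qed
      finally show ?thesis by (simp add: q_def)
    qed
    define A where "A = A0 + A3 + A1 * A0 + A4"
    have A10: "0 \<le> A1 * A0" using A1 A0 by simp
    have "M0 t \<le> A" using M0' A3 A10 A4 by (simp add: A_def)
    moreover have "\<bar>M1 t\<bar> \<le> A / n"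
      by (rule order_trans[OF M1']) (use A0 A10 A4 n0 in \<open>auto simp: A_def intro!: divide_right_mono\<close>)
    moreover have "o.mom t (\<lambda>x. \<bar>x\<bar>^3) \<le> A / (n * sqrt n)"
      by (rule order_trans[OF M3']) (use A0 A3 n0 in \<open>auto simp: A_def intro!: divide_right_mono\<close>)
    ultimately show "o.mom t0 (\<lambda>_. 1) \<le> A0 + A3 + A1 * A0 + A4 \<and> \<bar>o.mom t0 (\<lambda>x. x)\<bar> \<le> (A0 + A3 + A1 * A0 + A4) / real (k * s)
       \<and> o.mom t0 (\<lambda>x. \<bar>x\<bar> ^ 3) \<le> (A0 + A3 + A1 * A0 + A4) / (real (k * s) * sqrt (real (k * s)))"
      by (simp add: M0_def M1_def t_def A_def n_eq)
  qed
qed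

section \<open>Constraints as product measure\<close>

lemma finite_constraints [simp]: "finite (constraints k n)"
  unfolding constraints_def using finite_lists_length_eq[of "{..<n}" k] by (simp add: conj_commute)

lemma card_constraints: "card (constraints k n) = n ^ k"
  unfolding constraints_def using card_lists_length_eq[of "{..<n}" k] by (simp add: conj_commute)

lemma constraints_0: "constraints 0 n = {[]}"
  by (auto simp: constraints_def)

lemma sum_constraints_Suc:
  "(\<Sum>c\<in>constraints (Suc k) n. f c) = (\<Sum>x<n. \<Sum>c\<in>constraints k n. f (x # c))"
proof -
  have "constraints (Suc k) n = (\<lambda>(x, c). x # c) ` ({..<n} \<times> constraints k n)"
    by (force simp: constraints_def length_Suc_conv image_iff)
  moreover have "inj_on (\<lambda>(x, c). x # c) ({..<n} \<times> constraints k n)"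
    by (auto simp: inj_on_def)
  ultimately have "(\<Sum>c\<in>constraints (Suc k) n. f c) = (\<Sum>(x, c)\<in>{..<n} \<times> constraints k n. f (x # c))"
    by (simp add: sum.reindex case_prod_unfold)
  thus ?thesis by (simp add: sum.cartesian_product)
qed

lemma sum_prod_constraints:
  fixes g :: "nat \<Rightarrow> nat \<Rightarrow> real"
  shows "(\<Sum>c\<in>constraints k n. \<Prod>j<k. g j (c ! j)) = (\<Prod>j<k. \<Sum>x<n. g j x)"
proof (induction k arbitrary: g)
  case (Suc k)
  have "(\<Sum>c\<in>constraints (Suc k) n. \<Prod>j<Suc k. g j (c ! j))
      = (\<Sum>x<n. \<Sum>c\<in>constraints k n. g 0 x * (\<Prod>j<k. g (Suc j) (c ! j)))"
    unfolding sum_constraints_Suc by (subst prod.lessThan_Suc_shift) simp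
  also have "\<dots> = (\<Sum>x<n. g 0 x) * (\<Prod>j<k. \<Sum>x<n. g (Suc j) x)"
    by (simp only: sum_distrib_left[symmetric] sum_distrib_right Suc[of "\<lambda>j. g (Suc j)"])
  also have "\<dots> = (\<Prod>j<Suc k. \<Sum>x<n. g j x)"
    by (subst prod.lessThan_Suc_shift) simp
  finally show ?case .
qed (simp add: constraints_0)

lemma sum_prod_subset_constraints:
  fixes g :: "nat \<Rightarrow> nat \<Rightarrow> real"
  assumes "U \<subseteq> {..<k}"
  shows "(\<Sum>c\<in>constraints k n. \<Prod>j\<in>U. g j (c ! j)) = real n ^ (k - card U) * (\<Prod>j\<in>U. \<Sum>x<n. g j x)"
proof -
  have fin: "finite U" using assms finite_subset by blast
  have sub: "(\<Prod>j<k. if j \<in> U then f j else e j) = (\<Prod>j\<in>U. f j) * (\<Prod>j\<in>{..<k} - U. e j)" for f e :: "nat \<Rightarrow> real"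
  proof -
    have "{..<k} \<inter> {j. j \<in> U} = U" "{..<k} \<inter> - {j. j \<in> U} = {..<k} - U" using assms by auto
    thus ?thesis by (simp add: prod.If_cases)
  qed
  have "(\<Sum>c\<in>constraints k n. \<Prod>j\<in>U. g j (c ! j)) = (\<Sum>c\<in>constraints k n. \<Prod>j<k. (if j \<in> U then g j (c ! j) else 1))"
    by (simp add: sub)
  also have "\<dots> = (\<Prod>j<k. \<Sum>x<n. if j \<in> U then g j x else 1)"
    by (rule sum_prod_constraints[of "\<lambda>j x. if j \<in> U then g j x else 1"])
  also have "\<dots> = (\<Prod>j<k. if j \<in> U then (\<Sum>x<n. g j x) else real n)"
    by (intro prod.cong) auto
  also have "\<dots> = (\<Prod>j\<in>U. \<Sum>x<n. g j x) * real n ^ (k - card U)"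
    using assms fin by (simp add: sub card_Diff_subset)
  finally show ?thesis by simp
qed

text \<open>Exchanging the entry at \<open>j\<close> with a fresh \<open>x\<close> is an involution
  on pairs \<open>(c, x)\<close>: resampling one coordinate preserves the uniform
  distribution.\<close>

lemma sum_constraints_update:
  fixes f :: "nat list \<Rightarrow> real"
  assumes "j < k"
  shows "(\<Sum>c\<in>constraints k n. \<Sum>x<n. f (c[j := x])) = real n * (\<Sum>c\<in>constraints k n. f c)"
proof -
  define \<phi> where "\<phi> = (\<lambda>(c :: nat list, x :: nat). (c[j := x], c ! j))"
  have inv: "\<phi> z \<in> constraints k n \<times> {..<n} \<and> \<phi> (\<phi> z) = z" if zz: "z \<in> constraints k n \<times> {..<n}" for z
  proof -
    obtain c x where z: "z = (c, x)" "c \<in> constraints k n" "x < n" using zz by (cases z) auto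
    have len: "length c = k" "set c \<subseteq> {..<n}" using z by (auto simp: constraints_def)
    have "c ! j \<in> set c" using len assms by simp
    hence "c ! j < n" using len(2) by blast
    moreover have "set (c[j := x]) \<subseteq> {..<n}" using set_update_subset_insert[of c j x] len z(3) by auto
    ultimately show ?thesis using len assms z by (auto simp: \<phi>_def constraints_def)
  qed
  have "(\<Sum>c\<in>constraints k n. \<Sum>x<n. f (c[j := x])) = (\<Sum>z\<in>constraints k n \<times> {..<n}. f (fst (\<phi> z)))"
    by (simp add: sum.cartesian_product \<phi>_def case_prod_unfold)
  also have "\<dots> = (\<Sum>z\<in>constraints k n \<times> {..<n}. f (fst z))"
    by (rule sum.reindex_bij_witness[of _ \<phi> \<phi>]) (use inv in auto)
  also have "\<dots> = real n * (\<Sum>c\<in>constraints k n. f c)"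
    by (simp add: sum.cartesian_product[symmetric, of "\<lambda>c x. f c", simplified case_prod_unfold] sum_distrib_left[symmetric])
  finally show ?thesis .
qed

text \<open>Only the summand of the unique true position can be nonzero. A sum of products is the
  form that factorises under averaging over constraints and expands in characters.\<close>

lemma of_bool_exactly_one:
  fixes b :: "nat \<Rightarrow> bool"
  shows "(of_bool (card {j. j < k \<and> b j} = 1) :: real)
    = (\<Sum>j<k. \<Prod>l<k. if l = j then of_bool (b l) else 1 - of_bool (b l))"
proof -
  define X where "X = {j. j < k \<and> b j}"
  have "(\<Prod>l<k. if l = j then of_bool (b l) else 1 - of_bool (b l)) = (of_bool (X = {j}) :: real)" if jk: "j < k" for j
  proof (cases "X = {j}")
    case True
    hence "b l \<longleftrightarrow> l = j" if "l < k" for l using that unfolding X_def by blast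
    thus ?thesis using True by (simp add: prod.neutral)
  next
    case False
    then obtain l where "l < k" "(if l = j then of_bool (b l) else 1 - of_bool (b l)) = (0 :: real)"
    proof (cases "b j")
      case True
      hence "j \<in> X" using jk by (simp add: X_def)
      then obtain l where "l \<in> X" "l \<noteq> j" using False by blast
      thus ?thesis by (intro that[of l]) (auto simp: X_def)
    next
      case False
      thus ?thesis using \<open>j < k\<close> by (intro that[of j]) auto
    qed
    hence "(\<Prod>l<k. if l = j then of_bool (b l) else 1 - of_bool (b l)) = (0 :: real)"
      by (intro prod_zero[OF finite_lessThan] bexI[of _ l]) simp_all
    thus ?thesis using False by simp
  qed
  hence "(\<Sum>j<k. \<Prod>l<k. if l = j then of_bool (b l) else 1 - of_bool (b l)) = (\<Sum>j<k. of_bool (X = {j}) :: real)"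
    by (intro sum.cong) auto
  also have "\<dots> = of_bool (card X = 1)"
  proof (cases "card X = 1")
    case True
    then obtain i where i: "X = {i}" by (auto simp: card_1_singleton_iff)
    hence "i < k" by (auto simp: X_def)
    have "(\<Sum>j<k. of_bool (X = {j}) :: real) = (\<Sum>j<k. if j = i then 1 else 0)"
      using i by (intro sum.cong) auto
    thus ?thesis using True \<open>i < k\<close> by simp
  next
    case False
    hence "X \<noteq> {j}" for j by auto
    thus ?thesis using False by simp
  qed
  finally show ?thesis by (simp add: X_def)
qed

definition sat_set :: "nat set \<Rightarrow> nat list \<Rightarrow> bool" where
  "sat_set A c = sat_constraint (\<lambda>i. i \<in> A) c"

lemma of_bool_sat_set:
  assumes "c \<in> constraints k n"
  shows "(of_bool (sat_set A c) :: real)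
    = (\<Sum>j<k. \<Prod>l<k. if l = j then of_bool (c ! l \<in> A) else 1 - of_bool (c ! l \<in> A))"
proof -
  have "length c = k" using assms by (simp add: constraints_def)
  thus ?thesis using of_bool_exactly_one[of k "\<lambda>l. c ! l \<in> A"] by (simp only: sat_set_def sat_constraint_def)
qed

lemma sum_of_bool_mem: "A \<subseteq> {..<n::nat} \<Longrightarrow> (\<Sum>x<n. of_bool (x \<in> A) :: real) = real (card A)"
proof -
  assume A: "A \<subseteq> {..<n}"
  have "(\<Sum>x<n. of_bool (x \<in> A) :: real) = (\<Sum>x\<in>A. 1)"
    by (rule sum.mono_neutral_cong_right) (use A in auto)
  thus ?thesis by (simp only: sum_constant mult_1_right)
qed

text \<open>The true positions for \<open>A\<close> and for \<open>B\<close> either coincide, giving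
  the first term, or differ, giving the second. For fixed positions the count is a product with
  factors \<open>a\<close>, \<open>s - a\<close> and \<open>n - 2 s + a\<close>.\<close>

lemma card_sat_pair:
  assumes A: "A \<subseteq> {..<n}" "card A = s" and B: "B \<subseteq> {..<n}" "card B = s" and k: "2 \<le> k"
  defines "a \<equiv> real (card (A \<inter> B))"
  shows "(\<Sum>c\<in>constraints k n. of_bool (sat_set A c \<and> sat_set B c) :: real)
    = real k * a * (real n - 2 * real s + a) ^ (k - 1)
      + real k * (real k - 1) * (real s - a)^2 * (real n - 2 * real s + a) ^ (k - 2)"
proof -
  define w where "w = real n - 2 * real s + a"
  define f where "f A j l x = (if l = j then of_bool (x \<in> A) else 1 - of_bool (x \<in> A) :: real)" for A :: "nat set" and j l x :: nat
  have finA: "finite A" "finite B" using A B finite_subset by auto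
  have sAB: "(\<Sum>x<n. of_bool (x \<in> A) * of_bool (x \<in> B) :: real) = a"
  proof -
    have "A \<inter> B \<subseteq> {..<n}" using A by auto
    from sum_of_bool_mem[OF this] show ?thesis by (simp only: a_def Int_iff of_bool_conj)
  qed
  have sA: "(\<Sum>x<n. of_bool (x \<in> A) :: real) = real s" and sB: "(\<Sum>x<n. of_bool (x \<in> B) :: real) = real s"
    by (simp_all only: sum_of_bool_mem[OF A(1)] A(2) sum_of_bool_mem[OF B(1)] B(2))
  have s1: "(\<Sum>x<n. of_bool (x \<in> A) * (1 - of_bool (x \<in> B)) :: real) = real s - a"
    by (simp only: right_diff_distrib sum_subtractf mult_1_right sAB sA)
  have s2: "(\<Sum>x<n. (1 - of_bool (x \<in> A)) * of_bool (x \<in> B) :: real) = real s - a"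
    by (simp only: left_diff_distrib sum_subtractf mult_1 sAB sB)
  have s3: "(\<Sum>x<n. (1 - of_bool (x \<in> A)) * (1 - of_bool (x \<in> B)) :: real) = w"
    by (simp only: left_diff_distrib right_diff_distrib sum_subtractf mult_1 mult_1_right sAB sA sB)
      (simp add: w_def)
  have inner: "(\<Sum>x<n. f A j l x * f B i l x) = (if l = j then if l = i then a else real s - a else if l = i then real s - a else w)" for i j l
    by (cases "l = j"; cases "l = i") (simp_all only: f_def simp_thms if_True if_False sAB s1 s2 s3)
  have prod: "(\<Prod>l<k. \<Sum>x<n. f A j l x * f B i l x) = (if i = j then a * w ^ (k - 1) else (real s - a)^2 * w ^ (k - 2))"
    if ij: "i < k" "j < k" for i j
  proof (cases "i = j")
    case True
    have "(\<Prod>l<k. \<Sum>x<n. f A j l x * f B i l x) = a * (\<Prod>l\<in>{..<k} - {j}. w)"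
      using ij True by (subst prod.remove[of _ j]) (auto simp: inner intro!: prod.cong)
    thus ?thesis using True ij by simp
  next
    case False
    have "(\<Prod>l<k. \<Sum>x<n. f A j l x * f B i l x) = (real s - a) * ((real s - a) * (\<Prod>l\<in>{..<k} - {j} - {i}. w))"
      using ij False
      by (subst prod.remove[of _ j], simp, simp, subst prod.remove[of _ i]) (auto simp: inner intro!: prod.cong)
    also have "card ({..<k} - {j} - {i}) = k - 2" using ij False by simp
    hence "(\<Prod>l\<in>{..<k} - {j} - {i}. w) = w ^ (k - 2)" by simp
    finally show ?thesis using False by (simp add: power2_eq_square)
  qed
  have "(\<Sum>c\<in>constraints k n. of_bool (sat_set A c \<and> sat_set B c) :: real)
     = (\<Sum>c\<in>constraints k n. \<Sum>j<k. \<Sum>i<k. \<Prod>l<k. f A j l (c ! l) * f B i l (c ! l))"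
    by (intro sum.cong refl) (simp add: of_bool_conj of_bool_sat_set sum_product f_def prod.distrib)
  also have "\<dots> = (\<Sum>j<k. \<Sum>i<k. \<Sum>c\<in>constraints k n. \<Prod>l<k. f A j l (c ! l) * f B i l (c ! l))"
    by (subst sum.swap, intro sum.cong refl, rule sum.swap)
  also have "\<dots> = (\<Sum>j<k. \<Sum>i<k. \<Prod>l<k. \<Sum>x<n. f A j l x * f B i l x)"
    using sum_prod_constraints[of "\<lambda>l x. f A _ l x * f B _ l x" k n] by simp
  also have "\<dots> = (\<Sum>j<k. \<Sum>i<k. (if i = j then a * w ^ (k - 1) else (real s - a)^2 * w ^ (k - 2)))"
    using prod by (intro sum.cong refl) auto
  also have "\<dots> = (\<Sum>j<k. a * w ^ (k - 1) + real (k - 1) * ((real s - a)^2 * w ^ (k - 2)))"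
  proof (intro sum.cong refl)
    fix j assume j: "j \<in> {..<k}"
    show "(\<Sum>i<k. (if i = j then a * w ^ (k - 1) else (real s - a)^2 * w ^ (k - 2)))
        = a * w ^ (k - 1) + real (k - 1) * ((real s - a)^2 * w ^ (k - 2))"
      using j by (subst sum.remove[of _ j]) auto
  qed
  also have "\<dots> = real k * a * w ^ (k - 1) + real k * (real k - 1) * (real s - a)^2 * w ^ (k - 2)"
    using k by (simp add: of_nat_diff algebra_simps)
  finally show ?thesis by (simp add: w_def)
qed

lemma card_sat_single:
  assumes A: "A \<subseteq> {..<n}" "card A = s"
  shows "(\<Sum>c\<in>constraints k n. of_bool (sat_set A c) :: real) = real k * (real s * (real n - real s) ^ (k - 1))"
proof -
  define f where "f j l x = (if l = j then of_bool (x \<in> A) else 1 - of_bool (x \<in> A) :: real)" for j l x :: nat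
  have sA: "(\<Sum>x<n. of_bool (x \<in> A) :: real) = real s"
    by (simp only: sum_of_bool_mem[OF A(1)] A(2))
  have inner: "(\<Sum>x<n. f j l x) = (if l = j then real s else real n - real s)" for j l
  proof (cases "l = j")
    case False
    have "(\<Sum>x<n. f j l x) = (\<Sum>x<n. 1) - (\<Sum>x<n. of_bool (x \<in> A))"
      using False by (simp only: f_def if_False sum_subtractf)
    thus ?thesis unfolding sA using False by simp
  qed (simp only: f_def simp_thms if_True sA)
  have prod: "(\<Prod>l<k. \<Sum>x<n. f j l x) = real s * (real n - real s) ^ (k - 1)" if "j < k" for j
  proof -
    have "(\<Prod>l<k. \<Sum>x<n. f j l x) = real s * (\<Prod>l\<in>{..<k} - {j}. real n - real s)"
      using that by (subst prod.remove[of _ j]) (auto simp: inner intro!: prod.cong)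
    thus ?thesis using that by simp
  qed
  have "(\<Sum>c\<in>constraints k n. of_bool (sat_set A c) :: real) = (\<Sum>c\<in>constraints k n. \<Sum>j<k. \<Prod>l<k. f j l (c ! l))"
    by (intro sum.cong refl) (simp add: of_bool_sat_set f_def)
  also have "\<dots> = (\<Sum>j<k. \<Sum>c\<in>constraints k n. \<Prod>l<k. f j l (c ! l))" by (rule sum.swap)
  also have "\<dots> = (\<Sum>j<k. \<Prod>l<k. \<Sum>x<n. f j l x)"
    using sum_prod_constraints[of "\<lambda>l x. f _ l x" k n] by simp
  also have "\<dots> = (\<Sum>j<k. real s * (real n - real s) ^ (k - 1))" using prod by (intro sum.cong) auto
  finally show ?thesis by simp
qed

definition balanced :: "nat \<Rightarrow> nat \<Rightarrow> nat set set" where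
  "balanced n s = {A. A \<subseteq> {..<n} \<and> card A = s}"

lemma finite_balanced [simp]: "finite (balanced n s)"
  by (rule finite_subset[of _ "Pow {..<n}"]) (auto simp: balanced_def)

lemma card_balanced: "card (balanced n s) = n choose s"
  unfolding balanced_def using n_subsets[of "{..<n}" s] by simp

lemma card_balanced_overlap:
  assumes A: "A \<in> balanced n s" and a: "a \<le> s"
  shows "card {B\<in>balanced n s. card (A \<inter> B) = a} = (s choose a) * ((n - s) choose (s - a))"
proof -
  have AA: "A \<subseteq> {..<n}" "card A = s" "finite A" using A finite_subset by (auto simp: balanced_def)
  have "bij_betw (\<lambda>B. (A \<inter> B, B - A)) {B\<in>balanced n s. card (A \<inter> B) = a}
      ({X. X \<subseteq> A \<and> card X = a} \<times> {Y. Y \<subseteq> {..<n} - A \<and> card Y = s - a})"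
  proof (rule bij_betwI[where g="\<lambda>(X, Y). X \<union> Y"])
    show "(\<lambda>B. (A \<inter> B, B - A)) \<in> {B \<in> balanced n s. card (A \<inter> B) = a} \<rightarrow>
      {X. X \<subseteq> A \<and> card X = a} \<times> {Y. Y \<subseteq> {..<n} - A \<and> card Y = s - a}"
    proof
      fix B assume B: "B \<in> {B \<in> balanced n s. card (A \<inter> B) = a}"
      have "finite B" using B finite_subset by (auto simp: balanced_def)
      hence "card (B - A) = card B - card (A \<inter> B)" by (metis card_Diff_subset_Int finite_Int inf_commute)
      thus "(A \<inter> B, B - A) \<in> {X. X \<subseteq> A \<and> card X = a} \<times> {Y. Y \<subseteq> {..<n} - A \<and> card Y = s - a}"
        using B by (auto simp: balanced_def)
    qed
    show "(\<lambda>(X, Y). X \<union> Y) \<in> {X. X \<subseteq> A \<and> card X = a} \<times> {Y. Y \<subseteq> {..<n} - A \<and> card Y = s - a} \<rightarrow>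
      {B \<in> balanced n s. card (A \<inter> B) = a}"
    proof
      fix z assume "z \<in> {X. X \<subseteq> A \<and> card X = a} \<times> {Y. Y \<subseteq> {..<n} - A \<and> card Y = s - a}"
      then obtain X Y where z: "z = (X, Y)" "X \<subseteq> A" "card X = a" "Y \<subseteq> {..<n} - A" "card Y = s - a" by auto
      have fin: "finite X" "finite Y"
        using z AA finite_subset[of X A] finite_subset[of Y "{..<n} - A"] by auto
      have "X \<inter> Y = {}" using z by auto
      hence "card (X \<union> Y) = s" using card_Un_disjoint[OF fin] z a by simp
      moreover have "A \<inter> (X \<union> Y) = X" using z by auto
      ultimately show "(case z of (X, Y) \<Rightarrow> X \<union> Y) \<in> {B \<in> balanced n s. card (A \<inter> B) = a}"
        using z AA by (auto simp: balanced_def)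
    qed
  qed auto
  hence "card {B\<in>balanced n s. card (A \<inter> B) = a}
      = card ({X. X \<subseteq> A \<and> card X = a} \<times> {Y. Y \<subseteq> {..<n} - A \<and> card Y = s - a})"
    by (rule bij_betw_same_card)
  also have "\<dots> = (s choose a) * (card ({..<n} - A) choose (s - a))"
    using n_subsets[of A a] n_subsets[of "{..<n} - A" "s - a"] AA by (simp add: card_cartesian_product)
  also have "card ({..<n} - A) = n - s" using AA by (simp add: card_Diff_subset)
  finally show ?thesis .
qed

lemma sum_balanced_pairs:
  fixes g :: "nat \<Rightarrow> real"
  shows "(\<Sum>A\<in>balanced n s. \<Sum>B\<in>balanced n s. g (card (A \<inter> B)))
    = real (n choose s) * (\<Sum>a\<le>s. real ((s choose a) * ((n - s) choose (s - a))) * g a)"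
proof -
  have "(\<Sum>B\<in>balanced n s. g (card (A \<inter> B))) = (\<Sum>a\<le>s. real ((s choose a) * ((n - s) choose (s - a))) * g a)"
    if A: "A \<in> balanced n s" for A
  proof -
    have fA: "finite A" "card A = s" using A finite_subset by (auto simp: balanced_def)
    have "(\<Sum>B\<in>balanced n s. g (card (A \<inter> B))) = (\<Sum>a\<le>s. \<Sum>B | B \<in> balanced n s \<and> card (A \<inter> B) = a. g (card (A \<inter> B)))"
      using fA by (intro sum.group[symmetric]) (auto intro: card_mono)
    also have "\<dots> = (\<Sum>a\<le>s. real ((s choose a) * ((n - s) choose (s - a))) * g a)"
      using card_balanced_overlap[OF A] by (intro sum.cong refl) simp
    finally show ?thesis .
  qed
  thus ?thesis by (simp add: card_balanced)
qed

section \<open>Fourier expansion of a constraint\<close>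

definition xi :: "nat \<Rightarrow> nat set \<Rightarrow> nat \<Rightarrow> real" where
  "xi k A x = of_bool (x \<in> A) - 1 / real k"

text \<open>Obtained by writing \<open>of_bool\<close> as \<open>xi + 1 / k\<close> and its
  complement as \<open>- xi + (1 - 1 / k)\<close> in every position, and expanding the product;
  \<open>j\<close> is the true position.\<close>

definition fcoeff :: "nat \<Rightarrow> nat set \<Rightarrow> real" where
  "fcoeff k U = (\<Sum>j<k. (\<Prod>l\<in>U. if l = j then 1 else - 1) * (\<Prod>l\<in>{..<k} - U. if l = j then 1 / real k else 1 - 1 / real k))"

lemma fourier_expansion:
  assumes "c \<in> constraints k n"
  shows "(of_bool (sat_set A c) :: real) = (\<Sum>U\<in>Pow {..<k}. fcoeff k U * (\<Prod>j\<in>U. xi k A (c ! j)))"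
proof -
  define \<alpha> :: "nat \<Rightarrow> nat \<Rightarrow> real" where "\<alpha> j l = (if l = j then 1 else - 1)" for j l
  define \<beta> :: "nat \<Rightarrow> nat \<Rightarrow> real" where "\<beta> j l = (if l = j then 1 / real k else 1 - 1 / real k)" for j l
  have "(of_bool (sat_set A c) :: real) = (\<Sum>j<k. \<Prod>l<k. \<alpha> j l * xi k A (c ! l) + \<beta> j l)"
    unfolding of_bool_sat_set[OF assms] by (intro sum.cong prod.cong refl) (simp add: \<alpha>_def \<beta>_def xi_def)
  also have "\<dots> = (\<Sum>j<k. \<Sum>U\<in>Pow {..<k}. (\<Prod>l\<in>U. \<alpha> j l * xi k A (c ! l)) * (\<Prod>l\<in>{..<k} - U. \<beta> j l))"
    by (intro sum.cong refl prod_add) auto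
  also have "\<dots> = (\<Sum>U\<in>Pow {..<k}. \<Sum>j<k. (\<Prod>l\<in>U. \<alpha> j l * xi k A (c ! l)) * (\<Prod>l\<in>{..<k} - U. \<beta> j l))"
    by (rule sum.swap)
  also have "\<dots> = (\<Sum>U\<in>Pow {..<k}. fcoeff k U * (\<Prod>j\<in>U. xi k A (c ! j)))"
    by (intro sum.cong refl) (simp add: fcoeff_def \<alpha>_def \<beta>_def prod.distrib sum_distrib_left mult_ac)
  finally show ?thesis .
qed

text \<open>The summands collect the true position inside \<open>U\<close> and outside it. Where a
  truncated subtraction in an exponent takes effect, the coefficient in front is
  \<open>0\<close>.\<close>

lemma fcoeff_eq:
  assumes U: "U \<subseteq> {..<k}" and k: "1 \<le> k"
  shows "fcoeff k U = real (card U) * ((- 1) ^ (card U - 1) * (1 - 1 / real k) ^ (k - card U))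
    + real (k - card U) * ((- 1) ^ card U * (1 / real k * (1 - 1 / real k) ^ (k - card U - 1)))"
proof -
  let ?p = "1 / real k"
  have fin: "finite U" using U finite_subset by blast
  define f where "f j = (\<Prod>l\<in>U. if l = j then 1 else - 1) * (\<Prod>l\<in>{..<k} - U. if l = j then ?p else 1 - ?p)" for j
  have 1: "f j = (- 1) ^ (card U - 1) * (1 - ?p) ^ (k - card U)" if j: "j \<in> U" for j
  proof -
    have "(\<Prod>l\<in>U. if l = j then 1 else - 1 :: real) = 1 * (\<Prod>l\<in>U - {j}. - 1)"
      using j fin by (subst prod.remove[of _ j]) (auto intro!: prod.cong)
    moreover have "(\<Prod>l\<in>{..<k} - U. if l = j then ?p else 1 - ?p) = (\<Prod>l\<in>{..<k} - U. 1 - ?p)"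
      using j by (intro prod.cong) auto
    ultimately show ?thesis using j fin U by (simp add: f_def card_Diff_subset)
  qed
  have 2: "f j = (- 1) ^ card U * (?p * (1 - ?p) ^ (k - card U - 1))" if j: "j \<in> {..<k} - U" for j
  proof -
    have "(\<Prod>l\<in>U. if l = j then 1 else - 1 :: real) = (\<Prod>l\<in>U. - 1)"
      using j by (intro prod.cong) auto
    moreover have "(\<Prod>l\<in>{..<k} - U. if l = j then ?p else 1 - ?p) = ?p * (\<Prod>l\<in>{..<k} - U - {j}. 1 - ?p)"
      using j by (subst prod.remove[of _ j]) (auto intro!: prod.cong)
    moreover have "card ({..<k} - U - {j}) = k - card U - 1"
      using j fin U by (simp add: card_Diff_subset)
    ultimately show ?thesis by (simp add: f_def)
  qed
  have "fcoeff k U = (\<Sum>j\<in>U. f j) + (\<Sum>j\<in>{..<k} - U. f j)"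
    unfolding fcoeff_def f_def using U by (subst sum.subset_diff[of U]) auto
  also have "(\<Sum>j\<in>U. f j) = real (card U) * ((- 1) ^ (card U - 1) * (1 - ?p) ^ (k - card U))"
    using 1 by simp
  also have "(\<Sum>j\<in>{..<k} - U. f j) = real (k - card U) * ((- 1) ^ card U * (?p * (1 - ?p) ^ (k - card U - 1)))"
    using 2 fin U by (simp add: card_Diff_subset)
  finally show ?thesis .
qed

context
  fixes k :: nat
  assumes k: "3 \<le> k"
begin

lemma p_bounds: "0 < 1 / real k" "1 / real k \<le> 1 / 3" "0 < 1 - 1 / real k" "1 - 1 / real k \<le> 1"
  using k by (auto simp: field_simps)

lemma fcoeff_empty: "fcoeff k {} = (1 - 1 / real k) ^ (k - 1)"
  using k by (subst fcoeff_eq) auto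

text \<open>The density \<open>1 / k\<close> of true variables is chosen so that the first-order coefficients vanish.\<close>

lemma fcoeff_single: "i < k \<Longrightarrow> fcoeff k {i} = 0"
proof -
  assume "i < k"
  hence "fcoeff k {i} = (1 - 1 / real k) ^ (k - 1) - real (k - 1) * (1 / real k) * (1 - 1 / real k) ^ (k - 2)"
    using k by (subst fcoeff_eq) (auto simp: numeral_2_eq_2)
  also have "(1 - 1 / real k) ^ (k - 1) = (1 - 1 / real k) * (1 - 1 / real k) ^ (k - 2)"
  proof -
    have "k - 1 = Suc (k - 2)" using k by simp
    thus ?thesis by (simp only: power_Suc)
  qed
  also have "real (k - 1) * (1 / real k) = 1 - 1 / real k" using k by (simp add: of_nat_diff field_simps)
  finally show ?thesis by simp
qed

text \<open>The sign matters: a pair lowers the satisfied fraction only when its mean is positive,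
  so an upper bound on that mean suffices.\<close>

lemma fcoeff_pair:
  assumes "U \<subseteq> {..<k}" "card U = 2"
  shows "fcoeff k U = - ((1 - 1 / real k) ^ (k - 3))"
proof -
  let ?p = "1 / real k"
  have "fcoeff k U = - 2 * (1 - ?p) ^ (k - 2) + real (k - 2) * (?p * (1 - ?p) ^ (k - 3))"
    using assms k by (subst fcoeff_eq) (auto simp: numeral_3_eq_3 numeral_2_eq_2)
  also have "(1 - ?p) ^ (k - 2) = (1 - ?p) * (1 - ?p) ^ (k - 3)"
  proof -
    have "k - 2 = Suc (k - 3)" using k by simp
    thus ?thesis by simp
  qed
  also have "real (k - 2) * (?p * (1 - ?p) ^ (k - 3)) = (1 - 2 * ?p) * (1 - ?p) ^ (k - 3)"
    using k by (simp add: of_nat_diff field_simps)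
  finally show ?thesis by (simp add: algebra_simps)
qed

lemma abs_fcoeff_le:
  assumes "U \<subseteq> {..<k}"
  shows "\<bar>fcoeff k U\<bar> \<le> real k"
proof -
  let ?p = "1 / real k"
  have cU: "card U \<le> k" using card_mono[OF _ assms] by simp
  have t1: "\<bar>(- 1) ^ (card U - 1) * (1 - ?p) ^ (k - card U)\<bar> \<le> 1"
    using p_bounds by (simp add: abs_mult power_abs power_le_one)
  have "?p * (1 - ?p) ^ (k - card U - 1) \<le> 1 * 1"
    using p_bounds by (intro mult_mono power_le_one) auto
  hence t2: "\<bar>(- 1) ^ card U * (?p * (1 - ?p) ^ (k - card U - 1))\<bar> \<le> 1"
    using p_bounds by (simp add: abs_mult power_abs)
  have "\<bar>fcoeff k U\<bar> \<le> \<bar>real (card U) * ((- 1) ^ (card U - 1) * (1 - ?p) ^ (k - card U))\<bar>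
      + \<bar>real (k - card U) * ((- 1) ^ card U * (?p * (1 - ?p) ^ (k - card U - 1)))\<bar>"
  proof -
    have "1 \<le> k" using k by simp
    show ?thesis unfolding fcoeff_eq[OF assms \<open>1 \<le> k\<close>] by (rule abs_triangle_ineq)
  qed
  also have "\<dots> \<le> real (card U) * 1 + real (k - card U) * 1"
    unfolding abs_mult[of "real _"] using t1 t2 by (intro add_mono mult_mono) auto
  finally show ?thesis using cU by (simp add: of_nat_diff)
qed

lemma abs_xi_le: "\<bar>xi k A x\<bar> \<le> 1"
  using p_bounds by (auto simp: xi_def)

section \<open>Bad constraints for a given set of solutions\<close>

context
  fixes n :: nat and T :: "nat set set"
  assumes n: "0 < n" and T: "finite T" "T \<noteq> {}"
begin

text \<open>\<open>T\<close> stands for the solutions surviving the constraints so far. A value of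
  \<open>mean {i} c\<close> near \<open>1 - 1 / k\<close> says that the variable
  \<open>c ! i\<close> is nearly frozen to true.\<close>

definition mean :: "nat set \<Rightarrow> nat list \<Rightarrow> real" where
  "mean U c = (\<Sum>A\<in>T. \<Prod>j\<in>U. xi k A (c ! j)) / real (card T)"

text \<open>For balanced sets this is a fixed multiple of \<open>rho\<close>, see
  \<open>ov_eq\<close>.\<close>

definition ov :: "nat set \<times> nat set \<Rightarrow> real" where
  "ov z = (\<Sum>x<n. xi k (fst z) x * xi k (snd z) x) / real n"

definition pavg :: "(nat set \<times> nat set \<Rightarrow> real) \<Rightarrow> real" where
  "pavg f = (\<Sum>z\<in>T \<times> T. f z) / real (card T) ^ 2"

definition frac_sat :: "nat list \<Rightarrow> real" where
  "frac_sat c = (\<Sum>A\<in>T. of_bool (sat_set A c)) / real (card T)"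

lemma card_T_pos: "0 < real (card T)"
  using T by (simp add: card_gt_0_iff)

lemma frac_sat_expansion:
  "c \<in> constraints k n \<Longrightarrow> frac_sat c = (\<Sum>U\<in>Pow {..<k}. fcoeff k U * mean U c)"
proof -
  assume c: "c \<in> constraints k n"
  have "(\<Sum>A\<in>T. of_bool (sat_set A c) :: real) = (\<Sum>U\<in>Pow {..<k}. \<Sum>A\<in>T. fcoeff k U * (\<Prod>j\<in>U. xi k A (c ! j)))"
    unfolding fourier_expansion[OF c] by (rule sum.swap)
  thus ?thesis by (simp add: frac_sat_def mean_def sum_divide_distrib sum_distrib_left)
qed

lemma mean_empty: "mean {} c = 1"
  using card_T_pos by (simp add: mean_def)

text \<open>Holds for every \<open>A\<close>: if the first factor is positive, the second is at most
  \<open>1 - 1 / k\<close>; if it is \<open>- 1 / k\<close>, the product is at most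
  \<open>1 / k^2\<close>, which is the value of the right side. So a large pair mean forces a bias
  of each variable separately.\<close>

lemma mean_pair_le:
  assumes "i \<noteq> j"
  shows "mean {i, j} c \<le> (1 - 1 / real k) * mean {i} c + 1 / real k"
proof -
  let ?p = "1 / real k"
  have "(\<Sum>A\<in>T. \<Prod>l\<in>{i, j}. xi k A (c ! l)) \<le> (\<Sum>A\<in>T. (1 - ?p) * xi k A (c ! i) + ?p)"
  proof (rule sum_mono)
    fix A
    have "xi k A (c ! i) * xi k A (c ! j) \<le> (1 - ?p) * xi k A (c ! i) + ?p"
    proof -
      have "?p * ?p \<le> ?p * 1" using p_bounds by (intro mult_left_mono) auto
      hence "0 \<le> ?p * ?p" "?p * ?p \<le> ?p" by simp_all
      thus ?thesis
        using p_bounds by (cases "c ! i \<in> A"; cases "c ! j \<in> A") (simp_all add: xi_def algebra_simps)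
    qed
    thus "(\<Prod>l\<in>{i, j}. xi k A (c ! l)) \<le> (1 - ?p) * xi k A (c ! i) + ?p" using assms by simp
  qed
  hence "mean {i, j} c \<le> (\<Sum>A\<in>T. (1 - ?p) * xi k A (c ! i) + ?p) / real (card T)"
    unfolding mean_def by (intro divide_right_mono) auto
  also have "\<dots> = (1 - ?p) * mean {i} c + ?p"
    using card_T_pos by (simp add: mean_def sum.distrib sum_distrib_left[symmetric] add_divide_distrib)
  finally show ?thesis .
qed

text \<open>At most one second-order term is not negligible, and it can outweigh the constant term
\<open>fcoeff k {}\<close> only if both variables involved are nearly frozen to true.\<close>

lemma frac_sat_ge:
  assumes c: "c \<in> constraints k n" and \<eta>: "0 \<le> \<eta>" "0 \<le> \<eta>1"
    and big: "\<And>U. U \<subseteq> {..<k} \<Longrightarrow> 3 \<le> card U \<Longrightarrow> \<bar>mean U c\<bar> < \<eta>"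
    and pairs: "\<And>U U'. U \<subseteq> {..<k} \<Longrightarrow> U' \<subseteq> {..<k} \<Longrightarrow> card U = 2 \<Longrightarrow> card U' = 2 \<Longrightarrow> U \<noteq> U' \<Longrightarrow>
        \<bar>mean U c\<bar> < \<eta> \<or> \<bar>mean U' c\<bar> < \<eta>"
    and singles: "\<And>i j. i < k \<Longrightarrow> j < k \<Longrightarrow> i \<noteq> j \<Longrightarrow> mean {i} c < \<eta>1 \<or> mean {j} c < \<eta>1"
  shows "(1 - 1 / real k) ^ (k - 3) * ((1 - 1 / real k)^2 - 1 / real k - (1 - 1 / real k) * \<eta>1) - 2 ^ k * (real k * \<eta>)
    \<le> frac_sat c"
proof -
  let ?p = "1 / real k"
  define B0 where "B0 = (1 - ?p) ^ (k - 3)"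
  have B0: "0 \<le> B0" using p_bounds by (simp add: B0_def)
  define t where "t = - (B0 * ((1 - ?p) * \<eta>1 + ?p))"
  have t0: "t \<le> 0" using B0 \<eta> p_bounds by (simp add: t_def)
  have small: "- (real k * \<eta>) \<le> fcoeff k U * mean U c" if "U \<subseteq> {..<k}" "\<bar>mean U c\<bar> < \<eta>" for U
  proof -
    have "\<bar>fcoeff k U * mean U c\<bar> \<le> real k * \<eta>"
      unfolding abs_mult using abs_fcoeff_le[OF that(1)] that(2) by (intro mult_mono) auto
    thus ?thesis by linarith
  qed
  \<comment> \<open>By \<open>pairs\<close> at most one set of size two escapes the threshold; if
    none does, \<open>W\<close> is arbitrary.\<close>
  obtain W where W: "\<And>U. U \<subseteq> {..<k} \<Longrightarrow> card U = 2 \<Longrightarrow> U \<noteq> W \<Longrightarrow> \<bar>mean U c\<bar> < \<eta>"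
  proof (cases "\<exists>W. W \<subseteq> {..<k} \<and> card W = 2 \<and> \<not> \<bar>mean W c\<bar> < \<eta>")
    case True
    then obtain W where W: "W \<subseteq> {..<k}" "card W = 2" "\<not> \<bar>mean W c\<bar> < \<eta>" by blast
    show ?thesis by (rule that[of W]) (use pairs W in blast)
  qed blast
  have pt: "(if U = {} then (1 - ?p) ^ (k - 1) else 0) + (if U = W then t else 0) - real k * \<eta> \<le> fcoeff k U * mean U c"
    if U: "U \<in> Pow {..<k}" for U
  proof -
    have Uk: "U \<subseteq> {..<k}" using U by simp
    have fU: "finite U" using Uk finite_subset by blast
    have e0: "0 \<le> real k * \<eta>" using \<eta> by simp
    have q0: "0 \<le> (1 - ?p) ^ (k - 1)" using p_bounds by simp
    consider "card U = 0" | "card U = 1" | "card U = 2" | "3 \<le> card U" by linarith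
    thus ?thesis
    proof cases
      case 1
      hence "U = {}" using fU by simp
      thus ?thesis using t0 e0 by (simp add: fcoeff_empty mean_empty)
    next
      case 2
      then obtain i where "U = {i}" by (auto simp: card_1_singleton_iff)
      thus ?thesis using Uk t0 e0 by (simp add: fcoeff_single)
    next
      case 3
      hence ne: "U \<noteq> {}" by auto
      show ?thesis
      proof (cases "U = W")
        case False
        thus ?thesis using small[OF Uk W[OF Uk 3 False]] ne by simp
      next
        case True
        obtain i j where ij: "U = {i, j}" "i \<noteq> j" using 3 by (auto simp: card_2_iff)
        have "mean U c \<le> (1 - ?p) * \<eta>1 + ?p"
        proof -
          have "mean {i} c < \<eta>1 \<or> mean {j} c < \<eta>1" using singles[of i j] ij Uk by auto
          thus ?thesis
          proof
            assume "mean {i} c < \<eta>1"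
            hence "(1 - ?p) * mean {i} c \<le> (1 - ?p) * \<eta>1" using p_bounds by (intro mult_left_mono) auto
            thus ?thesis using mean_pair_le[OF ij(2), of c] ij(1) by simp
          next
            assume "mean {j} c < \<eta>1"
            hence "(1 - ?p) * mean {j} c \<le> (1 - ?p) * \<eta>1" using p_bounds by (intro mult_left_mono) auto
            moreover have "U = {j, i}" using ij by auto
            ultimately show ?thesis using mean_pair_le[of j i c] ij(2) by simp
          qed
        qed
        hence "B0 * mean U c \<le> B0 * ((1 - ?p) * \<eta>1 + ?p)" using B0 by (intro mult_left_mono)
        hence "t \<le> fcoeff k U * mean U c" unfolding fcoeff_pair[OF Uk 3] t_def B0_def by simp
        thus ?thesis using True ne e0 by simp
      qed
    next
      case 4
      hence ne: "U \<noteq> {}" by auto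
      thus ?thesis using small[OF Uk big[OF Uk 4]] t0 by (cases "U = W") simp_all
    qed
  qed
  have "(1 - ?p) ^ (k - 1) + t - 2 ^ k * (real k * \<eta>)
      \<le> (\<Sum>U\<in>Pow {..<k}. (if U = {} then (1 - ?p) ^ (k - 1) else 0) + (if U = W then t else 0) - real k * \<eta>)"
    using t0 by (simp add: sum.distrib sum_subtractf sum.delta card_Pow)
  also have "\<dots> \<le> frac_sat c"
    unfolding frac_sat_expansion[OF c] by (rule sum_mono) (rule pt)
  finally have "(1 - ?p) ^ (k - 1) + t - 2 ^ k * (real k * \<eta>) \<le> frac_sat c" .
  moreover have "(1 - ?p) ^ (k - 1) = B0 * (1 - ?p)^2"
  proof -
    have "k - 1 = (k - 3) + 2" using k by simp
    thus ?thesis unfolding B0_def by (simp only: power_add)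
  qed
  ultimately show ?thesis unfolding B0_def[symmetric] t_def by (simp add: algebra_simps)
qed

lemma abs_ov_le: "\<bar>ov z\<bar> \<le> 1"
proof -
  have "\<bar>\<Sum>x<n. xi k (fst z) x * xi k (snd z) x\<bar> \<le> (\<Sum>x<n. \<bar>xi k (fst z) x * xi k (snd z) x\<bar>)" by (rule sum_abs)
  also have "\<dots> \<le> (\<Sum>x<n. 1)"
    unfolding abs_mult using mult_mono[OF abs_xi_le abs_xi_le] by (intro sum_mono) simp
  finally show ?thesis using n by (simp add: ov_def)
qed

lemma mean_sq: "mean U c ^ 2 = pavg (\<lambda>z. \<Prod>j\<in>U. xi k (fst z) (c ! j) * xi k (snd z) (c ! j))"
  unfolding mean_def pavg_def power_divide
  by (simp add: power2_eq_square sum_product sum.cartesian_product case_prod_unfold prod.distrib)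

lemma pavg_mono: "(\<And>z. z \<in> T \<times> T \<Longrightarrow> f z \<le> g z) \<Longrightarrow> pavg f \<le> pavg g"
  unfolding pavg_def by (intro divide_right_mono sum_mono) auto

lemma pavg_nonneg: "(\<And>z. 0 \<le> f z) \<Longrightarrow> 0 \<le> pavg f"
  unfolding pavg_def by (intro divide_nonneg_nonneg sum_nonneg) auto

lemma pavg_cmult: "pavg (\<lambda>z. c * f z) = c * pavg f"
  by (simp add: pavg_def sum_distrib_left)

lemma pavg_add: "pavg (\<lambda>z. f z + g z) = pavg f + pavg g"
  by (simp add: pavg_def sum.distrib add_divide_distrib)

lemma sum_pavg: "(\<Sum>c\<in>X. pavg (f c)) = pavg (\<lambda>z. \<Sum>c\<in>X. f c z)"
  unfolding pavg_def sum_divide_distrib[symmetric] by (subst sum.swap) simp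

text \<open>A squared mean is an average over pairs of solutions, and for a fixed pair the
  coordinates of a random constraint are independent, each contributing \<open>ov z\<close>.\<close>

lemma sum_mean_sq:
  assumes "U \<subseteq> {..<k}"
  shows "(\<Sum>c\<in>constraints k n. mean U c ^ 2) = real n ^ k * pavg (\<lambda>z. ov z ^ card U)"
proof -
  have cU: "card U \<le> k" using card_mono[OF _ assms] by simp
  have "(\<Sum>c\<in>constraints k n. mean U c ^ 2)
      = pavg (\<lambda>z. \<Sum>c\<in>constraints k n. \<Prod>j\<in>U. xi k (fst z) (c ! j) * xi k (snd z) (c ! j))"
    unfolding mean_sq by (rule sum_pavg)
  also have "\<dots> = pavg (\<lambda>z. real n ^ k * ov z ^ card U)"
  proof (intro arg_cong[where f=pavg] ext)
    fix z
    have "(\<Sum>c\<in>constraints k n. \<Prod>j\<in>U. xi k (fst z) (c ! j) * xi k (snd z) (c ! j))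
        = real n ^ (k - card U) * (\<Prod>j\<in>U. \<Sum>x<n. xi k (fst z) x * xi k (snd z) x)"
      by (rule sum_prod_subset_constraints[OF assms, of "\<lambda>_ x. xi k (fst z) x * xi k (snd z) x"])
    also have "(\<Sum>x<n. xi k (fst z) x * xi k (snd z) x) = real n * ov z" using n by (simp add: ov_def)
    also have "real n ^ (k - card U) * (\<Prod>j\<in>U. real n * ov z) = real n ^ k * ov z ^ card U"
      using cU by (simp add: power_mult_distrib mult.assoc[symmetric] power_add[symmetric])
    finally show "(\<Sum>c\<in>constraints k n. \<Prod>j\<in>U. xi k (fst z) (c ! j) * xi k (snd z) (c ! j)) = real n ^ k * ov z ^ card U" .
  qed
  finally show ?thesis by (simp only: pavg_cmult)
qed

text \<open>Some \<open>j\<close> lies in \<open>U'\<close> but not in \<open>U\<close>. Resampling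
  coordinate \<open>j\<close> leaves \<open>mean U\<close> unchanged and averages the square of
  \<open>mean U'\<close> to at most \<open>pavg \<bar>ov\<bar>\<close>, so the product is of third
  order in the correlation.\<close>

lemma sum_mean_sq_pair:
  assumes U: "U \<subseteq> {..<k}" "card U = 2" and U': "U' \<subseteq> {..<k}" "card U' = 2" and ne: "U \<noteq> U'"
  shows "(\<Sum>c\<in>constraints k n. mean U c ^ 2 * mean U' c ^ 2) \<le> real n ^ k * (pavg (\<lambda>z. ov z ^ 2) * pavg (\<lambda>z. \<bar>ov z\<bar>))"
proof -
  have finU: "finite U" "finite U'" using U U' finite_subset by auto
  have "\<not> U' \<subseteq> U" using ne U U' finU by (metis card_subset_eq)
  then obtain j where j: "j \<in> U'" "j \<notin> U" by blast
  obtain l where l: "U' = {j, l}" "j \<noteq> l" using U'(2) j(1) by (auto simp: card_2_iff doubleton_eq_iff)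
  have jk: "j < k" using j U' by auto
  have upd: "(\<Sum>x<n. mean U' (c[j := x]) ^ 2) \<le> real n * pavg (\<lambda>z. \<bar>ov z\<bar>)" if c: "c \<in> constraints k n" for c
  proof -
    have len: "length c = k" using c by (simp add: constraints_def)
    have "(\<Sum>x<n. mean U' (c[j := x]) ^ 2)
        = pavg (\<lambda>z. \<Sum>x<n. (xi k (fst z) x * xi k (snd z) x) * (xi k (fst z) (c ! l) * xi k (snd z) (c ! l)))"
      unfolding mean_sq sum_pavg[symmetric] using l jk len by simp
    also have "\<dots> \<le> pavg (\<lambda>z. real n * \<bar>ov z\<bar>)"
    proof (rule pavg_mono)
      fix z
      have "\<bar>xi k (fst z) (c ! l) * xi k (snd z) (c ! l)\<bar> \<le> 1"
        unfolding abs_mult using mult_mono[OF abs_xi_le abs_xi_le] by simp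
      hence "\<bar>real n * ov z\<bar> * \<bar>xi k (fst z) (c ! l) * xi k (snd z) (c ! l)\<bar> \<le> \<bar>real n * ov z\<bar> * 1"
        by (intro mult_left_mono) auto
      hence "(real n * ov z) * (xi k (fst z) (c ! l) * xi k (snd z) (c ! l)) \<le> real n * \<bar>ov z\<bar>"
        using abs_ge_self[of "(real n * ov z) * (xi k (fst z) (c ! l) * xi k (snd z) (c ! l))"]
        by (simp only: abs_mult mult_1_right abs_of_nat)
      thus "(\<Sum>x<n. (xi k (fst z) x * xi k (snd z) x) * (xi k (fst z) (c ! l) * xi k (snd z) (c ! l))) \<le> real n * \<bar>ov z\<bar>"
        using n by (simp add: ov_def sum_distrib_right[symmetric])
    qed
    finally show ?thesis by (simp only: pavg_cmult)
  qed
  have inv: "mean U (c[j := x]) = mean U c" for c x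
    unfolding mean_def using j(2) by (intro arg_cong2[where f="(/)"] sum.cong prod.cong refl) (metis nth_list_update_neq)
  have "real n * (\<Sum>c\<in>constraints k n. mean U c ^ 2 * mean U' c ^ 2)
      = (\<Sum>c\<in>constraints k n. mean U c ^ 2 * (\<Sum>x<n. mean U' (c[j := x]) ^ 2))"
    using sum_constraints_update[OF jk, of "\<lambda>c. mean U c ^ 2 * mean U' c ^ 2" n]
    by (simp add: inv sum_distrib_left)
  also have "\<dots> \<le> (\<Sum>c\<in>constraints k n. mean U c ^ 2 * (real n * pavg (\<lambda>z. \<bar>ov z\<bar>)))"
    using upd by (intro sum_mono mult_left_mono) auto
  also have "\<dots> = real n * (real n ^ k * (pavg (\<lambda>z. ov z ^ 2) * pavg (\<lambda>z. \<bar>ov z\<bar>)))"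
    using sum_mean_sq[OF U(1)] U(2) by (simp add: sum_distrib_right[symmetric])
  finally show ?thesis using n by (simp only: mult_le_cancel_left_pos of_nat_0_less_iff)
qed

text \<open>A sum of squared single-variable biases. It shows that \<open>pavg ov\<close> is
  nonnegative although \<open>ov\<close> is signed, so the small signed first moment can be used
  without absolute values.\<close>

lemma pavg_ov_eq: "real n * pavg ov = (\<Sum>x<n. ((\<Sum>A\<in>T. xi k A x) / real (card T)) ^ 2)"
proof -
  have "((\<Sum>A\<in>T. xi k A x) / real (card T)) ^ 2 = pavg (\<lambda>z. xi k (fst z) x * xi k (snd z) x)" for x
    unfolding pavg_def power_divide by (simp add: power2_eq_square sum_product sum.cartesian_product case_prod_unfold)
  hence "(\<Sum>x<n. ((\<Sum>A\<in>T. xi k A x) / real (card T)) ^ 2) = pavg (\<lambda>z. real n * ov z)"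
    using n by (simp add: sum_pavg ov_def)
  thus ?thesis by (simp only: pavg_cmult)
qed

lemma pavg_ov_nonneg: "0 \<le> pavg ov"
proof -
  have "0 \<le> real n * pavg ov" unfolding pavg_ov_eq by (intro sum_nonneg) auto
  thus ?thesis using n by (simp add: zero_le_mult_iff)
qed

lemma sum_mean_single:
  assumes "i < k" "j < k" "i \<noteq> j"
  shows "(\<Sum>c\<in>constraints k n. mean {i} c ^ 2 * mean {j} c ^ 2) = real n ^ k * pavg ov ^ 2"
proof -
  define F where "F x = ((\<Sum>A\<in>T. xi k A x) / real (card T)) ^ 2" for x
  have "(\<Sum>c\<in>constraints k n. mean {i} c ^ 2 * mean {j} c ^ 2) = (\<Sum>c\<in>constraints k n. \<Prod>l\<in>{i, j}. (\<lambda>l x. F x) l (c ! l))"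
    using assms by (intro sum.cong refl) (simp add: mean_def F_def)
  also have "\<dots> = real n ^ (k - card {i, j}) * (\<Prod>l\<in>{i, j}. \<Sum>x<n. F x)"
    by (rule sum_prod_subset_constraints) (use assms in auto)
  also have "(\<Sum>x<n. F x) = real n * pavg ov" unfolding F_def by (rule pavg_ov_eq[symmetric])
  also have "real n ^ (k - card {i, j}) * (\<Prod>l\<in>{i, j}. real n * pavg ov) = (real n ^ (k - 2) * real n ^ 2) * pavg ov ^ 2"
  proof -
    have "card {i, j} = 2" using assms by simp
    thus ?thesis unfolding \<open>card {i, j} = 2\<close> using assms by (simp add: power2_eq_square mult_ac)
  qed
  also have "real n ^ (k - 2) * real n ^ 2 = real n ^ k"
  proof -
    have "k - 2 + 2 = k" using k by simp
    thus ?thesis unfolding power_add[symmetric] by (simp only:)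
  qed
  finally show ?thesis .
qed

lemma pavg_1: "pavg (\<lambda>_. 1) = 1"
  using card_T_pos by (simp add: pavg_def card_cartesian_product power2_eq_square)

text \<open>Averages \<open>(y - a)^2 (y + a) \<ge> 0\<close> at
  \<open>y = \<bar>ov z\<bar>\<close>, with \<open>a\<close> its mean.\<close>

lemma pavg_cube_ge:
  "pavg (\<lambda>z. ov z ^ 2) * pavg (\<lambda>z. \<bar>ov z\<bar>) \<le> pavg (\<lambda>z. \<bar>ov z\<bar> ^ 3)"
proof -
  define a where "a = pavg (\<lambda>z. \<bar>ov z\<bar>)"
  define b where "b = pavg (\<lambda>z. ov z ^ 2)"
  have a0: "0 \<le> a" unfolding a_def by (intro pavg_nonneg) simp
  have "0 \<le> (y - a)^2 * (y + a)" if "0 \<le> y" for y using a0 that by simp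
  moreover have "(y - a)^2 * (y + a) = y ^ 3 + ((- a) * y ^ 2 + ((- (a ^ 2)) * y + a ^ 3 * 1))" for y
    by (simp add: power2_eq_square power3_eq_cube algebra_simps)
  ultimately have "0 \<le> pavg (\<lambda>z. \<bar>ov z\<bar> ^ 3 + ((- a) * ov z ^ 2 + ((- (a ^ 2)) * \<bar>ov z\<bar> + a ^ 3 * 1)))"
    by (intro pavg_nonneg) (metis abs_ge_zero power2_abs)
  also have "\<dots> = pavg (\<lambda>z. \<bar>ov z\<bar> ^ 3) + ((- a) * b + ((- (a ^ 2)) * a + a ^ 3 * 1))"
    by (simp only: pavg_add pavg_cmult pavg_1 a_def[symmetric] b_def[symmetric])
  also have "\<dots> = pavg (\<lambda>z. \<bar>ov z\<bar> ^ 3) - a * b" by (simp add: power2_eq_square power3_eq_cube)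
  finally show ?thesis by (simp add: a_def b_def mult.commute)
qed

lemma pavg_sq_le: "pavg ov ^ 2 \<le> pavg (\<lambda>z. ov z ^ 2)"
proof -
  define a where "a = pavg ov"
  have "0 \<le> pavg (\<lambda>z. (ov z - a)^2)" by (intro pavg_nonneg) simp
  also have "\<dots> = pavg (\<lambda>z. ov z ^ 2 + ((- 2 * a) * ov z + a ^ 2 * 1))"
    by (intro arg_cong[where f=pavg] ext) (simp add: power2_eq_square algebra_simps)
  also have "\<dots> = pavg (\<lambda>z. ov z ^ 2) + ((- 2 * a) * a + a ^ 2 * 1)"
    by (simp only: pavg_add pavg_cmult pavg_1) (simp add: a_def)
  finally show ?thesis by (simp add: a_def power2_eq_square)
qed

text \<open>The square of a pair average is not a pair average, and \<open>expect_pairwt\<close>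
  computes expectations only of normalised pair sums. With \<open>a = pavg ov\<close>, either
  \<open>a \<le> \<delta>\<close> and \<open>a^2 \<le> \<delta> a\<close>, or \<open>a^2\<close> is
  at most \<open>a^3 / \<delta>\<close>, where \<open>a^3\<close> is below the third absolute
  moment.\<close>

lemma pavg_ov_sq_le:
  assumes "0 < \<delta>"
  shows "pavg ov ^ 2 \<le> \<delta> * pavg ov + pavg (\<lambda>z. \<bar>ov z\<bar> ^ 3) / \<delta>"
proof -
  define a where "a = pavg ov"
  have a0: "0 \<le> a" using pavg_ov_nonneg by (simp add: a_def)
  have c0: "0 \<le> pavg (\<lambda>z. \<bar>ov z\<bar> ^ 3)" by (intro pavg_nonneg) simp
  have "a \<le> pavg (\<lambda>z. \<bar>ov z\<bar>)" unfolding a_def by (intro pavg_mono) simp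
  hence "a ^ 2 * a \<le> pavg (\<lambda>z. ov z ^ 2) * pavg (\<lambda>z. \<bar>ov z\<bar>)"
    using pavg_sq_le a0 by (intro mult_mono pavg_nonneg) (auto simp: a_def)
  hence cube: "a ^ 2 * a \<le> pavg (\<lambda>z. \<bar>ov z\<bar> ^ 3)" using pavg_cube_ge by linarith
  have "a ^ 2 \<le> \<delta> * a + pavg (\<lambda>z. \<bar>ov z\<bar> ^ 3) / \<delta>"
  proof (cases "a \<le> \<delta>")
    case True
    hence "a * a \<le> \<delta> * a" using a0 by (intro mult_right_mono)
    thus ?thesis using c0 assms by (simp add: power2_eq_square add_increasing2)
  next
    case False
    hence "a ^ 2 * \<delta> \<le> a ^ 2 * a" by (intro mult_left_mono) auto
    hence "a ^ 2 * \<delta> \<le> pavg (\<lambda>z. \<bar>ov z\<bar> ^ 3)" using cube by linarith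
    hence "a ^ 2 \<le> pavg (\<lambda>z. \<bar>ov z\<bar> ^ 3) / \<delta>" using assms by (simp add: pos_le_divide_eq)
    moreover have "0 \<le> \<delta> * a" using a0 assms by simp
    ultimately show ?thesis by linarith
  qed
  thus ?thesis by (simp add: a_def)
qed

text \<open>Below \<open>\<beta>\<close> some hypothesis of \<open>frac_sat_ge\<close> must fail,
  and each kind of failure is counted by Chebyshev's inequality. \<open>2 ^ k\<close>,
  \<open>4 ^ k\<close> and \<open>k^2\<close> bound the numbers of sets, pairs of sets and pairs of
  positions; fourth powers come from products of two squared means.\<close>

lemma bad_count_le:
  fixes \<eta> \<eta>1 \<delta> \<beta> :: real
  assumes \<eta>: "0 < \<eta>" "0 < \<eta>1" and \<delta>: "0 < \<delta>"
    and \<beta>: "\<beta> \<le> (1 - 1 / real k) ^ (k - 3) * ((1 - 1 / real k)^2 - 1 / real k - (1 - 1 / real k) * \<eta>1) - 2 ^ k * (real k * \<eta>)"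
  shows "(\<Sum>c\<in>constraints k n. of_bool (frac_sat c < \<beta>)) \<le> real n ^ k *
    ((2 ^ k / \<eta>^2 + 4 ^ k / \<eta>^4 + (real k)^2 / \<eta>1^4) * ((1 + 1 / \<delta>) * pavg (\<lambda>z. \<bar>ov z\<bar> ^ 3) + \<delta> * pavg ov))"
proof -
  define P where "P = Pow {..<k}"
  define P3 where "P3 = {U\<in>P. 3 \<le> card U}"
  define P2 where "P2 = {z\<in>P \<times> P. card (fst z) = 2 \<and> card (snd z) = 2 \<and> fst z \<noteq> snd z}"
  define P1 where "P1 = {z\<in>{..<k} \<times> {..<k}. fst z \<noteq> snd z}"
  have fin: "finite P" "finite P3" "finite P2" "finite P1"
    by (auto simp: P_def P3_def P2_def P1_def)
  define m3 where "m3 = pavg (\<lambda>z. \<bar>ov z\<bar> ^ 3)"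
  have m30: "0 \<le> m3" unfolding m3_def by (intro pavg_nonneg) simp
  have pt: "of_bool (frac_sat c < \<beta>) \<le> (\<Sum>U\<in>P3. mean U c ^ 2 / \<eta>^2)
      + (\<Sum>z\<in>P2. mean (fst z) c ^ 2 * mean (snd z) c ^ 2 / \<eta>^4)
      + (\<Sum>z\<in>P1. mean {fst z} c ^ 2 * mean {snd z} c ^ 2 / \<eta>1^4)" (is "_ \<le> ?S3 + ?S2 + ?S1")
    if c: "c \<in> constraints k n" for c
  proof (cases "frac_sat c < \<beta>")
    case True
    have nn: "0 \<le> ?S3" "0 \<le> ?S2" "0 \<le> ?S1" by (intro sum_nonneg; simp)+
    have sq: "\<eta> ^ 2 \<le> x ^ 2" if "\<not> \<bar>x\<bar> < \<eta>" for x :: real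
      using that \<eta> by (metis abs_ge_zero less_imp_le not_less power2_abs power_mono)
    have "\<not> ((\<forall>U. U \<subseteq> {..<k} \<longrightarrow> 3 \<le> card U \<longrightarrow> \<bar>mean U c\<bar> < \<eta>) \<and>
       (\<forall>U U'. U \<subseteq> {..<k} \<longrightarrow> U' \<subseteq> {..<k} \<longrightarrow> card U = 2 \<longrightarrow> card U' = 2 \<longrightarrow> U \<noteq> U' \<longrightarrow>
        \<bar>mean U c\<bar> < \<eta> \<or> \<bar>mean U' c\<bar> < \<eta>) \<and>
       (\<forall>i j. i < k \<longrightarrow> j < k \<longrightarrow> i \<noteq> j \<longrightarrow> mean {i} c < \<eta>1 \<or> mean {j} c < \<eta>1))"
      using frac_sat_ge[OF c, of \<eta> \<eta>1] \<beta> True \<eta> by (smt (verit))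
    then consider (a) U where "U \<subseteq> {..<k}" "3 \<le> card U" "\<not> \<bar>mean U c\<bar> < \<eta>"
      | (b) U U' where "U \<subseteq> {..<k}" "U' \<subseteq> {..<k}" "card U = 2" "card U' = 2" "U \<noteq> U'"
          "\<not> \<bar>mean U c\<bar> < \<eta>" "\<not> \<bar>mean U' c\<bar> < \<eta>"
      | (c) i j where "i < k" "j < k" "i \<noteq> j" "\<not> mean {i} c < \<eta>1" "\<not> mean {j} c < \<eta>1"
      by blast
    hence "1 \<le> ?S3 + ?S2 + ?S1"
    proof cases
      case a
      have "1 \<le> mean U c ^ 2 / \<eta>^2" using sq[OF a(3)] \<eta> by simp
      also have "\<dots> \<le> ?S3" using a fin by (intro member_le_sum) (auto simp: P3_def P_def)
      finally show ?thesis using nn by linarith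
    next
      case b
      have "\<eta>^2 * \<eta>^2 \<le> mean U c ^ 2 * mean U' c ^ 2" using sq b by (intro mult_mono) auto
      hence "1 \<le> mean (fst (U, U')) c ^ 2 * mean (snd (U, U')) c ^ 2 / \<eta>^4" using \<eta> by (simp flip: power_add)
      also have "\<dots> \<le> ?S2" using b fin by (intro member_le_sum) (auto simp: P2_def P_def)
      finally show ?thesis using nn by linarith
    next
      case c
      have "\<eta>1^2 \<le> mean {i} c ^ 2" "\<eta>1^2 \<le> mean {j} c ^ 2" using c \<eta> by (auto intro!: power_mono)
      hence "\<eta>1^2 * \<eta>1^2 \<le> mean {i} c ^ 2 * mean {j} c ^ 2" by (intro mult_mono) auto
      hence "1 \<le> mean {fst (i, j)} c ^ 2 * mean {snd (i, j)} c ^ 2 / \<eta>1^4" using \<eta> by (simp flip: power_add)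
      also have "\<dots> \<le> ?S1" using c fin by (intro member_le_sum) (auto simp: P1_def)
      finally show ?thesis using nn by linarith
    qed
    thus ?thesis by simp
  next
    case False
    have "0 \<le> ?S3" "0 \<le> ?S2" "0 \<le> ?S1" by (intro sum_nonneg; simp)+
    thus ?thesis using False by simp
  qed
  define N where "N = real n ^ k"
  have N0: "0 \<le> N" by (simp add: N_def)
  have "(\<Sum>c\<in>constraints k n. of_bool (frac_sat c < \<beta>))
     \<le> (\<Sum>U\<in>P3. (\<Sum>c\<in>constraints k n. mean U c ^ 2) / \<eta>^2)
      + (\<Sum>z\<in>P2. (\<Sum>c\<in>constraints k n. mean (fst z) c ^ 2 * mean (snd z) c ^ 2) / \<eta>^4)
      + (\<Sum>z\<in>P1. (\<Sum>c\<in>constraints k n. mean {fst z} c ^ 2 * mean {snd z} c ^ 2) / \<eta>1^4)"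
    unfolding sum_divide_distrib
    by (subst (1 2 3) sum.swap) (unfold sum.distrib[symmetric], rule sum_mono, rule pt)
  also have "\<dots> \<le> (\<Sum>U\<in>P3. N * m3 / \<eta>^2) + (\<Sum>z\<in>P2. N * m3 / \<eta>^4)
      + (\<Sum>z\<in>P1. N * (\<delta> * pavg ov + m3 / \<delta>) / \<eta>1^4)"
  proof (intro add_mono sum_mono divide_right_mono)
    fix U assume U: "U \<in> P3"
    have "(\<Sum>c\<in>constraints k n. mean U c ^ 2) = N * pavg (\<lambda>z. ov z ^ card U)"
      unfolding N_def using U by (intro sum_mean_sq) (auto simp: P3_def P_def)
    also have "\<dots> \<le> N * m3"
      unfolding m3_def
    proof (intro mult_left_mono pavg_mono N0)
      fix z
      have "ov z ^ card U \<le> \<bar>ov z\<bar> ^ card U" by (metis abs_ge_self power_abs)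
      also have "\<dots> \<le> \<bar>ov z\<bar> ^ 3" using U abs_ov_le[of z] by (intro power_decreasing) (auto simp: P3_def)
      finally show "ov z ^ card U \<le> \<bar>ov z\<bar> ^ 3" .
    qed
    finally show "(\<Sum>c\<in>constraints k n. mean U c ^ 2) \<le> N * m3" .
  next
    fix z assume z: "z \<in> P2"
    have "(\<Sum>c\<in>constraints k n. mean (fst z) c ^ 2 * mean (snd z) c ^ 2) \<le> N * (pavg (\<lambda>z. ov z ^ 2) * pavg (\<lambda>z. \<bar>ov z\<bar>))"
      unfolding N_def using z by (intro sum_mean_sq_pair) (auto simp: P2_def P_def)
    also have "\<dots> \<le> N * m3" unfolding m3_def using pavg_cube_ge N0 by (intro mult_left_mono)
    finally show "(\<Sum>c\<in>constraints k n. mean (fst z) c ^ 2 * mean (snd z) c ^ 2) \<le> N * m3" .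
  next
    fix z assume z: "z \<in> P1"
    have "(\<Sum>c\<in>constraints k n. mean {fst z} c ^ 2 * mean {snd z} c ^ 2) = N * pavg ov ^ 2"
      unfolding N_def using z by (intro sum_mean_single) (auto simp: P1_def)
    also have "\<dots> \<le> N * (\<delta> * pavg ov + m3 / \<delta>)"
      unfolding m3_def using pavg_ov_sq_le[OF \<delta>] N0 by (intro mult_left_mono)
    finally show "(\<Sum>c\<in>constraints k n. mean {fst z} c ^ 2 * mean {snd z} c ^ 2) \<le> N * (\<delta> * pavg ov + m3 / \<delta>)" .
  qed auto
  also have "\<dots> \<le> 2 ^ k * (N * m3 / \<eta>^2) + 4 ^ k * (N * m3 / \<eta>^4) + (real k)^2 * (N * (\<delta> * pavg ov + m3 / \<delta>) / \<eta>1^4)"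
  proof -
    have "card P3 \<le> card P" by (intro card_mono fin) (auto simp: P3_def)
    hence c3: "real (card P3) \<le> 2 ^ k" by (simp add: P_def card_Pow)
    have "card P2 \<le> card (P \<times> P)" by (intro card_mono finite_cartesian_product fin) (auto simp: P2_def)
    hence "card P2 \<le> 2 ^ k * 2 ^ k" by (simp add: P_def card_Pow card_cartesian_product)
    also have "\<dots> = (4::nat) ^ k" by (simp flip: power_mult_distrib)
    finally have c2: "real (card P2) \<le> 4 ^ k" by (metis of_nat_le_iff of_nat_numeral of_nat_power)
    have "card P1 \<le> card ({..<k} \<times> {..<k})" by (intro card_mono) (auto simp: P1_def)
    hence "card P1 \<le> k * k" by (simp add: card_cartesian_product)
    hence c1: "real (card P1) \<le> (real k)^2" by (metis of_nat_le_iff of_nat_mult power2_eq_square)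
    have "0 \<le> N * (\<delta> * pavg ov + m3 / \<delta>) / \<eta>1^4" using N0 m30 pavg_ov_nonneg \<delta> by simp
    moreover have "0 \<le> N * m3 / \<eta>^2" "0 \<le> N * m3 / \<eta>^4" using N0 m30 by auto
    ultimately show ?thesis using c1 c2 c3 by (simp only: sum_constant) (intro add_mono mult_right_mono)
  qed
  also have "\<dots> \<le> N * ((2 ^ k / \<eta>^2 + 4 ^ k / \<eta>^4 + (real k)^2 / \<eta>1^4) * ((1 + 1 / \<delta>) * m3 + \<delta> * pavg ov))"
  proof -
    define X where "X = (1 + 1 / \<delta>) * m3 + \<delta> * pavg ov"
    have dp: "0 \<le> \<delta> * pavg ov" "0 \<le> m3 / \<delta>" using pavg_ov_nonneg \<delta> m30 by auto
    have x1: "m3 \<le> X" "\<delta> * pavg ov + m3 / \<delta> \<le> X" using dp m30 by (auto simp: X_def distrib_right)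
    have "2 ^ k * (N * m3 / \<eta>^2) \<le> 2 ^ k * (N * X / \<eta>^2)"
      using x1 N0 by (intro mult_left_mono divide_right_mono) auto
    moreover have "4 ^ k * (N * m3 / \<eta>^4) \<le> 4 ^ k * (N * X / \<eta>^4)"
      using x1 N0 by (intro mult_left_mono divide_right_mono) auto
    moreover have "(real k)^2 * (N * (\<delta> * pavg ov + m3 / \<delta>) / \<eta>1^4) \<le> (real k)^2 * (N * X / \<eta>1^4)"
      using x1 N0 by (intro mult_left_mono divide_right_mono) auto
    moreover have "2 ^ k * (N * X / \<eta>^2) + 4 ^ k * (N * X / \<eta>^4) + (real k)^2 * (N * X / \<eta>1^4)
        = N * ((2 ^ k / \<eta>^2 + 4 ^ k / \<eta>^4 + (real k)^2 / \<eta>1^4) * X)"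
      by (simp add: distrib_left distrib_right mult_ac)
    ultimately show ?thesis unfolding X_def[symmetric] by linarith
  qed
  finally show ?thesis by (simp add: N_def m3_def)
qed

end

end

section \<open>The process of exposing constraints\<close>

text \<open>Every candidate solution satisfies the same fraction \<open>q\<close> of the
  constraints; this makes \<open>ratio\<close> a martingale. Balanced assignments are put in
  later.\<close>

locale csp =
  fixes C :: "'c set" and S :: "'s set" and sat :: "'s \<Rightarrow> 'c \<Rightarrow> bool" and q :: real
  assumes finite_C: "finite C" and C_ne: "C \<noteq> {}"
    and finite_S: "finite S" and S_ne: "S \<noteq> {}"
    and q_pos: "0 < q" and q_le_1: "q \<le> 1"
    and card_sat: "\<And>\<sigma>. \<sigma> \<in> S \<Longrightarrow> real (card {c\<in>C. sat \<sigma> c}) = q * real (card C)"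
begin

definition sols :: "'c list \<Rightarrow> 's set" where
  "sols F = {\<sigma>\<in>S. \<forall>c\<in>set F. sat \<sigma> c}"

definition lists_of :: "nat \<Rightarrow> 'c list set" where
  "lists_of t = {F. set F \<subseteq> C \<and> length F = t}"

definition expect :: "nat \<Rightarrow> ('c list \<Rightarrow> real) \<Rightarrow> real" where
  "expect t f = (\<Sum>F\<in>lists_of t. f F) / real (card C) ^ t"

definition avg :: "('c \<Rightarrow> real) \<Rightarrow> real" where
  "avg f = (\<Sum>c\<in>C. f c) / real (card C)"

definition ratio :: "'c list \<Rightarrow> real" where
  "ratio F = real (card (sols F)) / (real (card S) * q ^ length F)"

definition corr :: "'s \<Rightarrow> 's \<Rightarrow> real" where
  "corr \<sigma> \<tau> = real (card {c\<in>C. sat \<sigma> c \<and> sat \<tau> c}) / (real (card C) * q^2)"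

definition pairwt :: "('s \<Rightarrow> 's \<Rightarrow> real) \<Rightarrow> 'c list \<Rightarrow> real" where
  "pairwt g F = (\<Sum>\<sigma>\<in>sols F. \<Sum>\<tau>\<in>sols F. g \<sigma> \<tau>) / (real (card S) ^ 2 * q ^ (2 * length F))"

text \<open>The conditional expectation, given \<open>F\<close>, of the squared \<open>ratio\<close>
  after \<open>j\<close> more constraints, as \<open>avg_moment_Cons\<close> and
  \<open>pairwt_1\<close> show.\<close>

definition moment :: "nat \<Rightarrow> 'c list \<Rightarrow> real" where
  "moment j F = pairwt (\<lambda>\<sigma> \<tau>. corr \<sigma> \<tau> ^ j) F"

definition bad_frac :: "real \<Rightarrow> 'c list \<Rightarrow> real" where
  "bad_frac b F = avg (\<lambda>c. of_bool (ratio (c # F) < b * ratio F))"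

lemma card_C_pos: "0 < real (card C)" and card_S_pos: "0 < real (card S)"
  using finite_C C_ne finite_S S_ne by (auto simp: card_gt_0_iff)

lemma finite_sols [simp]: "finite (sols F)"
  using finite_S by (simp add: sols_def)

lemma finite_lists_of [simp]: "finite (lists_of t)"
  unfolding lists_of_def using finite_lists_length_eq[OF finite_C] .

lemma sols_Cons: "sols (c # F) = {\<sigma>\<in>sols F. sat \<sigma> c}"
  by (auto simp: sols_def)

lemma sols_Nil [simp]: "sols [] = S"
  by (simp add: sols_def)

lemma lists_of_0: "lists_of 0 = {[]}"
  by (auto simp: lists_of_def)

lemma sum_lists_of_Suc: "(\<Sum>F\<in>lists_of (Suc t). f F) = (\<Sum>F\<in>lists_of t. \<Sum>c\<in>C. f (c # F))"
proof -
  have "lists_of (Suc t) = (\<lambda>(F, c). c # F) ` (lists_of t \<times> C)"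
    by (force simp: lists_of_def length_Suc_conv image_iff)
  moreover have "inj_on (\<lambda>(F, c). c # F) (lists_of t \<times> C)"
    by (auto simp: inj_on_def)
  ultimately have "(\<Sum>F\<in>lists_of (Suc t). f F) = (\<Sum>(F, c)\<in>lists_of t \<times> C. f (c # F))"
    by (simp add: sum.reindex case_prod_unfold)
  thus ?thesis by (simp add: sum.cartesian_product)
qed

lemma expect_0 [simp]: "expect 0 f = f []"
  by (simp add: expect_def lists_of_0)

lemma expect_Suc: "expect (Suc t) f = expect t (\<lambda>F. avg (\<lambda>c. f (c # F)))"
  by (simp add: expect_def avg_def sum_lists_of_Suc sum_divide_distrib mult.commute)

lemma expect_mono:
  "(\<And>F. F \<in> lists_of t \<Longrightarrow> f F \<le> g F) \<Longrightarrow> expect t f \<le> expect t g"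
  unfolding expect_def by (intro divide_right_mono sum_mono) auto

lemma expect_add: "expect t (\<lambda>F. f F + g F) = expect t f + expect t g"
  by (simp add: expect_def sum.distrib add_divide_distrib)

lemma expect_cmult: "expect t (\<lambda>F. c * f F) = c * expect t f"
  by (simp add: expect_def sum_distrib_left)

lemma avg_mono: "(\<And>c. c \<in> C \<Longrightarrow> f c \<le> g c) \<Longrightarrow> avg f \<le> avg g"
  unfolding avg_def by (intro divide_right_mono sum_mono) auto

lemma avg_add: "avg (\<lambda>F. f F + g F) = avg f + avg g"
  by (simp add: avg_def sum.distrib add_divide_distrib)

lemma avg_cmult: "avg (\<lambda>F. c * f F) = c * avg f"
  by (simp add: avg_def sum_distrib_left)

lemma avg_const [simp]: "avg (\<lambda>F. c) = c"
  using card_C_pos by (simp add: avg_def)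

lemma avg_nonneg: "(\<And>c. c \<in> C \<Longrightarrow> 0 \<le> f c) \<Longrightarrow> 0 \<le> avg f"
  unfolding avg_def by (intro divide_nonneg_nonneg sum_nonneg) auto

lemma sum_filter_of_bool:
  "finite A \<Longrightarrow> (\<Sum>x\<in>{x\<in>A. P x}. f x) = (\<Sum>x\<in>A. of_bool (P x) * (f x :: real))"
proof -
  assume A: "finite A"
  have "(\<Sum>x\<in>{x\<in>A. P x}. f x) = (\<Sum>x\<in>A. if P x then f x else 0)"
    by (rule sum.inter_filter[OF A])
  also have "\<dots> = (\<Sum>x\<in>A. of_bool (P x) * f x)" by (rule sum.cong) auto
  finally show ?thesis .
qed

lemma card_filter_of_bool:
  "finite A \<Longrightarrow> real (card {x\<in>A. P x}) = (\<Sum>x\<in>A. of_bool (P x))"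
  using sum_filter_of_bool[where f="\<lambda>_. 1"] by (simp only: real_of_card mult_1_right)

lemma avg_ratio_Cons: "avg (\<lambda>c. ratio (c # F)) = ratio F"
proof -
  have "(\<Sum>c\<in>C. real (card (sols (c # F)))) = (\<Sum>c\<in>C. \<Sum>\<sigma>\<in>sols F. of_bool (sat \<sigma> c))"
    by (simp add: sols_Cons card_filter_of_bool)
  also have "\<dots> = (\<Sum>\<sigma>\<in>sols F. \<Sum>c\<in>C. of_bool (sat \<sigma> c))"
    by (rule sum.swap)
  also have "\<dots> = (\<Sum>\<sigma>\<in>sols F. q * real (card C))"
    by (intro sum.cong refl) (auto simp: card_sat sols_def card_filter_of_bool[OF finite_C, symmetric])
  finally have "(\<Sum>c\<in>C. real (card (sols (c # F)))) = real (card (sols F)) * (q * real (card C))"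
    by simp
  thus ?thesis
    using card_C_pos card_S_pos q_pos
    by (simp add: avg_def ratio_def sum_divide_distrib[symmetric] field_simps)
qed

lemma avg_pairwt_Cons: "avg (\<lambda>c. pairwt g (c # F)) = pairwt (\<lambda>\<sigma> \<tau>. g \<sigma> \<tau> * corr \<sigma> \<tau>) F"
proof -
  have "(\<Sum>c\<in>C. \<Sum>\<sigma>\<in>sols (c # F). \<Sum>\<tau>\<in>sols (c # F). g \<sigma> \<tau>)
      = (\<Sum>c\<in>C. \<Sum>\<sigma>\<in>sols F. \<Sum>\<tau>\<in>sols F. of_bool (sat \<sigma> c \<and> sat \<tau> c) * g \<sigma> \<tau>)"
    by (simp only: sols_Cons sum_filter_of_bool[OF finite_sols] sum_distrib_left of_bool_conj mult.assoc)
  also have "\<dots> = (\<Sum>\<sigma>\<in>sols F. \<Sum>c\<in>C. \<Sum>\<tau>\<in>sols F. of_bool (sat \<sigma> c \<and> sat \<tau> c) * g \<sigma> \<tau>)"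
    by (rule sum.swap)
  also have "\<dots> = (\<Sum>\<sigma>\<in>sols F. \<Sum>\<tau>\<in>sols F. \<Sum>c\<in>C. of_bool (sat \<sigma> c \<and> sat \<tau> c) * g \<sigma> \<tau>)"
    by (intro sum.cong refl) (rule sum.swap)
  also have "\<dots> = (\<Sum>\<sigma>\<in>sols F. \<Sum>\<tau>\<in>sols F. g \<sigma> \<tau> * corr \<sigma> \<tau> * (real (card C) * q^2))"
  proof (intro sum.cong refl)
    fix \<sigma> \<tau>
    show "(\<Sum>c\<in>C. of_bool (sat \<sigma> c \<and> sat \<tau> c) * g \<sigma> \<tau>) = g \<sigma> \<tau> * corr \<sigma> \<tau> * (real (card C) * q^2)"
    proof -
      have "corr \<sigma> \<tau> * (real (card C) * q^2) = (\<Sum>c\<in>C. of_bool (sat \<sigma> c \<and> sat \<tau> c))"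
        using card_C_pos q_pos by (simp add: corr_def card_filter_of_bool[OF finite_C])
      thus ?thesis by (simp only: sum_distrib_right[symmetric] mult.assoc) (simp only: mult.commute)
    qed
  qed
  also have "\<dots> = (\<Sum>\<sigma>\<in>sols F. \<Sum>\<tau>\<in>sols F. g \<sigma> \<tau> * corr \<sigma> \<tau>) * (real (card C) * q^2)"
    by (simp add: sum_distrib_right)
  finally show ?thesis
    using card_C_pos card_S_pos q_pos
    by (simp add: avg_def pairwt_def sum_divide_distrib[symmetric] field_simps power2_eq_square)
qed

text \<open>Each independent constraint contributes one factor \<open>corr\<close> for every fixed
  pair, so expectations at time \<open>t\<close> reduce to a sum over all pairs in
  \<open>S\<close>.\<close>

lemma expect_pairwt: "expect t (pairwt g) = pairwt (\<lambda>\<sigma> \<tau>. g \<sigma> \<tau> * corr \<sigma> \<tau> ^ t) []"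
proof (induction t arbitrary: g)
  case (Suc t)
  have "expect (Suc t) (pairwt g) = expect t (pairwt (\<lambda>\<sigma> \<tau>. g \<sigma> \<tau> * corr \<sigma> \<tau>))"
    by (simp add: expect_Suc avg_pairwt_Cons)
  thus ?case using Suc by (simp add: mult.assoc)
qed simp

lemma ratio_Nil [simp]: "ratio [] = 1"
  using card_S_pos by (simp add: ratio_def)

lemma pairwt_1: "pairwt (\<lambda>_ _. 1) F = ratio F ^ 2"
  by (simp add: pairwt_def ratio_def power_divide power_mult_distrib power_even_eq)
    (simp add: power2_eq_square)

lemma avg_moment_Cons: "avg (\<lambda>c. moment j (c # F)) = moment (Suc j) F"
  unfolding moment_def by (simp add: avg_pairwt_Cons mult.commute)

lemma corr_nonneg: "0 \<le> corr \<sigma> \<tau>"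
  using q_pos by (simp add: corr_def)

lemma moment_nonneg: "0 \<le> moment j F"
  unfolding moment_def pairwt_def using corr_nonneg q_pos
  by (intro divide_nonneg_nonneg sum_nonneg) auto

lemma pairwt_mono_sols:
  assumes "x * real (card (sols F)) ^ 2 \<le> (\<Sum>\<sigma>\<in>sols F. \<Sum>\<tau>\<in>sols F. g \<sigma> \<tau>)"
  shows "x * ratio F ^ 2 \<le> pairwt g F"
proof -
  have "x * ratio F ^ 2 = (x * real (card (sols F)) ^ 2) / (real (card S) ^ 2 * q ^ (2 * length F))"
    by (simp add: ratio_def power_divide power_mult_distrib power_even_eq)
  also have "\<dots> \<le> pairwt g F"
    unfolding pairwt_def using assms q_pos by (intro divide_right_mono) auto
  finally show ?thesis .
qed

lemma power_ge_tangent: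
  fixes x m :: real
  assumes "0 < m" "0 \<le> x" "0 < j"
  shows "m ^ j + real j * m ^ (j - 1) * (x - m) \<le> x ^ j"
proof -
  have "1 + real j * (x / m - 1) \<le> (1 + (x / m - 1)) ^ j"
    using assms by (intro Bernoulli_inequality) auto
  hence "m ^ j * (1 + real j * (x / m - 1)) \<le> m ^ j * (x / m) ^ j"
    using assms by (intro mult_left_mono) auto
  moreover have "m ^ j * (x / m) ^ j = x ^ j"
    using assms by (simp add: power_divide)
  moreover have "m ^ j = m * m ^ (j - 1)"
    using assms by (cases j) auto
  hence "m ^ j * (1 + real j * (x / m - 1)) = m ^ j + real j * m ^ (j - 1) * (x - m)"
    using assms by (simp add: field_simps)
  ultimately show ?thesis by simp
qed

text \<open>Jensen's inequality for the \<open>j\<close>-th power under the pair weights, with the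
  tangent taken at the mean \<open>m\<close> of \<open>corr\<close>.\<close>

lemma moment_ge_power:
  assumes pos: "0 < ratio F" and m: "moment 1 F = m * ratio F ^ 2" and "0 < m"
  shows "m ^ j * ratio F ^ 2 \<le> moment j F"
proof (cases "j = 0")
  case True
  thus ?thesis by (simp add: moment_def pairwt_1)
next
  case False
  define D where "D = real (card S) ^ 2 * q ^ (2 * length F)"
  have D: "D > 0" using card_S_pos q_pos by (simp add: D_def)
  have lin: "pairwt (\<lambda>\<sigma> \<tau>. a + d * (g \<sigma> \<tau>)) F = a * ratio F ^ 2 + d * pairwt g F" for a d g
    unfolding pairwt_1[symmetric] unfolding pairwt_def
    by (simp add: sum.distrib sum_distrib_left[symmetric] add_divide_distrib)
  have "m ^ j * ratio F ^ 2 = pairwt (\<lambda>\<sigma> \<tau>. (m ^ j - real j * m ^ (j - 1) * m) + real j * m ^ (j - 1) * corr \<sigma> \<tau>) F"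
    using m unfolding lin by (simp add: moment_def algebra_simps)
  also have "\<dots> = pairwt (\<lambda>\<sigma> \<tau>. m ^ j + real j * m ^ (j - 1) * (corr \<sigma> \<tau> - m)) F"
    by (simp add: algebra_simps)
  also have "\<dots> \<le> moment j F"
    unfolding moment_def pairwt_def using power_ge_tangent[OF \<open>0 < m\<close> corr_nonneg] False q_pos
    by (intro divide_right_mono sum_mono) auto
  finally show ?thesis .
qed

lemma ratio_Cons_le: "ratio (c # F) \<le> ratio F / q"
proof -
  have "card (sols (c # F)) \<le> card (sols F)"
    by (intro card_mono) (auto simp: sols_Cons)
  thus ?thesis using q_pos card_S_pos by (simp add: ratio_def field_simps)
qed

lemma moment_1_eq: "moment 1 F = avg (\<lambda>c. ratio (c # F) ^ 2)"
  using avg_moment_Cons[of 0 F] by (simp add: moment_def pairwt_1)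

section \<open>The stopped process and its potential\<close>

context
  fixes M m J :: nat and R B b :: real
  assumes J: "0 < J" "m + J \<le> M" and R: "1 / q^2 \<le> R" "moment M [] \<le> R"
    and B: "ln R \<le> B" "2 * B \<le> real J" and b: "0 < b" "b < 1"
begin

text \<open>The stopping rule: no constraint may remove all but a fraction \<open>b q\<close> of the solutions, the conditional
second moment of the final ratio stays below \<open>R\<close>, and the ratio itself stays above \<open>R exp (-B)\<close>.\<close>

primrec good :: "'c list \<Rightarrow> bool" where
  "good [] \<longleftrightarrow> True"
| "good (c # F) \<longleftrightarrow> good F \<and> b * ratio F \<le> ratio (c # F)
     \<and> moment (M - Suc (length F)) (c # F) \<le> R \<and> ln R - ln (ratio (c # F)) \<le> B"

lemma R_ge_1: "1 \<le> R"
proof -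
  have "1 \<le> 1 / q^2" using q_pos q_le_1 by (simp add: power_le_one)
  thus ?thesis using R by linarith
qed

lemma good_imp:
  assumes "good F"
  shows "0 < ratio F" "moment (M - length F) F \<le> R" "ln R - ln (ratio F) \<le> B"
    "R * exp (- B) \<le> ratio F"
proof -
  have 1: "0 < ratio F \<and> moment (M - length F) F \<le> R \<and> ln R - ln (ratio F) \<le> B"
    using assms
  proof (induction F)
    case Nil
    thus ?case using R B by simp
  next
    case (Cons c F)
    hence "0 < b * ratio F" using b by simp
    thus ?case using Cons by auto
  qed
  have "R * exp (- B) \<le> R * exp (ln (ratio F) - ln R)"
    using 1 R_ge_1 by (intro mult_left_mono) auto
  also have "\<dots> = ratio F" using 1 R_ge_1 by (simp add: exp_diff)
  finally show "R * exp (- B) \<le> ratio F" .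
  show "0 < ratio F" "moment (M - length F) F \<le> R" "ln R - ln (ratio F) \<le> B" using 1 by auto
qed

text \<open>The conditional second moment dominates the squared ratio, so the ratio is at most
  \<open>sqrt R\<close>; one more constraint gains a factor of at most
  \<open>1 / q \<le> sqrt R\<close>. Hence \<open>psi\<close> is nonnegative even on a step that
  leaves the good set with positive ratio.\<close>

lemma good_ratio_le:
  assumes "good F"
  shows "ln (ratio F) \<le> ln R / 2"
    and "\<And>c. 0 < ratio (c # F) \<Longrightarrow> ln (ratio (c # F)) \<le> ln R"
proof -
  note g = good_imp[OF assms]
  have m1: "ratio F ^ 2 \<le> moment 1 F"
  proof -
    have "0 \<le> avg (\<lambda>c. (ratio (c # F) - ratio F) ^ 2)" by (intro avg_nonneg) auto
    also have "\<dots> = avg (\<lambda>c. ratio (c # F) ^ 2 + ((- 2 * ratio F) * ratio (c # F) + ratio F ^ 2))"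
      by (intro arg_cong[where f=avg] ext) (simp add: power2_eq_square algebra_simps)
    also have "\<dots> = moment 1 F - ratio F ^ 2"
      by (simp only: avg_add avg_cmult avg_ratio_Cons avg_const moment_1_eq) (simp add: power2_eq_square)
    finally show ?thesis by simp
  qed
  define v where "v = moment 1 F / ratio F ^ 2"
  have v: "1 \<le> v" "moment 1 F = v * ratio F ^ 2"
    using m1 g(1) by (auto simp: v_def field_simps)
  have "ratio F ^ 2 \<le> v ^ (M - length F) * ratio F ^ 2"
    using v one_le_power[of v "M - length F"] mult_right_mono[of 1 "v ^ (M - length F)" "ratio F ^ 2"] by simp
  also have "\<dots> \<le> R"
    using moment_ge_power[OF g(1) v(2)] v(1) g(2) by (meson le_trans less_le_trans order.trans zero_less_one)
  finally have "ln (ratio F ^ 2) \<le> ln R" using g(1) R_ge_1 by (subst ln_le_cancel_iff) auto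
  thus *: "ln (ratio F) \<le> ln R / 2" using g(1) by (simp add: ln_realpow)
  fix c assume pos: "0 < ratio (c # F)"
  have "ln (ratio (c # F)) \<le> ln (ratio F / q)"
    using ratio_Cons_le pos q_pos g(1) by (subst ln_le_cancel_iff) auto
  also have "\<dots> = ln (ratio F) - ln q" using g(1) q_pos by (simp add: ln_div)
  finally have "ln (ratio (c # F)) \<le> ln (ratio F) - ln q" .
  moreover have "- ln q \<le> ln R / 2"
  proof -
    have "ln (1 / q^2) \<le> ln R" using R q_pos R_ge_1 by (subst ln_le_cancel_iff) auto
    thus ?thesis using q_pos by (simp add: ln_div ln_realpow)
  qed
  ultimately show "ln (ratio (c # F)) \<le> ln R" using * by linarith
qed

definition psi :: "'c list \<Rightarrow> real" where "psi F = ln R - ln (ratio F)"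

lemma psi_nonneg: "good F \<Longrightarrow> 0 \<le> psi F"
  using good_ratio_le(1)[of F] ln_ge_zero[OF R_ge_1] by (simp add: psi_def)

text \<open>Jensen over at least \<open>J\<close> remaining steps gives \<open>(1 + V)^J\<close>
  times the squared ratio at most \<open>R\<close>, hence \<open>ln (1 + V) \<le> 2 psi / J\<close>.
  By \<open>2 B \<le> J\<close> this exponent is at most \<open>1\<close>, where
  \<open>exp z \<le> 1 + 2 z\<close>.\<close>

lemma second_moment_step:
  assumes "good F" "length F < m"
  shows "avg (\<lambda>c. (ratio (c # F) / ratio F - 1) ^ 2) \<le> 4 * psi F / real J"
proof -
  note g = good_imp[OF assms(1)]
  define V where "V = avg (\<lambda>c. (ratio (c # F) / ratio F - 1) ^ 2)"
  have V0: "0 \<le> V" unfolding V_def by (intro avg_nonneg) auto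
  have "V = avg (\<lambda>c. (1 / ratio F ^ 2) * ratio (c # F) ^ 2 + ((- 2 / ratio F) * ratio (c # F) + 1))"
    unfolding V_def using g(1)
    by (intro arg_cong[where f=avg] ext) (simp add: power2_eq_square field_simps)
  also have "\<dots> = moment 1 F / ratio F ^ 2 - 1"
    using g(1) by (simp only: avg_add avg_cmult avg_ratio_Cons avg_const moment_1_eq) simp
  finally have m: "moment 1 F = (1 + V) * ratio F ^ 2"
    using g(1) by (simp add: field_simps)
  have j: "J \<le> M - length F" using J assms(2) by simp
  have "(1 + V) ^ J * ratio F ^ 2 \<le> (1 + V) ^ (M - length F) * ratio F ^ 2"
    using V0 j by (intro mult_right_mono power_increasing) auto
  also have "\<dots> \<le> moment (M - length F) F"
    using moment_ge_power[OF g(1) m] V0 by simp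
  finally have "(1 + V) ^ J * ratio F ^ 2 \<le> R" using g(2) by linarith
  hence "ln ((1 + V) ^ J * ratio F ^ 2) \<le> ln R"
    using V0 g(1) R_ge_1 by (subst ln_le_cancel_iff) auto
  hence "real J * ln (1 + V) + 2 * ln (ratio F) \<le> ln R"
    using V0 g(1) by (simp add: ln_mult ln_realpow)
  hence "real J * ln (1 + V) \<le> 2 * psi F"
    using ln_ge_zero[OF R_ge_1] by (simp add: psi_def)
  hence l: "ln (1 + V) \<le> 2 * psi F / real J" using J by (simp add: field_simps)
  define z where "z = 2 * psi F / real J"
  have "z \<le> 1" "0 \<le> z" using B(2) g(3) J psi_nonneg[OF assms(1)] by (auto simp: z_def psi_def field_simps)
  have "1 + V \<le> exp z" using l V0 by (metis add_pos_nonneg exp_le_cancel_iff exp_ln zero_less_one z_def)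
  also have "\<dots> \<le> 1 + z + z^2" using \<open>z \<le> 1\<close> \<open>0 \<le> z\<close> by (rule exp_bound[rotated])
  also have "\<dots> \<le> 1 + 2 * z" using \<open>z \<le> 1\<close> \<open>0 \<le> z\<close> by (simp add: power2_eq_square mult_left_le)
  finally show ?thesis unfolding V_def[symmetric] by (simp add: z_def)
qed

lemma ln_ge_quadratic:
  fixes x :: real
  assumes "b \<le> 1 + x"
  shows "- ln (1 + x) \<le> - x + x^2 / b"
proof -
  have "- ln (1 + x) = ln (1 / (1 + x))" using assms b by (simp add: ln_div)
  also have "\<dots> \<le> 1 / (1 + x) - 1" using assms b by (intro ln_le_minus_one) auto
  also have "\<dots> = - x + x^2 / (1 + x)" using assms b by (simp add: field_simps power2_eq_square)
  also have "x^2 / (1 + x) \<le> x^2 / b" using assms b by (intro divide_left_mono) auto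
  finally show ?thesis by simp
qed

text \<open>The linear term of the logarithm averages to \<open>0\<close> by the martingale
  property, and discarding bad constraints keeps the remainder below \<open>y^2 / b\<close>. For a
  discarded constraint the pointwise bound is still nonnegative, as then
  \<open>y \<le> 0\<close>.\<close>

lemma psi_drift:
  assumes "good F" "length F < m"
  shows "avg (\<lambda>c. of_bool (b * ratio F \<le> ratio (c # F)) * psi (c # F)) \<le> (1 + 4 / (b * real J)) * psi F"
proof -
  note g = good_imp[OF assms(1)]
  define y where "y c = ratio (c # F) / ratio F - 1" for c
  define ok where "ok c \<longleftrightarrow> b * ratio F \<le> ratio (c # F)" for c
  have y0: "avg y = 0"
    using g(1) avg_add[of "\<lambda>c. (1 / ratio F) * ratio (c # F)" "\<lambda>_. -1"] avg_cmult[of "1 / ratio F" "\<lambda>c. ratio (c # F)"]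
    by (simp add: y_def[abs_def] avg_ratio_Cons)
  have pt: "of_bool (ok c) * psi (c # F) \<le> psi F + (- 1 * y c + (1 / b) * y c ^ 2)" for c
  proof (cases "ok c")
    case True
    have "0 < ratio (c # F)" using True g(1) b
      by (metis ok_def mult_pos_pos order_less_le_trans)
    hence "ln (1 + y c) = ln (ratio (c # F)) - ln (ratio F)"
      using g(1) by (simp add: y_def ln_div)
    hence "psi (c # F) = psi F - ln (1 + y c)" by (simp add: psi_def)
    moreover have "b \<le> 1 + y c" using True g(1) by (simp add: ok_def y_def field_simps)
    ultimately show ?thesis using True ln_ge_quadratic[of "y c"] by simp
  next
    case False
    have "y c \<le> 0" using False g(1) b
      by (simp add: ok_def y_def field_simps) (smt (verit) mult_less_cancel_right2)
    moreover have "0 \<le> (1 / b) * y c ^ 2" using b by simp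
    ultimately show ?thesis using psi_nonneg[OF assms(1)] False by simp
  qed
  have "avg (\<lambda>c. of_bool (ok c) * psi (c # F)) \<le> avg (\<lambda>c. psi F + (- 1 * y c + (1 / b) * y c ^ 2))"
    by (intro avg_mono pt)
  also have "\<dots> = psi F + (1 / b) * avg (\<lambda>c. y c ^ 2)"
    by (simp only: avg_add avg_cmult avg_const y0)
  also have "\<dots> \<le> psi F + (1 / b) * (4 * psi F / real J)"
    using second_moment_step[OF assms] b by (intro add_left_mono mult_left_mono) (auto simp: y_def)
  finally show ?thesis by (simp add: ok_def algebra_simps)
qed

text \<open>Every way of violating \<open>good\<close> other than by a bad constraint is paid for by one of the two
(super)martingale-like terms, as \<open>psi\<close> is nonnegative on good instances.\<close>

definition potential :: "nat \<Rightarrow> real" where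
  "potential t = expect t (\<lambda>F. of_bool (\<not> good F) + (1/R) * (of_bool (good F) * moment (M - t) F)
      + (1/B) * (of_bool (good F) * psi F))"

lemma avg_step:
  assumes "good F" "length F < m" and "0 < B"
  shows "avg (\<lambda>c. of_bool (\<not> good (c # F)) + (1/R) * (of_bool (good (c # F)) * moment (M - Suc (length F)) (c # F))
      + (1/B) * (of_bool (good (c # F)) * psi (c # F)))
    \<le> bad_frac b F + (1/R) * moment (M - length F) F + (1/B) * ((1 + 4 / (b * real J)) * psi F)"
proof -
  note g = good_imp[OF assms(1)]
  define ok where "ok c \<longleftrightarrow> b * ratio F \<le> ratio (c # F)" for c
  have pt: "of_bool (\<not> good (c # F)) + (1/R) * (of_bool (good (c # F)) * moment (M - Suc (length F)) (c # F))
      + (1/B) * (of_bool (good (c # F)) * psi (c # F))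
    \<le> of_bool (\<not> ok c) + (1/R) * moment (M - Suc (length F)) (c # F) + (1/B) * (of_bool (ok c) * psi (c # F))"
    for c
  proof -
    have mom0: "0 \<le> moment (M - Suc (length F)) (c # F) / R" using moment_nonneg R_ge_1 by simp
    have psi0: "0 \<le> psi (c # F) / B" if "ok c"
    proof -
      have "0 < ratio (c # F)" using that g(1) b by (metis ok_def mult_pos_pos order_less_le_trans)
      thus ?thesis using good_ratio_le(2)[OF assms(1)] assms(3) by (simp add: psi_def)
    qed
    consider "good (c # F)" | "\<not> ok c" | "ok c" "\<not> moment (M - Suc (length F)) (c # F) \<le> R"
      | "ok c" "\<not> psi (c # F) \<le> B"
      using assms(1) by (auto simp: ok_def psi_def)
    thus ?thesis
    proof cases
      case 1
      thus ?thesis by (auto simp: ok_def)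
    next
      case 2
      hence "\<not> good (c # F)" by (auto simp: ok_def)
      thus ?thesis using 2 mom0 by (simp del: good.simps)
    next
      case 3
      hence "\<not> good (c # F)" by auto
      moreover have "1 \<le> moment (M - Suc (length F)) (c # F) / R" using 3 R_ge_1 by simp
      ultimately show ?thesis using 3 psi0 by (simp del: good.simps)
    next
      case 4
      hence "\<not> good (c # F)" by (auto simp: psi_def)
      moreover have "1 \<le> psi (c # F) / B" using 4 assms(3) by simp
      ultimately show ?thesis using 4 mom0 by (simp del: good.simps)
    qed
  qed
  have "avg (\<lambda>c. of_bool (\<not> ok c) + (1/R) * moment (M - Suc (length F)) (c # F) + (1/B) * (of_bool (ok c) * psi (c # F)))
    = bad_frac b F + (1/R) * moment (M - length F) F + (1/B) * avg (\<lambda>c. of_bool (ok c) * psi (c # F))"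
  proof -
    have "Suc (M - Suc (length F)) = M - length F" using assms(2) J by simp
    thus ?thesis
      by (simp only: avg_add avg_cmult avg_moment_Cons) (simp add: bad_frac_def ok_def not_le)
  qed
  also have "\<dots> \<le> bad_frac b F + (1/R) * moment (M - length F) F + (1/B) * ((1 + 4 / (b * real J)) * psi F)"
    using psi_drift[OF assms(1,2)] assms(3) by (intro add_left_mono mult_left_mono) (auto simp: ok_def)
  finally show ?thesis using avg_mono[OF pt] by (meson order.trans)
qed

text \<open>The three terms bound three ways to fail: the conditional second moment exceeds
  \<open>R\<close>, \<open>psi\<close> exceeds \<open>B\<close>, or a bad constraint appears. On
  good instances the ratio is at least \<open>R exp (-B)\<close>, so \<open>bad_frac\<close> is
  below a multiple of \<open>pairwt g\<close>, whose expectation no longer involves the stopping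
  rule.\<close>

lemma unsat_bound:
  fixes g :: "'s \<Rightarrow> 's \<Rightarrow> real" and \<epsilon> :: real
  assumes "0 < B"
    and bad: "\<And>F. sols F \<noteq> {} \<Longrightarrow>
      bad_frac b F * real (card (sols F)) ^ 2 \<le> (\<Sum>\<sigma>\<in>sols F. \<Sum>\<tau>\<in>sols F. g \<sigma> \<tau>)"
    and eps: "\<And>t. t < m \<Longrightarrow> pairwt (\<lambda>\<sigma> \<tau>. g \<sigma> \<tau> * corr \<sigma> \<tau> ^ t) [] \<le> \<epsilon>"
  shows "expect m (\<lambda>F. of_bool (sols F = {}))
    \<le> moment M [] / R + ln R * (1 + 4 / (b * real J)) ^ m / B + real m * (\<epsilon> / (R * exp (- B))^2)"
proof -
  define \<kappa> where "\<kappa> = 4 / (b * real J)"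
  define l where "l = R * exp (- B)"
  have l: "0 < l" using R_ge_1 by (simp add: l_def)
  have \<kappa>: "0 \<le> \<kappa>" using b by (simp add: \<kappa>_def)
  have bad0: "0 \<le> bad_frac b F" for F unfolding bad_frac_def by (intro avg_nonneg) auto
  have bad1: "of_bool (good F) * bad_frac b F \<le> (1 / l^2) * pairwt g F" for F
  proof -
    have "0 \<le> bad_frac b F * ratio F ^ 2" using bad0 by simp
    also have pw: "\<dots> \<le> pairwt g F"
      using pairwt_mono_sols[OF bad[of F]] by (cases "sols F = {}") (auto simp: ratio_def pairwt_def)
    finally have "0 \<le> pairwt g F" .
    moreover have "bad_frac b F * l^2 \<le> pairwt g F" if "good F"
    proof -
      have "bad_frac b F * l^2 \<le> bad_frac b F * ratio F^2"
        using good_imp(4)[OF that] l bad0 by (intro mult_left_mono power_mono) (auto simp: l_def)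
      thus ?thesis using pw by simp
    qed
    ultimately show ?thesis using l by (auto simp: field_simps)
  qed
  have bad2: "expect t (\<lambda>F. of_bool (good F) * bad_frac b F) \<le> \<epsilon> / l^2" if "t < m" for t
  proof -
    have "expect t (\<lambda>F. of_bool (good F) * bad_frac b F) \<le> expect t (\<lambda>F. (1 / l^2) * pairwt g F)"
      using bad1 by (intro expect_mono)
    also have "\<dots> = (1 / l^2) * expect t (pairwt g)" by (rule expect_cmult)
    also have "\<dots> \<le> (1 / l^2) * \<epsilon>"
      unfolding expect_pairwt using eps[OF that] by (intro mult_left_mono) auto
    finally show ?thesis by simp
  qed
  \<comment> \<open>Both bounds go by one induction: apart from bad constraints, the potential grows
    by at most \<open>\<kappa> / B\<close> times the mean of \<open>psi\<close> controlled in the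
    first.\<close>
  have "expect t (\<lambda>F. of_bool (good F) * psi F) \<le> ln R * (1 + \<kappa>) ^ t
     \<and> potential t \<le> moment M [] / R + ln R * (1 + \<kappa>) ^ t / B + real t * (\<epsilon> / l^2)" if "t \<le> m" for t
    using that
  proof (induction t)
    case 0
    show ?case by (simp add: potential_def psi_def)
  next
    case (Suc t)
    have IH: "expect t (\<lambda>F. of_bool (good F) * psi F) \<le> ln R * (1 + \<kappa>) ^ t"
        "potential t \<le> moment M [] / R + ln R * (1 + \<kappa>) ^ t / B + real t * (\<epsilon> / l^2)"
      using Suc by auto
    have "expect (Suc t) (\<lambda>F. of_bool (good F) * psi F)
        \<le> expect t (\<lambda>F. (1 + \<kappa>) * (of_bool (good F) * psi F))"
      unfolding expect_Suc
    proof (rule expect_mono)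
      fix F assume F: "F \<in> lists_of t"
      show "avg (\<lambda>c. of_bool (good (c # F)) * psi (c # F)) \<le> (1 + \<kappa>) * (of_bool (good F) * psi F)"
      proof (cases "good F")
        case True
        have "avg (\<lambda>c. of_bool (good (c # F)) * psi (c # F))
            \<le> avg (\<lambda>c. of_bool (b * ratio F \<le> ratio (c # F)) * psi (c # F))"
        proof (rule avg_mono)
          fix c
          have "0 \<le> psi (c # F)" if "b * ratio F \<le> ratio (c # F)"
          proof -
            have "0 < ratio (c # F)" using that good_imp(1)[OF True] b
              by (metis mult_pos_pos order_less_le_trans)
            thus ?thesis using good_ratio_le(2)[OF True] by (simp add: psi_def)
          qed
          thus "of_bool (good (c # F)) * psi (c # F) \<le> of_bool (b * ratio F \<le> ratio (c # F)) * psi (c # F)"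
            by auto
        qed
        also have "\<dots> \<le> (1 + \<kappa>) * psi F"
          using psi_drift[OF True] F Suc.prems by (simp add: lists_of_def \<kappa>_def)
        finally show ?thesis using True by simp
      qed simp
    qed
    also have "\<dots> = (1 + \<kappa>) * expect t (\<lambda>F. of_bool (good F) * psi F)" by (rule expect_cmult)
    also have "\<dots> \<le> (1 + \<kappa>) * (ln R * (1 + \<kappa>) ^ t)" using IH(1) \<kappa> by (intro mult_left_mono) auto
    finally have 1: "expect (Suc t) (\<lambda>F. of_bool (good F) * psi F) \<le> ln R * (1 + \<kappa>) ^ Suc t"
      by (simp add: mult_ac)
    have "potential (Suc t) \<le> expect t (\<lambda>F. (of_bool (\<not> good F) + (1/R) * (of_bool (good F) * moment (M - t) F)
      + (1/B) * (of_bool (good F) * psi F)) + ((\<kappa> / B) * (of_bool (good F) * psi F) + of_bool (good F) * bad_frac b F))"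
      unfolding potential_def expect_Suc
    proof (rule expect_mono)
      fix F assume F: "F \<in> lists_of t"
      hence len: "length F = t" by (simp add: lists_of_def)
      show "avg (\<lambda>c. of_bool (\<not> good (c # F)) + 1 / R * (of_bool (good (c # F)) * moment (M - Suc t) (c # F)) +
               1 / B * (of_bool (good (c # F)) * psi (c # F)))
         \<le> of_bool (\<not> good F) + 1 / R * (of_bool (good F) * moment (M - t) F) + 1 / B * (of_bool (good F) * psi F)
           + (\<kappa> / B * (of_bool (good F) * psi F) + of_bool (good F) * bad_frac b F)"
      proof (cases "good F")
        case True
        have "avg (\<lambda>c. of_bool (\<not> good (c # F)) + 1 / R * (of_bool (good (c # F)) * moment (M - Suc t) (c # F)) +
               1 / B * (of_bool (good (c # F)) * psi (c # F)))
           \<le> bad_frac b F + (1/R) * moment (M - t) F + (1/B) * ((1 + \<kappa>) * psi F)"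
          using avg_step[OF True _ assms(1)] len Suc.prems by (simp add: \<kappa>_def)
        also have "\<dots> = of_bool (\<not> good F) + 1 / R * (of_bool (good F) * moment (M - t) F) + 1 / B * (of_bool (good F) * psi F)
           + (\<kappa> / B * (of_bool (good F) * psi F) + of_bool (good F) * bad_frac b F)"
          using True by (simp add: algebra_simps add_divide_distrib)
        finally show ?thesis .
      qed simp
    qed
    also have "\<dots> = potential t + (\<kappa> / B * expect t (\<lambda>F. of_bool (good F) * psi F)
        + expect t (\<lambda>F. of_bool (good F) * bad_frac b F))"
      by (simp only: expect_add expect_cmult potential_def)
    also have "\<dots> \<le> (moment M [] / R + ln R * (1 + \<kappa>) ^ t / B + real t * (\<epsilon> / l^2))
        + (\<kappa> / B * (ln R * (1 + \<kappa>) ^ t) + \<epsilon> / l^2)"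
      using IH bad2[of t] Suc.prems \<kappa> assms(1) by (intro add_mono mult_left_mono) auto
    also have "\<dots> = moment M [] / R + ln R * (1 + \<kappa>) ^ Suc t / B + real (Suc t) * (\<epsilon> / l^2)"
      by (simp add: algebra_simps add_divide_distrib)
    finally show ?case using 1 by simp
  qed
  hence pot: "potential m \<le> moment M [] / R + ln R * (1 + \<kappa>) ^ m / B + real m * (\<epsilon> / l^2)" by blast
  have "expect m (\<lambda>F. of_bool (sols F = {})) \<le> potential m"
    unfolding potential_def
  proof (rule expect_mono)
    fix F
    show "of_bool (sols F = {}) \<le> of_bool (\<not> good F) + 1 / R * (of_bool (good F) * moment (M - m) F)
        + 1 / B * (of_bool (good F) * psi F)"
    proof (cases "good F")
      case True
      have "sols F \<noteq> {}" using good_imp(1)[OF True] by (auto simp: ratio_def)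
      thus ?thesis using True psi_nonneg moment_nonneg R_ge_1 assms(1) by simp
    qed auto
  qed
  thus ?thesis using pot by (simp add: \<kappa>_def l_def)
qed

end

end

section \<open>Balanced assignments\<close>

context overlap
begin

text \<open>The probability that a balanced assignment satisfies a random constraint: the
  \<open>k\<close> choices of the true position cancel its probability \<open>1 / k\<close>.\<close>

definition qs :: real where "qs = (1 - 1 / real k) ^ (k - 1)"

lemma sat_fraction: "real n ^ k * (1 - 1 / real k) ^ (k - 1) = real k * (real s * (real n - real s) ^ (k - 1))"
proof -
  have "real n ^ k = real n * real n ^ (k - 1)" using k3 by (cases k) auto
  moreover have "real n ^ (k - 1) * (1 - 1 / real k) ^ (k - 1) = (real n - real s) ^ (k - 1)"
    by (simp add: power_mult_distrib[symmetric] s_eq right_diff_distrib)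
  ultimately show ?thesis by (simp add: n_def)
qed

text \<open>The quadratic factor of \<open>h\<close> arises from \<open>(1 + J x) (1 + x / J) + J (1
  - x)^2 = k (1 - x (J - 1) / J + x^2)\<close>, the sum of the cases of equal and distinct true
  positions.\<close>

lemma sat_pair_fraction:
  assumes "a \<le> s"
  shows "real k * real a * (real n - 2 * real s + real a) ^ (k - 1)
      + real k * (real k - 1) * (real s - real a)^2 * (real n - 2 * real s + real a) ^ (k - 2)
    = real n ^ k * ((1 - 1 / real k) ^ (k - 1))^2 * h (rho a)"
proof -
  define x where "x = rho a"
  define w where "w = real n - 2 * real s + real a"
  define W where "W = real n / (real k)^2"
  have K: "0 < real k" "0 < J" using k3 J2 by auto
  have w: "w = W * J^2 * (1 + x / J)" unfolding w_def nsa_eq x_def W_def by simp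
  have a: "real a = W * (1 + J * x)" unfolding W_def x_def by (rule a_eq)
  have sa: "real s - real a = W * J * (1 - x)" unfolding W_def x_def sa_eq by simp
  have k1: "w ^ (k - 1) = w * w ^ (k - 2)"
  proof -
    have "k - 1 = Suc (k - 2)" using k3 by simp
    thus ?thesis by simp
  qed
  have "real k * real a * w ^ (k - 1) + real k * (real k - 1) * (real s - real a)^2 * w ^ (k - 2)
      = real k * w ^ (k - 2) * (real a * w + J * (real s - real a)^2)"
    unfolding k1 by (simp add: J_def algebra_simps)
  also have "real a * w + J * (real s - real a)^2 = W^2 * J^2 * ((1 + J * x) * (1 + x / J) + J * (1 - x)^2)"
    unfolding sa unfolding a w by (simp add: power2_eq_square algebra_simps)
  also have "(1 + J * x) * (1 + x / J) + J * (1 - x)^2 = real k * (1 - x * (J - 1) / J + x^2)"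
    using K unfolding k_eq by (simp add: field_simps power2_eq_square)
  also have "real k * w ^ (k - 2) * (W^2 * J^2 * (real k * (1 - x * (J - 1) / J + x^2)))
      = (real k * W * J)^2 * (W * J^2) ^ (k - 2) * h x"
    unfolding w h_def by (simp add: power2_eq_square power_mult_distrib mult_ac)
  also have "(real k * W * J)^2 * (W * J^2) ^ (k - 2) = real n ^ k * ((1 - 1 / real k) ^ (k - 1))^2"
  proof -
    have q: "1 - 1 / real k = J / real k" using K by (simp add: J_def field_simps)
    have "real k * W * J = real n * (J / real k)" using K by (simp add: W_def power2_eq_square)
    moreover have "W * J^2 = real n * (J / real k)^2" by (simp add: W_def power_divide)
    ultimately have "(real k * W * J)^2 * (W * J^2) ^ (k - 2) = (real n)^2 * (real n) ^ (k - 2) * ((J / real k)^2 * ((J / real k)^2) ^ (k - 2))"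
      by (simp only: power_mult_distrib mult_ac)
    also have "(real n)^2 * (real n) ^ (k - 2) = real n ^ k"
    proof -
      have "2 + (k - 2) = k" using k3 by simp
      thus ?thesis unfolding power_add[symmetric] by (simp only:)
    qed
    also have "(J / real k)^2 * ((J / real k)^2) ^ (k - 2) = ((J / real k) ^ (k - 1))^2"
    proof -
      have "Suc (k - 2) = k - 1" using k3 by simp
      hence "((J / real k)^2) ^ (k - 1) = (J / real k)^2 * ((J / real k)^2) ^ (k - 2)" by (metis power_Suc)
      thus ?thesis by (simp only: power_mult[symmetric] mult.commute)
    qed
    finally show ?thesis by (simp only: q)
  qed
  finally show ?thesis by (simp only: w_def x_def)
qed

lemma csp_balanced: "csp (constraints k n) (balanced n s) sat_set qs"
  unfolding qs_def
proof
  have p: "0 < 1 - 1 / real k" "1 - 1 / real k \<le> 1" using k3 by (auto simp: field_simps)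
  show "finite (constraints k n)" "finite (balanced n s)" by simp_all
  have "0 < card (constraints k n)" using n_pos by (simp add: card_constraints)
  thus "constraints k n \<noteq> {}" by auto
  have "0 < card (balanced n s)" using n_ge by (simp add: card_balanced zero_less_binomial_iff)
  thus "balanced n s \<noteq> {}" by auto
  show "0 < (1 - 1 / real k) ^ (k - 1)" "(1 - 1 / real k) ^ (k - 1) \<le> 1"
    using p by (auto intro: power_le_one)
  fix A assume "A \<in> balanced n s"
  hence A: "A \<subseteq> {..<n}" "card A = s" by (auto simp: balanced_def)
  have "real (card {c \<in> constraints k n. sat_set A c}) = (\<Sum>c\<in>{c \<in> constraints k n. sat_set A c}. 1)" by simp
  also have "\<dots> = (\<Sum>c\<in>constraints k n. if sat_set A c then 1 else 0)" by (rule sum.inter_filter) simp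
  also have "\<dots> = (\<Sum>c\<in>constraints k n. of_bool (sat_set A c))" by (intro sum.cong) auto
  also have "\<dots> = (1 - 1 / real k) ^ (k - 1) * real (card (constraints k n))"
    unfolding card_sat_single[OF A] sat_fraction[symmetric] by (simp add: card_constraints)
  finally show "real (card {c \<in> constraints k n. sat_set A c}) = (1 - 1 / real k) ^ (k - 1) * real (card (constraints k n))" .
qed

sublocale csp "constraints k n" "balanced n s" sat_set qs
  by (rule csp_balanced)

lemma card_Int_balanced_le: "A \<in> balanced n s \<Longrightarrow> card (A \<inter> B) \<le> s"
  using finite_subset[of A "{..<n}"] by (auto simp: balanced_def intro: card_mono)

lemma corr_eq:
  assumes "A \<in> balanced n s" "B \<in> balanced n s"
  shows "corr A B = h (rho (card (A \<inter> B)))"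
proof -
  have AB: "A \<subseteq> {..<n}" "card A = s" "B \<subseteq> {..<n}" "card B = s" using assms by (auto simp: balanced_def)
  have le: "card (A \<inter> B) \<le> s" by (rule card_Int_balanced_le[OF assms(1)])
  have "real (card {c \<in> constraints k n. sat_set A c \<and> sat_set B c}) = (\<Sum>c\<in>constraints k n. of_bool (sat_set A c \<and> sat_set B c))"
    by (rule card_filter_of_bool) simp
  also have "\<dots> = real n ^ k * qs^2 * h (rho (card (A \<inter> B)))"
    using card_sat_pair[OF AB] k3 sat_pair_fraction[OF le] by (simp add: qs_def)
  finally show ?thesis
    using q_pos n_pos unfolding corr_def card_constraints by simp
qed

lemma ov_eq:
  assumes "A \<in> balanced n s" "B \<in> balanced n s"
  shows "ov k n (A, B) = J / (real k)^2 * rho (card (A \<inter> B))"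
proof -
  have AB: "A \<subseteq> {..<n}" "card A = s" "B \<subseteq> {..<n}" "card B = s" using assms by (auto simp: balanced_def)
  have i: "A \<inter> B \<subseteq> {..<n}" using AB by auto
  have "(\<Sum>x<n. xi k A x * xi k B x) = (\<Sum>x<n. of_bool (x \<in> A \<inter> B) - 1 / real k * of_bool (x \<in> A) - 1 / real k * of_bool (x \<in> B) + 1 / real k * (1 / real k))"
    by (intro sum.cong refl) (auto simp: xi_def algebra_simps)
  also have "\<dots> = real (card (A \<inter> B)) - 1 / real k * real s - 1 / real k * real s + 1 / real k * (real n * (1 / real k))"
    by (simp only: sum.distrib sum_subtractf sum_distrib_left[symmetric] sum_of_bool_mem[OF i] sum_of_bool_mem[OF AB(1)] sum_of_bool_mem[OF AB(3)] AB(2,4) sum_constant card_lessThan)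
  also have "\<dots> = real (card (A \<inter> B)) - real n / (real k)^2" using k3 by (simp add: s_eq power2_eq_square)
  also have "\<dots> = real n * (J / (real k)^2 * rho (card (A \<inter> B)))"
    unfolding a_eq[of "card (A \<inter> B)"] by (simp add: algebra_simps add_divide_distrib)
  finally have "(\<Sum>x<n. xi k A x * xi k B x) = real n * (J / (real k)^2 * rho (card (A \<inter> B)))" .
  moreover have n0: "0 < n" using n_pos by simp
  \<comment> \<open>Outside its context \<open>ov_def\<close> carries premises on a set
    \<open>T\<close>; a singleton discharges them.\<close>
  note ov_def[OF k3 n0 finite.insertI[OF finite.emptyI] insert_not_empty]
  ultimately show ?thesis using n_pos by simp
qed

text \<open>Grouping pairs by the size of their intersection produces the hypergeometric weights;
  this joins the process to the overlap estimates.\<close>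

lemma pairwt_Nil_eq_mom:
  "pairwt (\<lambda>A B. f (rho (card (A \<inter> B))) * corr A B ^ t) [] = mom t f"
proof -
  have N: "0 < real (n choose s)" using n_ge by (simp add: zero_less_binomial_iff)
  have "(\<Sum>A\<in>balanced n s. \<Sum>B\<in>balanced n s. f (rho (card (A \<inter> B))) * corr A B ^ t)
      = (\<Sum>A\<in>balanced n s. \<Sum>B\<in>balanced n s. (\<lambda>a. f (rho a) * h (rho a) ^ t) (card (A \<inter> B)))"
    by (intro sum.cong refl) (simp add: corr_eq)
  also have "\<dots> = real (n choose s) * (\<Sum>a\<le>s. real ((s choose a) * ((n - s) choose (s - a))) * (f (rho a) * h (rho a) ^ t))"
    by (rule sum_balanced_pairs)
  also have "\<dots> = real (n choose s) ^ 2 * mom t f"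
    using N by (simp add: mom_def hyp_def sum_distrib_left power2_eq_square mult_ac)
  finally show ?thesis using N by (simp add: pairwt_def card_balanced)
qed

lemma moment_Nil_eq_mom: "moment t [] = mom t (\<lambda>_. 1)"
  using pairwt_Nil_eq_mom[of "\<lambda>_. 1" t] by (simp add: moment_def)

lemma sols_subset: "sols F \<subseteq> balanced n s"
  by (auto simp: sols_def)

text \<open>Multiplying \<open>bad_count_le\<close> for \<open>T = sols F\<close> by the squared
  number of solutions gives the sum over pairs that \<open>unsat_bound\<close> asks for.\<close>

lemma bad_frac_le:
  fixes \<eta> \<eta>1 \<delta> b :: real
  assumes \<eta>: "0 < \<eta>" "0 < \<eta>1" and \<delta>: "0 < \<delta>"
    and b: "b * qs \<le> (1 - 1 / real k) ^ (k - 3) * ((1 - 1 / real k)^2 - 1 / real k - (1 - 1 / real k) * \<eta>1) - 2 ^ k * (real k * \<eta>)"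
    and F: "sols F \<noteq> {}"
  defines "Cc \<equiv> 2 ^ k / \<eta>^2 + 4 ^ k / \<eta>^4 + (real k)^2 / \<eta>1^4"
  shows "bad_frac b F * real (card (sols F)) ^ 2 \<le> (\<Sum>A\<in>sols F. \<Sum>B\<in>sols F.
      Cc * ((1 + 1 / \<delta>) * (J / (real k)^2)^3 * \<bar>rho (card (A \<inter> B))\<bar> ^ 3 + \<delta> * (J / (real k)^2) * rho (card (A \<inter> B))))"
proof -
  have n0: "0 < n" using n_pos by simp
  define T where "T = sols F"
  have T: "finite T" "T \<noteq> {}" using F by (auto simp: T_def)
  have cT: "0 < real (card T)" using T by (simp add: card_gt_0_iff)
  have "ratio (c # F) < b * ratio F \<longleftrightarrow> frac_sat T c < b * qs" for c
  proof -
    have "real (card (sols (c # F))) = (\<Sum>A\<in>T. of_bool (sat_set A c))"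
      unfolding sols_Cons T_def by (rule card_filter_of_bool) simp
    hence 1: "ratio (c # F) = frac_sat T c * (real (card T) / (real (card (balanced n s)) * qs ^ length F)) / qs"
      using cT by (simp add: ratio_def frac_sat_def[OF k3 n0 T])
    have 2: "ratio F = real (card T) / (real (card (balanced n s)) * qs ^ length F)"
      by (simp add: ratio_def T_def)
    have pos: "0 < real (card T) / (real (card (balanced n s)) * qs ^ length F)"
      using cT q_pos card_S_pos by simp
    show ?thesis unfolding 1 2[symmetric] using pos q_pos unfolding 2[symmetric]
      by (simp add: pos_divide_less_eq mult.commute mult.left_commute)
  qed
  hence "bad_frac b F * (real n ^ k) = (\<Sum>c\<in>constraints k n. of_bool (frac_sat T c < b * qs))"
    using n_pos by (simp add: bad_frac_def avg_def card_constraints)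
  also have "\<dots> \<le> real n ^ k * (Cc * ((1 + 1 / \<delta>) * pavg T (\<lambda>z. \<bar>ov k n z\<bar> ^ 3) + \<delta> * pavg T (ov k n)))"
    unfolding Cc_def by (rule bad_count_le[OF k3 n0 T \<eta> \<delta> b])
  finally have "bad_frac b F \<le> Cc * ((1 + 1 / \<delta>) * pavg T (\<lambda>z. \<bar>ov k n z\<bar> ^ 3) + \<delta> * pavg T (ov k n))"
    using n_pos by (simp add: mult.commute)
  also have "\<dots> = (\<Sum>A\<in>T. \<Sum>B\<in>T. Cc * ((1 + 1 / \<delta>) * \<bar>ov k n (A, B)\<bar> ^ 3 + \<delta> * ov k n (A, B))) / real (card T) ^ 2"
    unfolding pavg_def[OF k3 n0 T]
    by (simp add: sum.cartesian_product[symmetric] case_prod_unfold sum.distrib sum_distrib_left[symmetric] add_divide_distrib sum.cartesian_product)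
      (simp add: distrib_left add_divide_distrib)
  also have "(\<Sum>A\<in>T. \<Sum>B\<in>T. Cc * ((1 + 1 / \<delta>) * \<bar>ov k n (A, B)\<bar> ^ 3 + \<delta> * ov k n (A, B)))
      = (\<Sum>A\<in>T. \<Sum>B\<in>T. Cc * ((1 + 1 / \<delta>) * (J / (real k)^2)^3 * \<bar>rho (card (A \<inter> B))\<bar> ^ 3 + \<delta> * (J / (real k)^2) * rho (card (A \<inter> B))))"
  proof (intro sum.cong refl)
    fix A B assume "A \<in> T" "B \<in> T"
    hence AB: "A \<in> balanced n s" "B \<in> balanced n s" using sols_subset by (auto simp: T_def)
    have "\<bar>J / (real k)^2 * rho (card (A \<inter> B))\<bar> = J / (real k)^2 * \<bar>rho (card (A \<inter> B))\<bar>"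
      using J2 by (simp add: abs_mult)
    thus "Cc * ((1 + 1 / \<delta>) * \<bar>ov k n (A, B)\<bar> ^ 3 + \<delta> * ov k n (A, B))
      = Cc * ((1 + 1 / \<delta>) * (J / (real k)^2)^3 * \<bar>rho (card (A \<inter> B))\<bar> ^ 3 + \<delta> * (J / (real k)^2) * rho (card (A \<inter> B)))"
      unfolding ov_eq[OF AB] by (simp only: power_mult_distrib mult.assoc)
  qed
  moreover have "0 < real (card T) ^ 2" using cT by simp
  ultimately show ?thesis unfolding T_def[symmetric] by (simp only: pos_le_divide_eq)
qed

lemma lists_of_eq: "lists_of m = instances k m n"
  by (auto simp: lists_of_def instances_def)

lemma unsat_count_le:
  "real (card {F\<in>instances k m n. \<not> satisfiable F}) \<le> expect m (\<lambda>F. of_bool (sols F = {})) * (real n ^ k) ^ m"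
proof -
  have "{F\<in>instances k m n. \<not> satisfiable F} \<subseteq> {F\<in>lists_of m. sols F = {}}"
  proof
    fix F assume F: "F \<in> {F\<in>instances k m n. \<not> satisfiable F}"
    have "sols F = {}"
    proof (rule ccontr)
      assume "sols F \<noteq> {}"
      then obtain A where "A \<in> sols F" by blast
      hence "\<forall>c\<in>set F. sat_constraint (\<lambda>i. i \<in> A) c" by (simp add: sols_def sat_set_def)
      hence "satisfiable F" unfolding satisfiable_def by blast
      thus False using F by simp
    qed
    thus "F \<in> {F\<in>lists_of m. sols F = {}}" using F by (simp add: lists_of_eq)
  qed
  hence "real (card {F\<in>instances k m n. \<not> satisfiable F}) \<le> real (card {F\<in>lists_of m. sols F = {}})"
    by (simp add: card_mono)
  also have "\<dots> = (\<Sum>F\<in>lists_of m. of_bool (sols F = {}))" by (rule card_filter_of_bool) simp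
  also have "\<dots> = expect m (\<lambda>F. of_bool (sols F = {})) * (real n ^ k) ^ m"
    using n_pos by (simp add: expect_def card_constraints)
  finally show ?thesis .
qed

end

section \<open>The limit\<close>

text \<open>An intermediate density \<open>r'\<close> leaves a reserve of \<open>J = M - m\<close>
  steps, of order \<open>n\<close>, beyond the \<open>m\<close> steps that matter; the second moment
  is controlled up to \<open>M\<close>.\<close>

lemma unsat_fraction_small:
  fixes k :: nat and r \<epsilon> :: real
  assumes k: "3 \<le> k" and r: "0 < r" "r < ln (real k) / real k" and \<epsilon>: "0 < \<epsilon>"
  obtains s0 where "\<And>s m. s0 \<le> s \<Longrightarrow> real m \<le> r * real (k * s) \<Longrightarrow>
    real (card {F\<in>instances k m (k * s). \<not> satisfiable F}) \<le> \<epsilon> * (real (k * s) ^ k) ^ m"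
proof -
  obtain r' where r': "r < r'" "r' < ln (real k) / real k" using dense[OF r(2)] by blast
  hence r': "r < r'" "0 < r'" "r' < ln (real k) / real k" using r by auto
  obtain A N where A: "0 \<le> A" and mom: "\<And>s t. N \<le> s \<Longrightarrow> 0 < s \<Longrightarrow> real t \<le> r' * real (k * s) \<Longrightarrow>
       overlap.mom k s t (\<lambda>_. 1) \<le> A \<and> \<bar>overlap.mom k s t (\<lambda>x. x)\<bar> \<le> A / real (k * s)
       \<and> overlap.mom k s t (\<lambda>x. \<bar>x\<bar> ^ 3) \<le> A / (real (k * s) * sqrt (real (k * s)))"
    using overlap_moments[OF k r'(2,3)] by blast
  define p where "p = 1 / real k"
  define q where "q = (1 - p) ^ (k - 1)"
  have p: "0 < p" "p \<le> 1/3" using k by (auto simp: p_def field_simps)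
  have q: "0 < q" using p by (simp add: q_def)
  \<comment> \<open>The margin in \<open>frac_sat_ge\<close> at \<open>\<eta>1 = \<eta> = 0\<close>,
    divided by \<open>B0\<close>. It equals \<open>1 - 3 p + p^2\<close>, positive since
    \<open>p \<le> 1/3\<close>.\<close>
  define \<gamma> where "\<gamma> = (1 - p)^2 - p"
  have \<gamma>: "0 < \<gamma>"
  proof -
    have "\<gamma> = (1 - 3 * p) + p^2" by (simp add: \<gamma>_def power2_eq_square algebra_simps)
    moreover have "0 < p^2" using p by simp
    ultimately show ?thesis using p by linarith
  qed
  \<comment> \<open>Half of the margin \<open>B0 \<gamma>\<close> goes to \<open>\<eta>1\<close>, a
    quarter to \<open>\<eta>\<close>, and a quarter is left for \<open>b q\<close>.\<close>
  define \<eta>1 where "\<eta>1 = \<gamma> / (2 * (1 - p))"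
  define B0 where "B0 = (1 - p) ^ (k - 3)"
  define \<eta> where "\<eta> = B0 * \<gamma> / (4 * 2 ^ k * real k)"
  define b where "b = min (1/2) (B0 * \<gamma> / (4 * q))"
  have B0: "0 < B0" using p by (simp add: B0_def)
  have \<eta>1: "0 < \<eta>1" using \<gamma> p by (simp add: \<eta>1_def)
  have \<eta>: "0 < \<eta>" using \<gamma> B0 k by (simp add: \<eta>_def)
  have b: "0 < b" "b < 1" using B0 \<gamma> q by (auto simp: b_def)
  have bq: "b * q \<le> B0 * ((1 - p)^2 - p - (1 - p) * \<eta>1) - 2 ^ k * (real k * \<eta>)"
  proof -
    have "b * q \<le> (B0 * \<gamma> / (4 * q)) * q" using q by (intro mult_right_mono) (auto simp: b_def)
    also have "\<dots> = B0 * \<gamma> / 4" using q by simp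
    also have "\<dots> = B0 * (\<gamma> - \<gamma> / 2) - B0 * \<gamma> / 4" by (simp add: algebra_simps)
    also have "\<gamma> / 2 = (1 - p) * \<eta>1" using p by (simp add: \<eta>1_def field_simps)
    also have "B0 * \<gamma> / 4 = 2 ^ k * (real k * \<eta>)" using k by (simp add: \<eta>_def)
    finally show ?thesis by (simp add: \<gamma>_def)
  qed
  define Cc where "Cc = 2 ^ k / \<eta>^2 + 4 ^ k / \<eta>^4 + (real k)^2 / \<eta>1^4"
  have Cc: "0 \<le> Cc" by (simp add: Cc_def)
  \<comment> \<open>Bounds the Gronwall factor \<open>(1 + 4 / (b J))^m\<close>, from
    \<open>m \<le> r n\<close> and \<open>J \<ge> (r' - r) n / 2\<close>.\<close>
  define E1 where "E1 = exp (8 * r / (b * (r' - r)))"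
  \<comment> \<open>The last entry makes the first term of \<open>unsat_bound\<close> at most
    \<open>\<epsilon> / 3\<close>; the last entry of \<open>B\<close> does the same for the second
    term.\<close>
  define R where "R = max (max (1 / q^2) A) (max 1 (3 * A / \<epsilon>))"
  have R: "1 / q^2 \<le> R" "A \<le> R" "1 \<le> R" "3 * A / \<epsilon> \<le> R" by (auto simp: R_def)
  define B where "B = max 1 (max (ln R) (3 * (ln R * E1) / \<epsilon>))"
  have B: "1 \<le> B" "ln R \<le> B" "3 * (ln R * E1) / \<epsilon> \<le> B" by (auto simp: B_def)
  define l where "l = (R * exp (- B))^2"
  have l: "0 < l" using R by (simp add: l_def)
  define f where "f x = r * x * (Cc * ((1 + x powr (1/4)) * (A / (x * sqrt x)) + x powr (-1/4) * (A / x)) / l)" for x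
  have "(\<lambda>x. r * Cc * A / l * ((1 + real x powr (1/4)) / sqrt (real x) + real x powr (-1/4))) \<longlonglongrightarrow> 0"
    by (intro tendsto_mult_right_zero) real_asymp
  moreover have "f (real x) = r * Cc * A / l * ((1 + real x powr (1/4)) / sqrt (real x) + real x powr (-1/4))" for x
    by (cases "x = 0") (simp_all add: f_def distrib_left add_divide_distrib mult_ac)
  ultimately have "(\<lambda>x. f (real x)) \<longlonglongrightarrow> 0" by simp
  then obtain s1 where s1: "\<And>x. s1 \<le> x \<Longrightarrow> f (real x) \<le> \<epsilon> / 3"
  proof -
    assume "(\<lambda>x. f (real x)) \<longlonglongrightarrow> 0"
    hence "eventually (\<lambda>x. f (real x) < \<epsilon> / 3) sequentially" using \<epsilon> by (intro order_tendstoD) auto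
    thus ?thesis using that unfolding eventually_sequentially by (meson less_imp_le)
  qed
  \<comment> \<open>The last entry ensures \<open>2 B \<le> J\<close>; its \<open>2\<close> absorbs
    the rounding in \<open>M\<close>.\<close>
  define s0 where "s0 = max (max N 1) (max s1 (nat \<lceil>(4 * B + 2) / (r' - r)\<rceil>))"
  show thesis
  proof (rule that[of s0])
    fix s m assume s: "s0 \<le> s" and m: "real m \<le> r * real (k * s)"
    have s0: "N \<le> s" "0 < s" "s1 \<le> s" "nat \<lceil>(4 * B + 2) / (r' - r)\<rceil> \<le> s" using s by (auto simp: s0_def)
    interpret o: overlap k s using k s0 by unfold_locales
    define n where "n = real (k * s)"
    have on: "o.n = k * s" by (simp add: o.n_def)
    have "1 * real s \<le> real k * real s" using k by (intro mult_right_mono) auto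
    hence sn: "real s \<le> n" by (simp add: n_def)
    have n0: "0 < n" using s0 k by (simp add: n_def)
    have qs: "o.qs = q" by (simp add: o.qs_def q_def p_def)
    define M where "M = nat \<lfloor>r' * n\<rfloor>"
    have M: "real M \<le> r' * n" "r' * n - 1 \<le> real M" using r' n0 by (auto simp: M_def)
    define J where "J = M - m"
    have rn: "4 * B + 2 \<le> (r' - r) * n"
    proof -
      have "(4 * B + 2) / (r' - r) \<le> real s" using s0(4) by linarith
      hence "(4 * B + 2) / (r' - r) \<le> n" using sn by linarith
      thus ?thesis using r' by (simp add: pos_divide_le_eq mult.commute)
    qed
    have Jr: "(r' - r) * n / 2 \<le> real J"
    proof -
      have "(r' - r) * n - 1 \<le> real M - real m" using M(2) m by (simp add: n_def algebra_simps)
      moreover have "real M - real m \<le> real J" by (simp add: J_def)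
      ultimately show ?thesis using rn B by linarith
    qed
    have BJ: "2 * B \<le> real J" using Jr rn by linarith
    have J0: "0 < J" using BJ B by (cases J) auto
    have mJ: "m + J \<le> M" using J0 by (simp add: J_def)
    have tle: "real t \<le> r' * real (k * s)" if "t \<le> M" for t
    proof -
      have "real t \<le> real M" using that by (rule of_nat_mono)
      thus ?thesis using M(1) by (simp only: n_def)
    qed
    have momM: "o.moment M [] \<le> R"
      using mom[OF s0(1,2) tle[of M]] R(2) unfolding o.moment_Nil_eq_mom by simp
    define \<delta> where "\<delta> = n powr (-1/4)"
    have \<delta>: "0 < \<delta>" using n0 by (simp add: \<delta>_def)
    have \<delta>i: "1 / \<delta> = n powr (1/4)" using n0 by (simp add: \<delta>_def powr_minus_divide)
    define c where "c = o.J / (real k)^2"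
    have c: "0 \<le> c" "c \<le> 1"
    proof -
      show "0 \<le> c" using o.J2 by (simp add: c_def)
      have "o.J \<le> real k * 1" by (simp add: o.J_def)
      also have "\<dots> \<le> real k * real k" using k by (intro mult_left_mono) auto
      finally show "c \<le> 1" using k by (simp add: c_def power2_eq_square divide_le_eq_1_pos)
    qed
    define G where "G x = Cc * ((1 + 1 / \<delta>) * c ^ 3 * \<bar>x\<bar> ^ 3 + \<delta> * c * x)" for x
    define e where "e = Cc * ((1 + n powr (1/4)) * (A / (n * sqrt n)) + \<delta> * (A / n))"
    have bound: "o.expect m (\<lambda>F. of_bool (o.sols F = {}))
      \<le> o.moment M [] / R + ln R * (1 + 4 / (b * real J)) ^ m / B + real m * (e / (R * exp (- B))^2)"
    proof (rule o.unsat_bound[OF J0 mJ R(1)[folded qs] momM B(2) BJ b])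
      show "0 < B" using B by simp
      fix F assume "o.sols F \<noteq> {}"
      from o.bad_frac_le[OF \<eta> \<eta>1 \<delta> _ this, of b]
      show "o.bad_frac b F * (real (card (o.sols F)))\<^sup>2 \<le> (\<Sum>A\<in>o.sols F. \<Sum>B\<in>o.sols F. G (o.rho (card (A \<inter> B))))"
        using bq unfolding qs by (simp add: G_def Cc_def c_def B0_def p_def)
    next
      fix t assume "t < m"
      hence "t \<le> M" using mJ by simp
      note mt = mom[OF s0(1,2) tle[OF this]]
      have "o.pairwt (\<lambda>A B. G (o.rho (card (A \<inter> B))) * o.corr A B ^ t) [] = o.mom t G"
        by (rule o.pairwt_Nil_eq_mom)
      also have "\<dots> = Cc * ((1 + 1 / \<delta>) * c ^ 3 * o.mom t (\<lambda>x. \<bar>x\<bar> ^ 3) + \<delta> * c * o.mom t (\<lambda>x. x))"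
        unfolding G_def[abs_def] by (simp only: o.mom_cmult o.mom_add)
      also have "\<dots> \<le> e"
        unfolding e_def
      proof (intro mult_left_mono[OF _ Cc] add_mono)
        have "c ^ 3 \<le> 1" using c by (intro power_le_one)
        hence c3: "(1 + 1 / \<delta>) * c ^ 3 \<le> (1 + 1 / \<delta>) * 1" using \<delta> by (intro mult_left_mono) auto
        have "(1 + 1 / \<delta>) * c ^ 3 * o.mom t (\<lambda>x. \<bar>x\<bar> ^ 3) \<le> ((1 + 1 / \<delta>) * 1) * (A / (n * sqrt n))"
        proof (rule mult_mono[OF c3])
          show "o.mom t (\<lambda>x. \<bar>x\<bar> ^ 3) \<le> A / (n * sqrt n)" using mt by (simp add: n_def)
          show "0 \<le> (1 + 1 / \<delta>) * 1" using \<delta> by simp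
          show "0 \<le> o.mom t (\<lambda>x. \<bar>x\<bar> ^ 3)" by (intro o.mom_nonneg) simp
        qed
        thus "(1 + 1 / \<delta>) * c ^ 3 * o.mom t (\<lambda>x. \<bar>x\<bar> ^ 3) \<le> (1 + n powr (1/4)) * (A / (n * sqrt n))"
          using \<delta>i by simp
        have "c * o.mom t (\<lambda>x. x) \<le> c * (A / n)" using mt c by (intro mult_left_mono) (auto simp: n_def)
        also have "\<dots> \<le> 1 * (A / n)" using c A n0 by (intro mult_right_mono) auto
        finally have "\<delta> * (c * o.mom t (\<lambda>x. x)) \<le> \<delta> * (A / n)" using \<delta> by (intro mult_left_mono) auto
        thus "\<delta> * c * o.mom t (\<lambda>x. x) \<le> \<delta> * (A / n)" by (simp only: mult.assoc)
      qed
      finally show "o.pairwt (\<lambda>A B. G (o.rho (card (A \<inter> B))) * o.corr A B ^ t) [] \<le> e" .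
    qed
    have t1: "o.moment M [] / R \<le> \<epsilon> / 3"
    proof -
      have "o.moment M [] \<le> A"
        using mom[OF s0(1,2) tle[of M]] unfolding o.moment_Nil_eq_mom by simp
      also have "3 * A \<le> R * \<epsilon>" using R(4) \<epsilon> by (simp add: pos_divide_le_eq)
      hence "A \<le> (\<epsilon> / 3) * R" by (simp add: mult.commute)
      finally show ?thesis using R(3) by (simp add: pos_divide_le_eq)
    qed
    have t2: "ln R * (1 + 4 / (b * real J)) ^ m / B \<le> \<epsilon> / 3"
    proof -
      have "(1 + 4 / (b * real J)) ^ m \<le> exp (4 / (b * real J)) ^ m"
        using b J0 by (intro power_mono exp_ge_add_one_self) auto
      also have "\<dots> = exp (real m * (4 / (b * real J)))" by (rule exp_of_nat_mult[symmetric])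
      also have "\<dots> \<le> E1"
      proof -
        have J1: "0 < (r' - r) * n / 2" using r' n0 by simp
        have "real m * (4 / (b * real J)) \<le> (r * n) * (4 / (b * ((r' - r) * n / 2)))"
          using m b J0 Jr J1 r by (intro mult_mono divide_left_mono mult_left_mono) (auto simp: n_def)
        also have "\<dots> = 8 * r / (b * (r' - r))" using n0 by simp
        finally show ?thesis by (simp add: E1_def)
      qed
      finally have "ln R * (1 + 4 / (b * real J)) ^ m \<le> ln R * E1" using R(3) by (intro mult_left_mono) auto
      also have "3 * (ln R * E1) \<le> B * \<epsilon>" using B(3) \<epsilon> by (simp add: pos_divide_le_eq)
      hence "ln R * E1 \<le> (\<epsilon> / 3) * B" by (simp add: mult.commute)
      finally show ?thesis using B(1) by (simp add: pos_divide_le_eq)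
    qed
    have t3: "real m * (e / (R * exp (- B))^2) \<le> \<epsilon> / 3"
    proof -
      have e0: "0 \<le> e" unfolding e_def using Cc A n0 \<delta>
        by (intro mult_nonneg_nonneg add_nonneg_nonneg divide_nonneg_nonneg) auto
      have "real m * (e / l) \<le> (r * n) * (e / l)" using m e0 l by (intro mult_right_mono) (auto simp: n_def)
      also have "\<dots> = f (real (k * s))" by (simp add: f_def e_def \<delta>_def n_def)
      also have "\<dots> \<le> \<epsilon> / 3"
      proof (rule s1)
        have "1 * s \<le> k * s" using k by (intro mult_right_mono) auto
        thus "s1 \<le> k * s" using s0(3) by linarith
      qed
      finally show ?thesis by (simp add: l_def)
    qed
    have "o.expect m (\<lambda>F. of_bool (o.sols F = {})) \<le> \<epsilon>" using bound t1 t2 t3 by linarith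
    hence "o.expect m (\<lambda>F. of_bool (o.sols F = {})) * (real o.n ^ k) ^ m \<le> \<epsilon> * (real o.n ^ k) ^ m"
      by (intro mult_right_mono) auto
    thus "real (card {F\<in>instances k m (k * s). \<not> satisfiable F}) \<le> \<epsilon> * (real (k * s) ^ k) ^ m"
      using o.unsat_count_le[of m] unfolding on by linarith
  qed
qed

lemma finite_instances: "finite (instances k m n)"
  and card_instances: "card (instances k m n) = (n ^ k) ^ m"
proof -
  have e: "instances k m n = {cs. set cs \<subseteq> constraints k n \<and> length cs = m}"
    by (auto simp: instances_def)
  show "finite (instances k m n)" unfolding e by (intro finite_lists_length_eq) simp
  show "card (instances k m n) = (n ^ k) ^ m"
    unfolding e by (subst card_lists_length_eq) (simp_all add: card_constraints)
qed

lemma prob_sat_eq: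
  assumes "0 < n"
  shows "1 - prob_sat k m n = real (card {F\<in>instances k m n. \<not> satisfiable F}) / (real n ^ k) ^ m"
proof -
  let ?I = "instances k m n"
  have c: "0 < card ?I" using assms by (simp add: card_instances)
  hence ne: "?I \<noteq> {}" by auto
  have "prob_sat k m n = real (card (?I \<inter> {cs. satisfiable cs})) / real (card ?I)"
    unfolding prob_sat_def random_instance_def using measure_pmf_of_set[OF ne finite_instances] by simp
  moreover have "card ?I = card (?I \<inter> {cs. satisfiable cs}) + card {F\<in>?I. \<not> satisfiable F}"
  proof -
    have "?I = (?I \<inter> {cs. satisfiable cs}) \<union> {F\<in>?I. \<not> satisfiable F}" by auto
    thus ?thesis by (metis (no_types, lifting) card_Un_disjoint finite_instances finite_Un Int_iff disjoint_iff mem_Collect_eq)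
  qed
  hence "real (card {F\<in>?I. \<not> satisfiable F}) = real (card ?I) - real (card (?I \<inter> {cs. satisfiable cs}))" by simp
  ultimately have "1 - prob_sat k m n = real (card {F\<in>?I. \<not> satisfiable F}) / real (card ?I)"
    using c by (simp add: diff_divide_distrib)
  thus ?thesis by (simp add: card_instances)
qed

theorem mainTheorem3:
  fixes k :: nat and r :: real
  assumes "k \<ge> 3" and "r > 0" and "r < ln (real k) / real k"
  shows "(\<lambda>n. prob_sat k (nat \<lfloor>r * real n\<rfloor>) n) \<longlonglongrightarrow> 1"
proof (rule LIMSEQ_I)
  fix \<epsilon> :: real assume \<epsilon>: "0 < \<epsilon>"
  \<comment> \<open>The exponential bounds the cost of padding, since at most \<open>k\<close>
    variables are added and \<open>m \<le> r n\<close>.\<close>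
  define e where "e = \<epsilon> / (2 * exp ((real k)^2 * r))"
  have e: "0 < e" using \<epsilon> by (simp add: e_def)
  obtain s0 where s0: "\<And>s m. s0 \<le> s \<Longrightarrow> real m \<le> r * real (k * s) \<Longrightarrow>
    real (card {F\<in>instances k m (k * s). \<not> satisfiable F}) \<le> e * (real (k * s) ^ k) ^ m"
    using unsat_fraction_small[OF assms(1,2,3) e] by blast
  show "\<exists>n0. \<forall>n\<ge>n0. norm (prob_sat k (nat \<lfloor>r * real n\<rfloor>) n - 1) < \<epsilon>"
  proof (intro exI allI impI)
    fix n assume n: "n \<ge> k * s0 + 1"
    \<comment> \<open>Enlarging the variable set to the next multiple \<open>N\<close> of \<open>k\<close> costs only the constant factor \<open>(N/n)^(k m)\<close>.\<close>
    define m where "m = nat \<lfloor>r * real n\<rfloor>"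
    define s where "s = n div k + 1"
    define N where "N = k * s"
    have m: "real m \<le> r * real n" using assms(2) by (simp add: m_def)
    have n0: "0 < n" using n by simp
    have "k * (n div k) + n mod k = n" "n mod k < k" "N = k * (n div k) + k"
      using assms(1) by (simp_all add: N_def s_def)
    hence N: "n \<le> N" "N \<le> n + k" by linarith+
    have ss: "s0 \<le> s"
    proof -
      have "k * s0 \<le> k * s" using n N(1) unfolding N_def by linarith
      thus ?thesis using assms(1) by simp
    qed
    have rN: "real m \<le> r * real (k * s)"
    proof -
      have "r * real n \<le> r * real N" using N assms(2) by (intro mult_left_mono) auto
      thus ?thesis using m by (simp add: N_def)
    qed
    \<comment> \<open>Satisfiability quantifies over assignments of all naturals, so it is
      unaffected by the number of variables.\<close>
    have sub: "{F\<in>instances k m n. \<not> satisfiable F} \<subseteq> {F\<in>instances k m N. \<not> satisfiable F}"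
      using N(1) by (fastforce simp: instances_def constraints_def)
    have "real (card {F\<in>instances k m n. \<not> satisfiable F}) \<le> real (card {F\<in>instances k m N. \<not> satisfiable F})"
      using sub finite_instances by (simp add: card_mono)
    also have "\<dots> \<le> e * (real N ^ k) ^ m" using s0[OF ss rN] by (simp add: N_def)
    also have "\<dots> \<le> e * (exp ((real k)^2 * r) * (real n ^ k) ^ m)"
    proof (intro mult_left_mono)
      have "real N \<le> real n + real k" using N(2) by linarith
      also have "\<dots> = real n * (1 + real k / real n)" using n0 by (simp add: distrib_left)
      also have "\<dots> \<le> real n * exp (real k / real n)" by (intro mult_left_mono exp_ge_add_one_self) auto
      finally have "(real N ^ k) ^ m \<le> ((real n * exp (real k / real n)) ^ k) ^ m" by (intro power_mono) auto
      also have "\<dots> = exp (real (k * m) * (real k / real n)) * (real n ^ k) ^ m"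
        by (simp add: power_mult_distrib power_mult[symmetric] exp_of_nat_mult[symmetric])
      also have "\<dots> \<le> exp ((real k)^2 * r) * (real n ^ k) ^ m"
      proof (intro mult_right_mono)
        have "real (k * m) * (real k / real n) = (real k)^2 * (real m / real n)" by (simp add: power2_eq_square)
        also have "\<dots> \<le> (real k)^2 * r" using m n0 by (intro mult_left_mono) (auto simp: pos_divide_le_eq)
        finally show "exp (real (k * m) * (real k / real n)) \<le> exp ((real k)^2 * r)" by simp
      qed auto
      finally show "(real N ^ k) ^ m \<le> exp ((real k)^2 * r) * (real n ^ k) ^ m" .
    qed (use e in simp)
    also have "\<dots> = (\<epsilon> / 2) * (real n ^ k) ^ m" by (simp add: e_def)
    finally have "1 - prob_sat k m n \<le> \<epsilon> / 2"
      unfolding prob_sat_eq[OF n0] using n0 by (simp add: pos_divide_le_eq)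
    moreover have "prob_sat k m n \<le> 1" unfolding prob_sat_def by (rule measure_pmf.prob_le_1)
    ultimately show "norm (prob_sat k (nat \<lfloor>r * real n\<rfloor>) n - 1) < \<epsilon>"
      using \<epsilon> unfolding m_def[symmetric] by simp
  qed
qed

end
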